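(* Identity between representatives, $(u_\varepsilon)_\varepsilon+\mathcal{N}_{\mathscr{S}}(\mathbb{R}^n)\mapsto(u_\varepsilon)_\varepsilon+\mathcal{N}_\tau(\mathbb{R}^n)$, defines a $\widetilde{\mathbb{C}}$-linear continuous embedding (injective continuous map) of (i) $\mathcal{G}_{\mathscr{S}}(\mathbb{R}^n)$ into $\mathcal{G}_\tau(\mathbb{R}^n)$. Integration, $u\mapsto\big(v\mapsto\int_{\mathbb{R}^n}u(y)v(y)\,dy\big)$, defines a $\widetilde{\mathbb{C}}$-linear continuous embedding of (ii) $\mathcal{G}_\tau(\mathbb{R}^n)$ into $\mathcal{L}(\mathcal{G}_{\mathscr{S}}(\mathbb{R}^n),\widetilde{\mathbb{C}})$.
   Context: All nets are indexed by $\varepsilon\in(0,1]$ and $O$-estimates are for $\varepsilon\to 0$. Generalized numbers: $\widetilde{\mathbb{C}}$ is the ring of nets $(z_\varepsilon)_\varepsilon\in\mathbb{C}^{(0,1]}$ with $|z_\varepsilon|=O(\varepsilon^{-N})$ for some $N\in\mathbb{N}$, modulo the nets with $|z_\varepsilon|=O(\varepsilon^q)$ for all $q\in\mathbb{N}$. For $z=[(z_\varepsilon)_\varepsilon]$, $\mathrm{v}(z)=\sup\{b\in\mathbb{R}: |z_\varepsilon|=O(\varepsilon^b)\}$ and $|z|_{\mathrm e}=e^{-\mathrm{v}(z)}$; $\widetilde{\mathbb{C}}$ carries the topology of the ultrametric $|z-z'|_{\mathrm e}$. An ultra-pseudo-seminorm on a $\widetilde{\mathbb{C}}$-module $\mathcal{M}$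 is a map $\mathcal{P}:\mathcal{M}\to[0,\infty)$ with $\mathcal{P}(0)=0$, $\mathcal{P}(\lambda u)\le|\lambda|_{\mathrm e}\mathcal{P}(u)$ for $\lambda\in\widetilde{\mathbb{C}}$, equality holding if $\lambda=[(c\varepsilon^a)_\varepsilon]$ with $c\in\mathbb{C}\setminus\{0\}$, $a\in\mathbb{R}$, and $\mathcal{P}(u+v)\le\max\{\mathcal{P}(u),\mathcal{P}(v)\}$. Locally convex $\widetilde{\mathbb{C}}$-linear topologies are those determined by families of ultra-pseudo-seminorms. $\mathcal{G}_{\mathscr{S}}(\mathbb{R}^n)=\mathcal{E}_{\mathscr{S}}(\mathbb{R}^n)/\mathcal{N}_{\mathscr{S}}(\mathbb{R}^n)$, where, with $p_j(f)=\sup_{x\in\mathbb{R}^n,|\alpha|\le j}(1+|x|)^j|\partial^\alpha f(x)|$, $\mathcal{E}_{\mathscr{S}}(\mathbb{R}^n)$ is the set of nets $(u_\varepsilon)_\varepsilon\in\mathscr{S}(\mathbb{R}^n)^{(0,1]}$ such that for all $j\in\mathbb{N}$ there is $N\in\mathbb{N}$ with $p_j(u_\varepsilon)=O(\varepsilon^{-N})$, and $\mathcal{N}_{\mathscr{S}}(\mathbb{R}^n)$ is the set of nets with $p_j(u_\varepsilon)=O(\varepsilon^q)$ for all $j,q\in\mathbb{N}$. It carries the topology of the ultra-pseudo-seminorms $\mathcal{P}_j(u)=\exp(-\sup\{b\in\mathbb{R}:p_j(u_\varepsilon)=O(\varepsilon^b)\})$, $j\in\mathbb{N}$. $\mathcal{G}_\tau(\mathbb{R}^n)=\mathcal{E}_\tau(\mathbb{R}^n)/\mathcal{N}_\tau(\mathbb{R}^n)$,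 where $\mathcal{E}_\tau(\mathbb{R}^n)$ is the set of nets $(u_\varepsilon)_\varepsilon\in\mathcal{O}_M(\mathbb{R}^n)^{(0,1]}$ such that for all $\alpha\in\mathbb{N}^n$ there is $N\in\mathbb{N}$ with $\sup_{x}(1+|x|)^{-N}|\partial^\alpha u_\varepsilon(x)|=O(\varepsilon^{-N})$, and $\mathcal{N}_\tau(\mathbb{R}^n)$ is the set of nets such that for all $\alpha$ there is $N$ such that for all $q\in\mathbb{N}$, $\sup_{x}(1+|x|)^{-N}|\partial^\alpha u_\varepsilon(x)|=O(\varepsilon^{q})$. Here $\mathcal{O}_M(\mathbb{R}^n)$ is the space of smooth functions all of whose derivatives have at most polynomial growth. Topology of $\mathcal{G}_\tau(\mathbb{R}^n)$: for $m,N\in\mathbb{N}$ let $\mathcal{E}^m_N(\mathbb{R}^n)$ be the set of nets in $\mathcal{O}_M(\mathbb{R}^n)^{(0,1]}$ with $\sup_{x\in\mathbb{R}^n,|\alpha|\le m}(1+|x|)^{-N}|\partial^\alpha u_\varepsilon(x)|=O(\varepsilon^{-M})$ for some $M\in\mathbb{N}$, and $\mathcal{G}^m_{N,\mathscr{S}}(\mathbb{R}^n)=\mathcal{E}^m_N(\mathbb{R}^n)/\mathcal{N}_{\mathscr{S}}(\mathbb{R}^n)$ with the topology of the single ultra-pseudo-seminorm $\mathcal{P}^m_N(u)=\exp(-\sup\{b\in\mathbb{R}:\sup_{x,|\alpha|\le m}(1+|x|)^{-N}|\partial^\alpha u_\varepsilon(x)|=O(\varepsilon^b)\})$. $\mathcal{G}^m_{\tau,\mathscr{S}}(\mathbb{R}^n)=\bigcup_N\mathcal{G}^m_{N,\mathscr{S}}(\mathbb{R}^n)$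 carries the inductive limit topology (finest locally convex $\widetilde{\mathbb{C}}$-linear topology making the inclusions continuous), $\mathcal{G}_{\tau,\mathscr{S}}(\mathbb{R}^n)=\bigcap_m\mathcal{G}^m_{\tau,\mathscr{S}}(\mathbb{R}^n)=\mathcal{E}_\tau(\mathbb{R}^n)/\mathcal{N}_{\mathscr{S}}(\mathbb{R}^n)$ carries the initial topology with respect to the inclusions into the $\mathcal{G}^m_{\tau,\mathscr{S}}(\mathbb{R}^n)$, and $\mathcal{G}_\tau(\mathbb{R}^n)$ carries the finest locally convex $\widetilde{\mathbb{C}}$-linear topology making the surjection $\mathcal{G}_{\tau,\mathscr{S}}(\mathbb{R}^n)\to\mathcal{G}_\tau(\mathbb{R}^n)$, $(u_\varepsilon)_\varepsilon+\mathcal{N}_{\mathscr{S}}(\mathbb{R}^n)\mapsto(u_\varepsilon)_\varepsilon+\mathcal{N}_\tau(\mathbb{R}^n)$, continuous. $\mathcal{L}(\mathcal{M},\widetilde{\mathbb{C}})$ is the space of continuous $\widetilde{\mathbb{C}}$-linear functionals on $\mathcal{M}$, with the topology of uniform convergence on bounded subsets, determined by $T\mapsto\sup_{u\in B}|Tu|_{\mathrm e}$, $B\subseteq\mathcal{M}$ bounded; $B$ is bounded if every continuous ultra-pseudo-seminorm is bounded on $B$. For $u\in\mathcal{G}_\tau(\mathbb{R}^n)$, $v\in\mathcal{G}_{\mathscr{S}}(\mathbb{R}^n)$, $\int_{\mathbb{R}^n}u(y)v(y)\,dy:=[(\int_{\mathbb{R}^n}u_\varepsilon(y)v_\varepsi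lon(y)\,dy)_\varepsilon]\in\widetilde{\mathbb{C}}$.
   Formalization: The quotients modulo N_S used to define the topology of G_τ are not C̃-modules (a negligible number times 1 is not in N_S), so ultra-pseudo-seminorm conditions on λu there are required for every product of representatives of λ and u. *)

theory Defs
  imports "HOL-Analysis.Analysis" "HOL-Library.Function_Algebras"
begin

section \<open>Nets and asymptotic estimates\<close>

text \<open>
  A net \<open>(z\<^sub>\<epsilon>)\<close> indexed by \<open>\<epsilon> \<in> (0,1]\<close> is a function on \<^typ>\<open>real\<close>; its values outside
  \<open>(0,1]\<close> never matter, and nets which agree on \<open>(0,1]\<close> are identified by the quotients below.
  Since the suprema occurring in the seminorms may be infinite, the estimate
  \<open>g\<^sub>\<epsilon> = O(\<epsilon>\<^sup>b)\<close> is formulated for nets in \<open>[0,\<infinity>]\<close>; see \<open>eps_bigo_iff_bigo\<close>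
  for the agreement with Landau symbols.
\<close>

definition eps_bigo :: "(real \<Rightarrow> ennreal) \<Rightarrow> real \<Rightarrow> bool" where
  "eps_bigo g b \<longleftrightarrow> (\<exists>C::real. \<forall>\<^sub>F \<epsilon> in at_right 0. g \<epsilon> \<le> ennreal (C * \<epsilon> powr b))"

definition valuation :: "(real \<Rightarrow> ennreal) \<Rightarrow> ereal" where
  "valuation g = Sup {ereal b | b. eps_bigo g b}"

text \<open>
  \<open>exp (- valuation g)\<close>, with \<open>exp (- \<infinity>) = 0\<close>. Valuation \<open>-\<infinity>\<close> does not occur for moderate nets.
\<close>

definition exp_val :: "(real \<Rightarrow> ennreal) \<Rightarrow> real" where
  "exp_val g = (if valuation g = \<infinity> then 0 else exp (- real_of_ereal (valuation g)))"

lemma eventually_eps: "\<forall>\<^sub>F \<epsilon>::real in at_right 0. 0 < \<epsilon> \<and> \<epsilon> \<le> 1"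
  unfolding eventually_at_right_field by (intro exI[of _ 1]) auto

lemma eps_bigo_iff_bigo:
  fixes z :: "real \<Rightarrow> complex"
  shows "eps_bigo (\<lambda>\<epsilon>. ennreal (cmod (z \<epsilon>))) b \<longleftrightarrow> z \<in> O[at_right 0](\<lambda>\<epsilon>. of_real (\<epsilon> powr b))"
proof
  assume "eps_bigo (\<lambda>\<epsilon>. ennreal (cmod (z \<epsilon>))) b"
  then obtain C where C: "\<forall>\<^sub>F \<epsilon> in at_right 0. ennreal (cmod (z \<epsilon>)) \<le> ennreal (C * \<epsilon> powr b)"
    unfolding eps_bigo_def by blast
  show "z \<in> O[at_right 0](\<lambda>\<epsilon>. of_real (\<epsilon> powr b))"
  proof (rule bigoI[where c = "max C 0"])
    show "\<forall>\<^sub>F \<epsilon> in at_right 0. cmod (z \<epsilon>) \<le> max C 0 * cmod (of_real (\<epsilon> powr b))"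
      using C
    proof eventually_elim
      case (elim \<epsilon>)
      have "C * \<epsilon> powr b \<le> max C 0 * \<epsilon> powr b" by (intro mult_right_mono) auto
      then have "ennreal (cmod (z \<epsilon>)) \<le> ennreal (max C 0 * \<epsilon> powr b)"
        using elim by (meson ennreal_leI order_trans)
      then show ?case by (simp add: ennreal_le_iff)
    qed
  qed
next
  assume "z \<in> O[at_right 0](\<lambda>\<epsilon>. of_real (\<epsilon> powr b))"
  then obtain C where C: "\<forall>\<^sub>F \<epsilon> in at_right 0. cmod (z \<epsilon>) \<le> C * cmod (of_real (\<epsilon> powr b))"
    by (elim landau_o.bigE)
  show "eps_bigo (\<lambda>\<epsilon>. ennreal (cmod (z \<epsilon>))) b"
    unfolding eps_bigo_def
    by (rule exI[of _ C], rule eventually_mono[OF C]) (auto intro!: ennreal_leI)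
qed

lemma eps_bigo_obtain:
  assumes "eps_bigo g b"
  obtains C where "C \<ge> 0" "\<forall>\<^sub>F \<epsilon> in at_right 0. g \<epsilon> \<le> ennreal (C * \<epsilon> powr b)"
proof -
  from assms obtain C where C: "\<forall>\<^sub>F \<epsilon> in at_right 0. g \<epsilon> \<le> ennreal (C * \<epsilon> powr b)"
    unfolding eps_bigo_def by blast
  have "\<forall>\<^sub>F \<epsilon> in at_right 0. g \<epsilon> \<le> ennreal (max C 0 * \<epsilon> powr b)"
    using C
  proof eventually_elim
    case (elim \<epsilon>)
    have "C * \<epsilon> powr b \<le> max C 0 * \<epsilon> powr b" by (intro mult_right_mono) auto
    then show ?case using elim by (meson ennreal_leI order_trans)
  qed
  then show ?thesis using that[of "max C 0"] by simp
qed

lemma eps_bigo_mono_ev: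
  assumes "eps_bigo g b" "\<forall>\<^sub>F \<epsilon> in at_right 0. h \<epsilon> \<le> g \<epsilon>"
  shows "eps_bigo h b"
proof -
  from assms(1) obtain C where C: "\<forall>\<^sub>F \<epsilon> in at_right 0. g \<epsilon> \<le> ennreal (C * \<epsilon> powr b)"
    unfolding eps_bigo_def by blast
  show ?thesis unfolding eps_bigo_def
    by (rule exI[of _ C]) (use C assms(2) in eventually_elim, auto intro: order_trans)
qed

lemma eps_bigo_mono:
  assumes "eps_bigo g b" "\<And>\<epsilon>. 0 < \<epsilon> \<Longrightarrow> \<epsilon> \<le> 1 \<Longrightarrow> h \<epsilon> \<le> g \<epsilon>"
  shows "eps_bigo h b"
  by (rule eps_bigo_mono_ev[OF assms(1)], rule eventually_mono[OF eventually_eps])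
     (use assms(2) in auto)

lemma eps_bigo_weaken:
  assumes "eps_bigo g b" "a \<le> b"
  shows "eps_bigo g a"
proof -
  obtain C where C: "C \<ge> 0" "\<forall>\<^sub>F \<epsilon> in at_right 0. g \<epsilon> \<le> ennreal (C * \<epsilon> powr b)"
    using eps_bigo_obtain[OF assms(1)] by blast
  show ?thesis unfolding eps_bigo_def
  proof (rule exI[of _ C], use C(2) eventually_eps in eventually_elim)
    case (elim \<epsilon>)
    have "\<epsilon> powr b \<le> \<epsilon> powr a" using elim assms(2) by (intro powr_mono') auto
    then have "C * \<epsilon> powr b \<le> C * \<epsilon> powr a" using C(1) by (rule mult_left_mono)
    then show ?case using elim(1) by (meson ennreal_leI order_trans)
  qed
qed

lemma eps_bigo_add:
  assumes "eps_bigo g b" "eps_bigo h b"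
  shows "eps_bigo (\<lambda>\<epsilon>. g \<epsilon> + h \<epsilon>) b"
proof -
  obtain C where C: "C \<ge> 0" "\<forall>\<^sub>F \<epsilon> in at_right 0. g \<epsilon> \<le> ennreal (C * \<epsilon> powr b)"
    using eps_bigo_obtain[OF assms(1)] by blast
  obtain D where D: "D \<ge> 0" "\<forall>\<^sub>F \<epsilon> in at_right 0. h \<epsilon> \<le> ennreal (D * \<epsilon> powr b)"
    using eps_bigo_obtain[OF assms(2)] by blast
  show ?thesis unfolding eps_bigo_def
  proof (rule exI[of _ "C + D"], use C(2) D(2) in eventually_elim)
    case (elim \<epsilon>)
    have "g \<epsilon> + h \<epsilon> \<le> ennreal (C * \<epsilon> powr b) + ennreal (D * \<epsilon> powr b)"
      using elim by (intro add_mono)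
    also have "\<dots> = ennreal ((C + D) * \<epsilon> powr b)"
      using C(1) D(1) by (simp add: ennreal_plus[symmetric] distrib_right del: ennreal_plus)
    finally show ?case .
  qed
qed

lemma eps_bigo_mult:
  assumes "eps_bigo g a" "eps_bigo h b"
  shows "eps_bigo (\<lambda>\<epsilon>. g \<epsilon> * h \<epsilon>) (a + b)"
proof -
  obtain C where C: "C \<ge> 0" "\<forall>\<^sub>F \<epsilon> in at_right 0. g \<epsilon> \<le> ennreal (C * \<epsilon> powr a)"
    using eps_bigo_obtain[OF assms(1)] by blast
  obtain D where D: "D \<ge> 0" "\<forall>\<^sub>F \<epsilon> in at_right 0. h \<epsilon> \<le> ennreal (D * \<epsilon> powr b)"
    using eps_bigo_obtain[OF assms(2)] by blast
  show ?thesis unfolding eps_bigo_def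
  proof (rule exI[of _ "C * D"], use C(2) D(2) in eventually_elim)
    case (elim \<epsilon>)
    have "g \<epsilon> * h \<epsilon> \<le> ennreal (C * \<epsilon> powr a) * ennreal (D * \<epsilon> powr b)"
      using elim by (intro mult_mono) auto
    also have "\<dots> = ennreal (C * D * \<epsilon> powr (a + b))"
      using C(1) D(1) by (simp add: ennreal_mult[symmetric] powr_add mult_ac)
    finally show ?case .
  qed
qed

lemma eps_bigo_zero [simp]: "eps_bigo (\<lambda>_. 0) b"
  unfolding eps_bigo_def by simp

lemma eps_bigo_less_valuation:
  assumes "ereal b < valuation g"
  shows "eps_bigo g b"
proof -
  obtain c where "eps_bigo g c" "ereal b < ereal c"
    using assms unfolding valuation_def less_Sup_iff by blast
  then show ?thesis by (intro eps_bigo_weaken[of g c b]) auto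
qed

lemma exp_val_le:
  assumes "eps_bigo g b"
  shows "exp_val g \<le> exp (- b)"
proof -
  have "ereal b \<le> valuation g" unfolding valuation_def using assms by (intro Sup_upper) auto
  then show ?thesis unfolding exp_val_def
    by (cases "valuation g") auto
qed

lemma exp_val_less:
  assumes "exp_val g < exp (- b)" "\<exists>a. eps_bigo g a"
  shows "eps_bigo g b"
proof (rule eps_bigo_less_valuation)
  from assms(2) obtain a where "eps_bigo g a" by blast
  then have "ereal a \<le> valuation g" unfolding valuation_def by (intro Sup_upper) auto
  then show "ereal b < valuation g" using assms(1) unfolding exp_val_def
    by (cases "valuation g") auto
qed

lemma exp_val_nonneg: "exp_val g \<ge> 0"
  by (simp add: exp_val_def)

lemma exp_val_cong:
  assumes "\<And>b. eps_bigo g b \<longleftrightarrow> eps_bigo h b"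
  shows "exp_val g = exp_val h"
  using assms by (simp add: exp_val_def valuation_def)

lemma exp_val_eq_0:
  assumes "\<exists>a. eps_bigo g a"
  shows "exp_val g = 0 \<longleftrightarrow> (\<forall>q::nat. eps_bigo g (real q))"
proof
  assume "exp_val g = 0"
  then show "\<forall>q::nat. eps_bigo g (real q)" using exp_val_less[OF _ assms] by simp
next
  assume *: "\<forall>q::nat. eps_bigo g (real q)"
  show "exp_val g = 0"
  proof (rule ccontr)
    assume "exp_val g \<noteq> 0"
    then have pos: "exp_val g > 0" using exp_val_nonneg[of g] by simp
    obtain q :: nat where q: "- ln (exp_val g) < real q" using reals_Archimedean2 by blast
    have "exp_val g \<le> exp (- real q)" using * exp_val_le by blast
    also have "\<dots> < exp (ln (exp_val g))" using q by (subst exp_less_cancel_iff) simp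
    finally show False using pos by simp
  qed
qed

lemma exp_val_max:
  assumes "\<exists>a. eps_bigo g a" "\<exists>a. eps_bigo h a"
    and le: "\<And>\<epsilon>. 0 < \<epsilon> \<Longrightarrow> \<epsilon> \<le> 1 \<Longrightarrow> k \<epsilon> \<le> g \<epsilon> + h \<epsilon>"
  shows "exp_val k \<le> max (exp_val g) (exp_val h)"
proof (rule ccontr)
  assume "\<not> ?thesis"
  then obtain s where s: "max (exp_val g) (exp_val h) < s" "s < exp_val k"
    using dense by (metis not_le)
  have "s > 0" using s(1) exp_val_nonneg[of g] by simp
  then have e: "s = exp (- (- ln s))" by simp
  have "eps_bigo g (- ln s)" "eps_bigo h (- ln s)"
    using s(1) exp_val_less[OF _ assms(1), of "- ln s"] exp_val_less[OF _ assms(2), of "- ln s"]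
    unfolding e[symmetric] by simp_all
  then have "eps_bigo k (- ln s)"
    by (intro eps_bigo_mono[OF eps_bigo_add[of g "- ln s" h] le])
  then have "exp_val k \<le> s" using exp_val_le e by metis
  then show False using s(2) by simp
qed


section \<open>The ring of generalized complex numbers\<close>

definition moderate_num :: "(real \<Rightarrow> complex) set" where
  "moderate_num = {z. \<exists>N::nat. eps_bigo (\<lambda>\<epsilon>. ennreal (cmod (z \<epsilon>))) (- real N)}"

definition negligible_num :: "(real \<Rightarrow> complex) set" where
  "negligible_num = {z. \<forall>q::nat. eps_bigo (\<lambda>\<epsilon>. ennreal (cmod (z \<epsilon>))) (real q)}"

lemma moderate_numI:
  assumes "eps_bigo (\<lambda>\<epsilon>. ennreal (cmod (z \<epsilon>))) b"
  shows "z \<in> moderate_num"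
proof -
  obtain N :: nat where "- b \<le> real N" using real_arch_simple by blast
  then show ?thesis using eps_bigo_weaken[OF assms, of "- real N"]
    unfolding moderate_num_def by auto
qed

lemma moderate_num_ex: "z \<in> moderate_num \<longleftrightarrow> (\<exists>b. eps_bigo (\<lambda>\<epsilon>. ennreal (cmod (z \<epsilon>))) b)"
  using moderate_numI unfolding moderate_num_def by blast

lemma negligible_num_all:
  "z \<in> negligible_num \<longleftrightarrow> (\<forall>b. eps_bigo (\<lambda>\<epsilon>. ennreal (cmod (z \<epsilon>))) b)"
proof
  assume z: "z \<in> negligible_num"
  show "\<forall>b. eps_bigo (\<lambda>\<epsilon>. ennreal (cmod (z \<epsilon>))) b"
  proof
    fix b :: real
    obtain q :: nat where "b \<le> real q" using real_arch_simple by blast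
    then show "eps_bigo (\<lambda>\<epsilon>. ennreal (cmod (z \<epsilon>))) b"
      using z eps_bigo_weaken unfolding negligible_num_def by blast
  qed
qed (simp add: negligible_num_def)

lemma cmod_add_bigo:
  assumes "eps_bigo (\<lambda>\<epsilon>. ennreal (cmod (z \<epsilon>))) b" "eps_bigo (\<lambda>\<epsilon>. ennreal (cmod (w \<epsilon>))) b"
  shows "eps_bigo (\<lambda>\<epsilon>. ennreal (cmod ((z + w) \<epsilon>))) b"
  by (rule eps_bigo_mono[OF eps_bigo_add[OF assms]])
     (simp add: ennreal_plus[symmetric] ennreal_leI norm_triangle_ineq del: ennreal_plus)

lemma cmod_mult_bigo:
  assumes "eps_bigo (\<lambda>\<epsilon>. ennreal (cmod (z \<epsilon>))) a" "eps_bigo (\<lambda>\<epsilon>. ennreal (cmod (w \<epsilon>))) b"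
  shows "eps_bigo (\<lambda>\<epsilon>. ennreal (cmod ((z * w) \<epsilon>))) (a + b)"
  using eps_bigo_mult[OF assms] by (simp add: norm_mult ennreal_mult)

lemma moderate_num_const: "(\<lambda>_. c) \<in> moderate_num"
  by (rule moderate_numI[of _ 0], unfold eps_bigo_def, rule exI[of _ "cmod c"])
     (rule eventually_mono[OF eventually_eps], simp)

lemma moderate_num_add: "z \<in> moderate_num \<Longrightarrow> w \<in> moderate_num \<Longrightarrow> z + w \<in> moderate_num"
proof -
  assume "z \<in> moderate_num" "w \<in> moderate_num"
  then obtain a b where "eps_bigo (\<lambda>\<epsilon>. ennreal (cmod (z \<epsilon>))) a" "eps_bigo (\<lambda>\<epsilon>. ennreal (cmod (w \<epsilon>))) b"
    unfolding moderate_num_ex by blast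
  then have "eps_bigo (\<lambda>\<epsilon>. ennreal (cmod ((z + w) \<epsilon>))) (min a b)"
    by (intro cmod_add_bigo) (auto elim: eps_bigo_weaken)
  then show ?thesis by (rule moderate_numI)
qed

lemma moderate_num_mult: "z \<in> moderate_num \<Longrightarrow> w \<in> moderate_num \<Longrightarrow> z * w \<in> moderate_num"
  unfolding moderate_num_ex by (blast intro: cmod_mult_bigo)

lemma moderate_num_uminus: "z \<in> moderate_num \<Longrightarrow> - z \<in> moderate_num"
  by (simp add: moderate_num_def)

lemma moderate_num_0: "0 \<in> moderate_num" and moderate_num_1: "1 \<in> moderate_num"
  using moderate_num_const[of 0] moderate_num_const[of 1]
  by (simp_all add: zero_fun_def one_fun_def)

lemma moderate_num_powr: "(\<lambda>\<epsilon>. c * of_real (\<epsilon> powr a)) \<in> moderate_num"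
  by (rule moderate_numI[of _ a], unfold eps_bigo_def, rule exI[of _ "cmod c"])
     (simp add: norm_mult)

lemma negligible_num_add: "z \<in> negligible_num \<Longrightarrow> w \<in> negligible_num \<Longrightarrow> z + w \<in> negligible_num"
  unfolding negligible_num_def using cmod_add_bigo by blast

lemma negligible_num_uminus: "z \<in> negligible_num \<Longrightarrow> - z \<in> negligible_num"
  by (simp add: negligible_num_def)

lemma negligible_num_diff: "z \<in> negligible_num \<Longrightarrow> w \<in> negligible_num \<Longrightarrow> z - w \<in> negligible_num"
  using negligible_num_add[OF _ negligible_num_uminus] by fastforce

lemma negligible_num_mult: "z \<in> moderate_num \<Longrightarrow> w \<in> negligible_num \<Longrightarrow> z * w \<in> negligible_num"
proof -
  assume z: "z \<in> moderate_num" and w: "w \<in> negligible_num"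
  obtain a where a: "eps_bigo (\<lambda>\<epsilon>. ennreal (cmod (z \<epsilon>))) a" using z moderate_num_ex by blast
  have "eps_bigo (\<lambda>\<epsilon>. ennreal (cmod ((z * w) \<epsilon>))) b" for b
    using cmod_mult_bigo[OF a, of w "b - a"] w by (simp add: negligible_num_all)
  then show ?thesis unfolding negligible_num_all by blast
qed

lemma negligible_num_0: "0 \<in> negligible_num"
  by (simp add: negligible_num_def)

quotient_type gcomplex = "real \<Rightarrow> complex" /
  partial: "\<lambda>z w. z \<in> moderate_num \<and> w \<in> moderate_num \<and> z - w \<in> negligible_num"
proof (rule part_equivpI)
  show "\<exists>x. x \<in> moderate_num \<and> x \<in> moderate_num \<and> x - x \<in> negligible_num"
    using moderate_num_0 negligible_num_0 by auto
  show "symp (\<lambda>z w. z \<in> moderate_num \<and> w \<in> moderate_num \<and> z - w \<in> negligible_num)"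
    by (rule sympI) (metis minus_diff_eq negligible_num_uminus)
  show "transp (\<lambda>z w. z \<in> moderate_num \<and> w \<in> moderate_num \<and> z - w \<in> negligible_num)"
  proof (rule transpI, intro conjI)
    fix x y z :: "real \<Rightarrow> complex"
    assume "x \<in> moderate_num \<and> y \<in> moderate_num \<and> x - y \<in> negligible_num"
      "y \<in> moderate_num \<and> z \<in> moderate_num \<and> y - z \<in> negligible_num"
    then show "x - z \<in> negligible_num" using negligible_num_add[of "x - y" "y - z"] by simp
  qed auto
qed

instantiation gcomplex :: comm_ring_1
begin

lift_definition zero_gcomplex :: gcomplex is 0
  using moderate_num_0 negligible_num_0 by simp

lift_definition one_gcomplex :: gcomplex is 1
  using moderate_num_1 negligible_num_0 by simp

lift_definition plus_gcomplex :: "gcomplex \<Rightarrow> gcomplex \<Rightarrow> gcomplex" is "(+)"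
proof (intro conjI)
  fix f1 f2 f3 f4 :: "real \<Rightarrow> complex"
  assume *: "f1 \<in> moderate_num \<and> f2 \<in> moderate_num \<and> f1 - f2 \<in> negligible_num"
    "f3 \<in> moderate_num \<and> f4 \<in> moderate_num \<and> f3 - f4 \<in> negligible_num"
  have "f1 + f3 - (f2 + f4) = (f1 - f2) + (f3 - f4)" by simp
  then show "f1 + f3 - (f2 + f4) \<in> negligible_num" using * negligible_num_add by metis
qed (auto intro: moderate_num_add)

lift_definition uminus_gcomplex :: "gcomplex \<Rightarrow> gcomplex" is uminus
proof (intro conjI)
  fix f1 f2 :: "real \<Rightarrow> complex"
  assume *: "f1 \<in> moderate_num \<and> f2 \<in> moderate_num \<and> f1 - f2 \<in> negligible_num"
  have "- f1 - - f2 = - (f1 - f2)" by simp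
  then show "- f1 - - f2 \<in> negligible_num" using * negligible_num_uminus by metis
qed (auto intro: moderate_num_uminus)

lift_definition times_gcomplex :: "gcomplex \<Rightarrow> gcomplex \<Rightarrow> gcomplex" is "(*)"
proof (intro conjI)
  fix f1 f2 f3 f4 :: "real \<Rightarrow> complex"
  assume *: "f1 \<in> moderate_num \<and> f2 \<in> moderate_num \<and> f1 - f2 \<in> negligible_num"
    "f3 \<in> moderate_num \<and> f4 \<in> moderate_num \<and> f3 - f4 \<in> negligible_num"
  have "f1 * f3 - f2 * f4 = f3 * (f1 - f2) + f2 * (f3 - f4)" by (simp add: algebra_simps)
  then show "f1 * f3 - f2 * f4 \<in> negligible_num"
    using * negligible_num_add negligible_num_mult by metis
qed (auto intro: moderate_num_mult)

definition minus_gcomplex :: "gcomplex \<Rightarrow> gcomplex \<Rightarrow> gcomplex" where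
  "minus_gcomplex z w = z + - w"

instance
proof
  fix a b c :: gcomplex
  note r = moderate_num_0 moderate_num_1 moderate_num_add moderate_num_mult moderate_num_uminus
    negligible_num_0
  show "a * b * c = a * (b * c)" by transfer (auto simp: mult.assoc intro: r)
  show "a * b = b * a" by transfer (auto simp: mult.commute intro: r)
  show "1 * a = a" by transfer (auto intro: r)
  show "(a + b) * c = a * c + b * c" by transfer (auto simp: distrib_right intro: r)
  show "a + b + c = a + (b + c)" by transfer (auto simp: add.assoc intro: r)
  show "a + b = b + a" by transfer (auto simp: add.commute intro: r)
  show "0 + a = a" by transfer (auto intro: r)
  show "- a + a = 0" by transfer (auto intro: r)
  show "a - b = a + - b" by (simp add: minus_gcomplex_def)
  show "(0::gcomplex) \<noteq> 1"
  proof (transfer, rule notI)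
    assume "0 \<in> moderate_num \<and> 1 \<in> moderate_num \<and> 0 - 1 \<in> negligible_num"
    then have "eps_bigo (\<lambda>\<epsilon>. ennreal (cmod ((0 - 1 :: real \<Rightarrow> complex) \<epsilon>))) (real 1)"
      unfolding negligible_num_def by blast
    then obtain C where C: "C \<ge> 0"
      "\<forall>\<^sub>F \<epsilon> in at_right 0. ennreal (cmod ((0 - 1 :: real \<Rightarrow> complex) \<epsilon>)) \<le> ennreal (C * \<epsilon> powr real 1)"
      by (rule eps_bigo_obtain)
    have "\<forall>\<^sub>F \<epsilon> :: real in at_right 0. \<epsilon> < 1 / (C + 1)"
      unfolding eventually_at_right_field using C(1) by (intro exI[of _ "1 / (C + 1)"]) auto
    with C(2) eventually_eps have "\<forall>\<^sub>F \<epsilon> :: real in at_right 0. False"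
    proof eventually_elim
      case (elim \<epsilon>)
      have "1 \<le> C * \<epsilon>" using elim C(1) ennreal_le_iff[of "C * \<epsilon>" 1] by (auto simp del: ennreal_1 simp flip: ennreal_1)
      moreover have "(C + 1) * \<epsilon> < 1" using elim C(1) by (simp add: field_simps)
      ultimately show False using elim by (simp add: algebra_simps)
    qed
    then show False by (simp add: trivial_limit_at_right_real)
  qed
qed

end

lift_definition gabs :: "gcomplex \<Rightarrow> real" is "\<lambda>z. exp_val (\<lambda>\<epsilon>. ennreal (cmod (z \<epsilon>)))"
proof (rule exp_val_cong)
  fix z w :: "real \<Rightarrow> complex" and b
  assume *: "z \<in> moderate_num \<and> w \<in> moderate_num \<and> z - w \<in> negligible_num"
  then have d: "eps_bigo (\<lambda>\<epsilon>. ennreal (cmod ((z - w) \<epsilon>))) b"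
      "eps_bigo (\<lambda>\<epsilon>. ennreal (cmod ((w - z) \<epsilon>))) b"
    using negligible_num_all negligible_num_uminus[of "z - w"] by auto
  show "eps_bigo (\<lambda>\<epsilon>. ennreal (cmod (z \<epsilon>))) b = eps_bigo (\<lambda>\<epsilon>. ennreal (cmod (w \<epsilon>))) b"
    using cmod_add_bigo[OF d(1), of w] cmod_add_bigo[OF d(2), of z] by auto
qed

lemma gabs_nonneg: "gabs z \<ge> 0"
  by transfer (rule exp_val_nonneg)

lemma gabs_eq_0: "gabs z = 0 \<longleftrightarrow> z = 0"
proof transfer
  fix z :: "real \<Rightarrow> complex"
  assume "z \<in> moderate_num \<and> z \<in> moderate_num \<and> z - z \<in> negligible_num"
  then have "z \<in> moderate_num" by simp
  then show "exp_val (\<lambda>\<epsilon>. ennreal (cmod (z \<epsilon>))) = 0 \<longleftrightarrow>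
      z \<in> moderate_num \<and> 0 \<in> moderate_num \<and> z - 0 \<in> negligible_num"
    using moderate_num_0 exp_val_eq_0[of "\<lambda>\<epsilon>. ennreal (cmod (z \<epsilon>))"]
    by (simp add: moderate_num_ex negligible_num_def)
qed

lemma gabs_uminus: "gabs (- z) = gabs z"
  by transfer simp

lemma gabs_ultra: "gabs (z + w) \<le> max (gabs z) (gabs w)"
proof transfer
  fix z w :: "real \<Rightarrow> complex"
  assume "z \<in> moderate_num \<and> z \<in> moderate_num \<and> z - z \<in> negligible_num"
    "w \<in> moderate_num \<and> w \<in> moderate_num \<and> w - w \<in> negligible_num"
  then show "exp_val (\<lambda>\<epsilon>. ennreal (cmod ((z + w) \<epsilon>)))
      \<le> max (exp_val (\<lambda>\<epsilon>. ennreal (cmod (z \<epsilon>)))) (exp_val (\<lambda>\<epsilon>. ennreal (cmod (w \<epsilon>))))"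
    unfolding moderate_num_ex
    by (intro exp_val_max)
       (auto simp: ennreal_plus[symmetric] norm_triangle_ineq intro!: ennreal_leI simp del: ennreal_plus)
qed

instantiation gcomplex :: metric_space
begin

definition dist_gcomplex :: "gcomplex \<Rightarrow> gcomplex \<Rightarrow> real" where
  "dist_gcomplex z w = gabs (z - w)"

definition uniformity_gcomplex :: "(gcomplex \<times> gcomplex) filter" where
  "uniformity_gcomplex = (INF e\<in>{0<..}. principal {(x, y). dist x y < e})"

definition open_gcomplex :: "gcomplex set \<Rightarrow> bool" where
  "open_gcomplex U = (\<forall>x\<in>U. \<forall>\<^sub>F (x', y) in uniformity. x' = x \<longrightarrow> y \<in> U)"

instance
proof
  fix x y z :: gcomplex
  show "dist x y = 0 \<longleftrightarrow> x = y" by (simp add: dist_gcomplex_def gabs_eq_0)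
  have "gabs (x - y) \<le> max (gabs (x - z)) (gabs (- (y - z)))"
    using gabs_ultra[of "x - z" "- (y - z)"] by simp
  then show "dist x y \<le> dist x z + dist y z"
    unfolding dist_gcomplex_def gabs_uminus using gabs_nonneg[of "x - z"] gabs_nonneg[of "y - z"]
    by (simp add: max_def split: if_splits)
qed (auto simp: uniformity_gcomplex_def open_gcomplex_def)

end


section \<open>Locally convex topologies on modules over the generalized numbers\<close>

text \<open>
  A module is given by its carrier \<open>M\<close> and by \<open>S\<close>, where \<open>S l u\<close> is the set of all values of the
  product of the scalar \<open>l\<close> and \<open>u\<close>. For a genuine module this is the singleton
  \<open>{scale l u}\<close>. Sets of values are needed because on the quotients by
  \<open>\<N>\<^sub>\<S>\<close> of spaces of nets in \<open>\<O>\<^sub>M\<close> used below,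
  multiplication by a generalized number depends on the chosen representatives: a negligible
  number times a net in \<open>\<O>\<^sub>M\<close> need not belong to \<open>\<N>\<^sub>\<S>\<close>.
\<close>

definition ultra_pseudo_seminorm ::
    "(gcomplex \<Rightarrow> 'a \<Rightarrow> 'a set) \<Rightarrow> 'a::ab_group_add set \<Rightarrow> ('a \<Rightarrow> real) \<Rightarrow> bool" where
  "ultra_pseudo_seminorm S M P \<longleftrightarrow>
     P 0 = 0 \<and>
     (\<forall>u\<in>M. P u \<ge> 0) \<and>
     (\<forall>l. \<forall>u\<in>M. \<forall>w\<in>S l u. P w \<le> gabs l * P u) \<and>
     (\<forall>c a. c \<noteq> 0 \<longrightarrow> (\<forall>u\<in>M. \<forall>w\<in>S (abs_gcomplex (\<lambda>\<epsilon>. c * of_real (\<epsilon> powr a))) u.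
        P w = gabs (abs_gcomplex (\<lambda>\<epsilon>. c * of_real (\<epsilon> powr a))) * P u)) \<and>
     (\<forall>u\<in>M. \<forall>v\<in>M. P (u + v) \<le> max (P u) (P v))"

definition seminorm_topology :: "'a::ab_group_add set \<Rightarrow> ('a \<Rightarrow> real) set \<Rightarrow> 'a topology" where
  "seminorm_topology M F = topology (\<lambda>U. U \<subseteq> M \<and>
     (\<forall>u\<in>U. \<exists>F0 \<delta>. finite F0 \<and> F0 \<subseteq> F \<and> \<delta> > 0 \<and> {v \<in> M. \<forall>P\<in>F0. P (v - u) < \<delta>} \<subseteq> U))"

definition locally_convex_topology ::
    "(gcomplex \<Rightarrow> 'a \<Rightarrow> 'a set) \<Rightarrow> 'a::ab_group_add set \<Rightarrow> 'a topology \<Rightarrow> bool" where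
  "locally_convex_topology S M T \<longleftrightarrow>
     (\<exists>F. (\<forall>P\<in>F. ultra_pseudo_seminorm S M P) \<and> T = seminorm_topology M F)"

text \<open>
  The finest locally convex topology on \<open>M\<close> making all maps \<open>f\<close> with \<open>(X, f) \<in> I\<close> continuous.
\<close>

definition is_finest_lc ::
    "(gcomplex \<Rightarrow> 'a \<Rightarrow> 'a set) \<Rightarrow> 'a::ab_group_add set \<Rightarrow> ('b topology \<times> ('b \<Rightarrow> 'a)) set \<Rightarrow> 'a topology \<Rightarrow> bool"
  where
  "is_finest_lc S M I T \<longleftrightarrow>
     locally_convex_topology S M T \<and> (\<forall>(X, f)\<in>I. continuous_map X T f) \<and>
     (\<forall>T'. locally_convex_topology S M T' \<and> (\<forall>(X, f)\<in>I. continuous_map X T' f) \<longrightarrow>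
        (\<forall>U. openin T' U \<longrightarrow> openin T U))"

definition finest_lc ::
    "(gcomplex \<Rightarrow> 'a \<Rightarrow> 'a set) \<Rightarrow> 'a::ab_group_add set \<Rightarrow> ('b topology \<times> ('b \<Rightarrow> 'a)) set \<Rightarrow> 'a topology"
  where "finest_lc S M I = (THE T. is_finest_lc S M I T)"

definition lc_bounded ::
    "(gcomplex \<Rightarrow> 'a \<Rightarrow> 'a set) \<Rightarrow> 'a::ab_group_add set \<Rightarrow> 'a topology \<Rightarrow> 'a set \<Rightarrow> bool" where
  "lc_bounded S M T B \<longleftrightarrow> B \<subseteq> M \<and>
     (\<forall>P. ultra_pseudo_seminorm S M P \<and> continuous_map T euclideanreal P \<longrightarrow> bdd_above (P ` B))"

lemma ultra_pseudo_seminormD: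
  assumes "ultra_pseudo_seminorm S M P"
  shows "P 0 = 0" "u \<in> M \<Longrightarrow> P u \<ge> 0"
    "u \<in> M \<Longrightarrow> v \<in> M \<Longrightarrow> P (u + v) \<le> max (P u) (P v)"
  using assms unfolding ultra_pseudo_seminorm_def by simp_all

lemma openin_seminorm_topology:
  "openin (seminorm_topology M F) U \<longleftrightarrow> U \<subseteq> M \<and>
     (\<forall>u\<in>U. \<exists>F0 \<delta>. finite F0 \<and> F0 \<subseteq> F \<and> \<delta> > 0 \<and> {v \<in> M. \<forall>P\<in>F0. P (v - u) < \<delta>} \<subseteq> U)"
proof -
  let ?B = "\<lambda>u F0 \<delta>. {v \<in> M. \<forall>P\<in>F0. P (v - u) < (\<delta>::real)}"
  let ?O = "\<lambda>U. U \<subseteq> M \<and> (\<forall>u\<in>U. \<exists>F0 \<delta>. finite F0 \<and> F0 \<subseteq> F \<and> \<delta> > 0 \<and> ?B u F0 \<delta> \<subseteq> U)"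
  have "istopology ?O"
    unfolding istopology_def
  proof (intro conjI allI impI)
    fix U V assume UV: "?O U" "?O V"
    show "U \<inter> V \<subseteq> M" using UV by blast
    show "\<forall>u\<in>U \<inter> V. \<exists>F0 \<delta>. finite F0 \<and> F0 \<subseteq> F \<and> \<delta> > 0 \<and> ?B u F0 \<delta> \<subseteq> U \<inter> V"
    proof
      fix u assume u: "u \<in> U \<inter> V"
      obtain F1 d1 where 1: "finite F1" "F1 \<subseteq> F" "d1 > 0" "?B u F1 d1 \<subseteq> U"
        using UV(1) u by blast
      obtain F2 d2 where 2: "finite F2" "F2 \<subseteq> F" "d2 > 0" "?B u F2 d2 \<subseteq> V"
        using UV(2) u by blast
      have "?B u (F1 \<union> F2) (min d1 d2) \<subseteq> ?B u F1 d1 \<inter> ?B u F2 d2" by auto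
      then have "?B u (F1 \<union> F2) (min d1 d2) \<subseteq> U \<inter> V" using 1(4) 2(4) by blast
      then show "\<exists>F0 \<delta>. finite F0 \<and> F0 \<subseteq> F \<and> \<delta> > 0 \<and> ?B u F0 \<delta> \<subseteq> U \<inter> V"
        using 1 2 by (intro exI[of _ "F1 \<union> F2"] exI[of _ "min d1 d2"]) auto
    qed
  next
    fix \<K> assume K: "\<forall>K\<in>\<K>. ?O K"
    then show "\<Union>\<K> \<subseteq> M" by blast
    show "\<forall>u\<in>\<Union>\<K>. \<exists>F0 \<delta>. finite F0 \<and> F0 \<subseteq> F \<and> \<delta> > 0 \<and> ?B u F0 \<delta> \<subseteq> \<Union>\<K>"
    proof
      fix u assume "u \<in> \<Union>\<K>"
      then obtain K0 where "K0 \<in> \<K>" "u \<in> K0" by blast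
      moreover have "\<exists>F0 \<delta>. finite F0 \<and> F0 \<subseteq> F \<and> \<delta> > 0 \<and> ?B u F0 \<delta> \<subseteq> K0"
        using K calculation by simp
      then obtain F0 \<delta> where "finite F0" "F0 \<subseteq> F" "\<delta> > 0" "?B u F0 \<delta> \<subseteq> K0"
        by (elim exE conjE)
      ultimately have "finite F0 \<and> F0 \<subseteq> F \<and> \<delta> > 0 \<and> ?B u F0 \<delta> \<subseteq> \<Union>\<K>"
        by (simp add: subset_iff) blast
      then show "\<exists>F0 \<delta>. finite F0 \<and> F0 \<subseteq> F \<and> \<delta> > 0 \<and> ?B u F0 \<delta> \<subseteq> \<Union>\<K>" by (intro exI)
    qed
  qed
  then show ?thesis unfolding seminorm_topology_def by (subst topology_inverse') auto
qed

lemma topspace_seminorm_topology [simp]: "topspace (seminorm_topology M F) = M"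
proof -
  have "openin (seminorm_topology M F) M"
    unfolding openin_seminorm_topology by (auto intro!: exI[of _ "{}"] exI[of _ "1::real"])
  then show ?thesis
    by (metis openin_seminorm_topology openin_subset openin_topspace subset_antisym)
qed

lemma openin_seminorm_ball:
  assumes P: "ultra_pseudo_seminorm S M P" and M: "\<And>u v. u \<in> M \<Longrightarrow> v \<in> M \<Longrightarrow> u - v \<in> M"
    and u: "u \<in> M" and "P \<in> F"
  shows "openin (seminorm_topology M F) {v \<in> M. P (v - u) < \<delta>}"
  unfolding openin_seminorm_topology
proof (intro conjI ballI)
  fix v assume v: "v \<in> {v \<in> M. P (v - u) < \<delta>}"
  have *: "\<delta> > 0" using ultra_pseudo_seminormD(2)[OF P M[of v u]] u v by auto
  have "P (w - u) < \<delta>" if "w \<in> M" "P (w - v) < \<delta>" for w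
  proof -
    have "P ((w - v) + (v - u)) \<le> max (P (w - v)) (P (v - u))"
      using M u v that(1) by (intro ultra_pseudo_seminormD(3)[OF P]) auto
    then have "P (w - u) \<le> max (P (w - v)) (P (v - u))" by simp
    also have "\<dots> < \<delta>" using that v by simp
    finally show ?thesis .
  qed
  then show "\<exists>F0 \<delta>'. finite F0 \<and> F0 \<subseteq> F \<and> 0 < \<delta>' \<and>
      {w \<in> M. \<forall>P\<in>F0. P (w - v) < \<delta>'} \<subseteq> {v \<in> M. P (v - u) < \<delta>}"
    using assms(4) * by (intro exI[of _ "{P}"] exI[of _ \<delta>]) auto
qed auto

lemma continuous_map_seminorm_topology:
  assumes F: "\<And>P. P \<in> F \<Longrightarrow> ultra_pseudo_seminorm S M P"
    and M: "\<And>u v. u \<in> M \<Longrightarrow> v \<in> M \<Longrightarrow> u - v \<in> M"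
    and f: "f ` topspace X \<subseteq> M"
  shows "continuous_map X (seminorm_topology M F) f \<longleftrightarrow>
    (\<forall>P\<in>F. continuous_map X (seminorm_topology M {P}) f)" (is "?L \<longleftrightarrow> ?R")
proof
  assume L: ?L
  show ?R
  proof
    fix P assume "P \<in> F"
    then have "openin (seminorm_topology M F) U" if "openin (seminorm_topology M {P}) U" for U
      using that unfolding openin_seminorm_topology
      by (meson empty_subsetI insert_subset order_trans)
    then show "continuous_map X (seminorm_topology M {P}) f"
      using L unfolding continuous_map_alt by simp
  qed
next
  assume R: ?R
  show ?L
    unfolding continuous_map_def
  proof (intro conjI allI impI)
    show "f \<in> topspace X \<rightarrow> topspace (seminorm_topology M F)" using f by auto
    fix U assume U: "openin (seminorm_topology M F) U"
    show "openin X {x \<in> topspace X. f x \<in> U}"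
    proof (subst openin_subopen, intro ballI)
      fix x assume x: "x \<in> {x \<in> topspace X. f x \<in> U}"
      obtain F0 \<delta> where F0: "finite F0" "F0 \<subseteq> F" "\<delta> > 0"
          "{v \<in> M. \<forall>P\<in>F0. P (v - f x) < \<delta>} \<subseteq> U"
        using U x unfolding openin_seminorm_topology by blast
      let ?W = "\<lambda>P. {y \<in> topspace X. f y \<in> {v \<in> M. P (v - f x) < \<delta>}}"
      have fx: "f x \<in> M" using f x by auto
      have o: "openin X (?W P)" if "P \<in> F0" for P
        using R F0(2) that openin_seminorm_ball[OF F M fx, of P "{P}" \<delta>]
        unfolding continuous_map_def by blast
      have "P (f x - f x) < \<delta>" if "P \<in> F0" for P
        using ultra_pseudo_seminormD(1)[OF F[of P]] F0(2,3) that by auto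
      then have "openin X (topspace X \<inter> \<Inter>(?W ` F0))" "x \<in> topspace X \<inter> \<Inter>(?W ` F0)"
        using F0(1) o x fx by (auto intro!: openin_Int_Inter)
      moreover have "topspace X \<inter> \<Inter>(?W ` F0) \<subseteq> {x \<in> topspace X. f x \<in> U}"
        using F0(4) f by blast
      ultimately show "\<exists>T. openin X T \<and> x \<in> T \<and> T \<subseteq> {x \<in> topspace X. f x \<in> U}" by blast
    qed
  qed
qed

lemma is_finest_lc_seminorm:
  fixes S :: "gcomplex \<Rightarrow> 'a \<Rightarrow> 'a::ab_group_add set"
  assumes M: "\<And>u v. u \<in> M \<Longrightarrow> v \<in> M \<Longrightarrow> u - v \<in> M"
    and f: "\<And>X f. (X, f) \<in> I \<Longrightarrow> f ` topspace X \<subseteq> M"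
  defines "F \<equiv> {P. ultra_pseudo_seminorm S M P \<and>
      (\<forall>(X, f)\<in>I. continuous_map X (seminorm_topology M {P}) f)}"
  shows "is_finest_lc S M I (seminorm_topology M F)"
  unfolding is_finest_lc_def
proof (intro conjI allI impI)
  show "locally_convex_topology S M (seminorm_topology M F)"
    unfolding locally_convex_topology_def by (rule exI[of _ F]) (simp add: F_def)
  show "\<forall>(X, f)\<in>I. continuous_map X (seminorm_topology M F) f"
  proof (safe)
    fix X f assume "(X, f) \<in> I"
    then show "continuous_map X (seminorm_topology M F) f"
      using M f by (subst continuous_map_seminorm_topology[where S = S]) (auto simp: F_def)
  qed
  fix T' U
  assume *: "locally_convex_topology S M T' \<and> (\<forall>(X, f)\<in>I. continuous_map X T' f)" "openin T' U"
  then obtain G where G: "\<forall>P\<in>G. ultra_pseudo_seminorm S M P" "T' = seminorm_topology M G"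
    unfolding locally_convex_topology_def by blast
  have "continuous_map X (seminorm_topology M {P}) f" if "(X, f) \<in> I" "P \<in> G" for X f P
  proof -
    have "continuous_map X (seminorm_topology M G) f" using * that(1) G(2) by auto
    then show ?thesis
      using continuous_map_seminorm_topology[where S = S and F = G and M = M and X = X and f = f]
        G(1) M f[OF that(1)] that(2) by blast
  qed
  then have "G \<subseteq> F" using G(1) unfolding F_def by auto
  then show "openin (seminorm_topology M F) U"
    using *(2) unfolding G(2) openin_seminorm_topology by (meson order_trans)
qed

lemma finest_lc_eq:
  assumes M: "\<And>u v. u \<in> M \<Longrightarrow> v \<in> M \<Longrightarrow> u - v \<in> M"
    and f: "\<And>X f. (X, f) \<in> I \<Longrightarrow> f ` topspace X \<subseteq> M"
  shows "finest_lc S M I = seminorm_topology M {P. ultra_pseudo_seminorm S M P \<and>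
      (\<forall>(X, f)\<in>I. continuous_map X (seminorm_topology M {P}) f)}"
  unfolding finest_lc_def
proof (rule the_equality)
  show "is_finest_lc S M I (seminorm_topology M {P. ultra_pseudo_seminorm S M P \<and>
      (\<forall>(X, f)\<in>I. continuous_map X (seminorm_topology M {P}) f)})"
    by (rule is_finest_lc_seminorm[OF M f])
  then show "T = seminorm_topology M {P. ultra_pseudo_seminorm S M P \<and>
      (\<forall>(X, f)\<in>I. continuous_map X (seminorm_topology M {P}) f)}" if "is_finest_lc S M I T" for T
    using that unfolding is_finest_lc_def topology_eq by blast
qed


section \<open>Smooth functions, weighted suprema\<close>

definition pder :: "'n::finite \<Rightarrow> (real^'n \<Rightarrow> complex) \<Rightarrow> real^'n \<Rightarrow> complex" where
  "pder i f x = vector_derivative (\<lambda>t. f (x + t *\<^sub>R axis i 1)) (at 0)"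

definition smooth :: "(real^'n::finite \<Rightarrow> complex) \<Rightarrow> bool" where
  "smooth f \<longleftrightarrow> (\<forall>is. continuous_on UNIV (foldr pder is f) \<and>
     (\<forall>i x. (\<lambda>t. foldr pder is f (x + t *\<^sub>R axis i 1)) differentiable (at 0)))"

text \<open>
  Multi-indices are functions \<open>\<alpha> :: 'n \<Rightarrow> nat\<close>. The order in which the coordinates are enumerated
  is immaterial for smooth functions.
\<close>

definition coordinates :: "'n::finite list" where
  "coordinates = (SOME is. distinct is \<and> set is = UNIV)"

definition mderiv :: "('n::finite \<Rightarrow> nat) \<Rightarrow> (real^'n \<Rightarrow> complex) \<Rightarrow> real^'n \<Rightarrow> complex" where
  "mderiv \<alpha> f = foldr (\<lambda>i. pder i ^^ \<alpha> i) coordinates f"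

definition multi_indices_le :: "nat \<Rightarrow> ('n::finite \<Rightarrow> nat) set" where
  "multi_indices_le m = {\<alpha>. sum \<alpha> UNIV \<le> m}"

definition wsup :: "(real^'n \<Rightarrow> real) \<Rightarrow> ('n::finite \<Rightarrow> nat) set \<Rightarrow> (real^'n \<Rightarrow> complex) \<Rightarrow> ennreal" where
  "wsup w A f = (SUP x. SUP \<alpha>\<in>A. ennreal (w x * cmod (mderiv \<alpha> f x)))"

definition schwartz_seminorm :: "nat \<Rightarrow> (real^'n::finite \<Rightarrow> complex) \<Rightarrow> ennreal" where
  "schwartz_seminorm j = wsup (\<lambda>x. (1 + norm x) ^ j) (multi_indices_le j)"

text \<open>The rapidly decreasing functions \<open>\<S>\<close>, and the space \<open>\<O>\<^sub>M\<close>.\<close>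

definition schwartz :: "(real^'n::finite \<Rightarrow> complex) set" where
  "schwartz = {f. smooth f \<and> (\<forall>j. schwartz_seminorm j f < \<infinity>)}"

definition slowly_increasing :: "(real^'n::finite \<Rightarrow> complex) set" where
  "slowly_increasing = {f. smooth f \<and>
     (\<forall>\<alpha>. \<exists>(N::nat) C. \<forall>x. cmod (mderiv \<alpha> f x) \<le> C * (1 + norm x) ^ N)}"

definition tempered_weight :: "nat \<Rightarrow> real^'n::finite \<Rightarrow> real" where
  "tempered_weight N x = 1 / (1 + norm x) ^ N"

definition nets_in :: "'a set \<Rightarrow> (real \<Rightarrow> 'a) set" where
  "nets_in X = {u. \<forall>\<epsilon>\<in>{0<..1}. u \<epsilon> \<in> X}"

text \<open>The \<open>\<epsilon>\<close>-wise product of a net of numbers and a net of functions.\<close>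

definition net_scale :: "(real \<Rightarrow> complex) \<Rightarrow> (real \<Rightarrow> real^'n::finite \<Rightarrow> complex) \<Rightarrow> real \<Rightarrow> real^'n \<Rightarrow> complex" where
  "net_scale l u = (\<lambda>\<epsilon> x. l \<epsilon> * u \<epsilon> x)"

lemma smoothD:
  assumes "smooth f"
  shows "(\<lambda>t. foldr pder is f (x + t *\<^sub>R axis i 1)) differentiable (at 0)"
    "continuous_on UNIV (foldr pder is f)"
  using assms unfolding smooth_def by blast+

lemma foldr_pder_add:
  assumes f: "smooth f" and g: "smooth g"
  shows "foldr pder is (f + g) = foldr pder is f + foldr pder is g"
proof (induction "is")
  case (Cons i "is")
  show ?case
  proof
    fix x
    show "foldr pder (i # is) (f + g) x = (foldr pder (i # is) f + foldr pder (i # is) g) x"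
      using smoothD(1)[OF f, of "is" x i] smoothD(1)[OF g, of "is" x i]
      by (simp add: Cons.IH pder_def[of i])
  qed
qed simp

lemma foldr_pder_cmult:
  assumes f: "smooth f"
  shows "foldr pder is (\<lambda>x. c * f x) = (\<lambda>x. c * foldr pder is f x)"
proof (induction "is")
  case (Cons i "is")
  show ?case
  proof
    fix x
    show "foldr pder (i # is) (\<lambda>x. c * f x) x = c * foldr pder (i # is) f x"
      using smoothD(1)[OF f, of "is" x i]
      by (simp add: Cons.IH pder_def[of i])
  qed
qed simp

lemma smooth_add: "smooth f \<Longrightarrow> smooth g \<Longrightarrow> smooth (f + g)"
proof -
  assume *: "smooth f" "smooth g"
  show ?thesis
    unfolding smooth_def[of "f + g"] foldr_pder_add[OF *]
    unfolding plus_fun_def using smoothD[OF *(1)] smoothD[OF *(2)]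
    by (auto intro!: continuous_on_add differentiable_add)
qed

lemma smooth_cmult: "smooth f \<Longrightarrow> smooth (\<lambda>x. c * f x)"
  unfolding smooth_def[of "\<lambda>x. c * f x"]
  by (auto simp: foldr_pder_cmult smooth_def intro!: continuous_intros differentiable_mult)

lemma mderiv_foldr: "\<exists>is. \<forall>f. mderiv \<alpha> f = foldr pder is f"
proof -
  have "foldr (\<lambda>i. pder i ^^ \<alpha> i) xs f = foldr pder (concat (map (\<lambda>i. replicate (\<alpha> i) i) xs)) f" for xs f
    by (induction xs) auto
  then show ?thesis unfolding mderiv_def by blast
qed

lemma mderiv_add: "smooth f \<Longrightarrow> smooth g \<Longrightarrow> mderiv \<alpha> (f + g) = mderiv \<alpha> f + mderiv \<alpha> g"
  using mderiv_foldr[of \<alpha>] foldr_pder_add by metis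

lemma mderiv_cmult: "smooth f \<Longrightarrow> mderiv \<alpha> (\<lambda>x. c * f x) = (\<lambda>x. c * mderiv \<alpha> f x)"
  using mderiv_foldr[of \<alpha>] foldr_pder_cmult by metis

lemma smooth_0: "smooth 0"
proof -
  have *: "foldr pder is 0 = (0 :: real^'a \<Rightarrow> complex)" for "is" :: "'a list"
    by (induction "is") (auto simp: pder_def zero_fun_def fun_eq_iff)
  show ?thesis unfolding smooth_def * by (simp add: zero_fun_def)
qed

lemma mderiv_0: "mderiv \<alpha> 0 = 0"
  using mderiv_cmult[OF smooth_0, of \<alpha> 0] by (simp add: zero_fun_def)

lemma wsup_0 [simp]: "wsup w A 0 = 0"
  unfolding wsup_def mderiv_0 by (intro antisym SUP_least) auto

lemma wsup_add:
  assumes "smooth f" "smooth g" and w: "\<And>x. w x \<ge> 0"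
  shows "wsup w A (f + g) \<le> wsup w A f + wsup w A g"
  unfolding wsup_def
proof (intro SUP_least)
  fix x \<alpha> assume a: "\<alpha> \<in> A"
  have "ennreal (w x * cmod (mderiv \<alpha> (f + g) x)) \<le>
      ennreal (w x * cmod (mderiv \<alpha> f x)) + ennreal (w x * cmod (mderiv \<alpha> g x))"
    using w[of x] assms(1,2)
    by (auto simp: mderiv_add ennreal_plus[symmetric] distrib_left[symmetric] norm_triangle_ineq
        intro!: ennreal_leI mult_left_mono simp del: ennreal_plus)
  also have "\<dots> \<le> (SUP x. SUP \<alpha>\<in>A. ennreal (w x * cmod (mderiv \<alpha> f x))) +
      (SUP x. SUP \<alpha>\<in>A. ennreal (w x * cmod (mderiv \<alpha> g x)))"
    using a by (intro add_mono SUP_upper2[where i = x] SUP_upper2[where i = \<alpha>]) auto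
  finally show "ennreal (w x * cmod (mderiv \<alpha> (f + g) x)) \<le> \<dots>" .
qed

lemma wsup_cmult:
  assumes "smooth f" and w: "\<And>x. w x \<ge> 0"
  shows "wsup w A (\<lambda>x. c * f x) \<le> ennreal (cmod c) * wsup w A f"
  unfolding wsup_def
proof (intro SUP_least)
  fix x \<alpha> assume a: "\<alpha> \<in> A"
  have "ennreal (w x * cmod (mderiv \<alpha> (\<lambda>x. c * f x) x)) =
      ennreal (cmod c) * ennreal (w x * cmod (mderiv \<alpha> f x))"
    using w[of x] assms(1) by (simp add: mderiv_cmult norm_mult ennreal_mult[symmetric] mult_ac)
  also have "\<dots> \<le> ennreal (cmod c) * (SUP x. SUP \<alpha>\<in>A. ennreal (w x * cmod (mderiv \<alpha> f x)))"
    using a by (intro mult_left_mono SUP_upper2[where i = x] SUP_upper2[where i = \<alpha>]) auto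
  finally show "ennreal (w x * cmod (mderiv \<alpha> (\<lambda>x. c * f x) x)) \<le> \<dots>" .
qed

lemma wsup_mono:
  assumes "A \<subseteq> B" "\<And>x. w x \<le> w' x"
  shows "wsup w A f \<le> wsup w' B f"
  unfolding wsup_def
  by (intro SUP_mono' SUP_subset_mono assms ennreal_leI mult_right_mono) auto

lemma tempered_weight_nonneg: "tempered_weight N x \<ge> 0"
  by (simp add: tempered_weight_def)

lemma tempered_weight_antimono: "N \<le> M \<Longrightarrow> tempered_weight M x \<le> tempered_weight N x"
  unfolding tempered_weight_def by (intro divide_left_mono power_increasing mult_pos_pos zero_less_power) (auto intro: add_pos_nonneg)

lemma tempered_weight_le: "tempered_weight N x \<le> (1 + norm x) ^ j"
proof -
  have "1 \<le> (1 + norm x) ^ k" for k by (intro one_le_power) simp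
  from this[of N] this[of j] have "1 / (1 + norm x) ^ N \<le> 1" "1 \<le> (1 + norm x) ^ j"
    using divide_le_eq_1_pos[of "(1 + norm x) ^ N" 1] by linarith+
  then show ?thesis unfolding tempered_weight_def by linarith
qed

lemma slowly_increasing_smooth: "f \<in> slowly_increasing \<Longrightarrow> smooth f"
  by (simp add: slowly_increasing_def)

lemma schwartz_smooth: "f \<in> schwartz \<Longrightarrow> smooth f"
  by (simp add: schwartz_def)

lemma schwartz_0: "0 \<in> schwartz"
  by (simp add: schwartz_def smooth_0 schwartz_seminorm_def)

lemma schwartz_add: "f \<in> schwartz \<Longrightarrow> g \<in> schwartz \<Longrightarrow> f + g \<in> schwartz"
proof -
  assume *: "f \<in> schwartz" "g \<in> schwartz"
  have "schwartz_seminorm j (f + g) \<le> schwartz_seminorm j f + schwartz_seminorm j g" for j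
    unfolding schwartz_seminorm_def using * by (intro wsup_add) (auto intro: schwartz_smooth)
  then show ?thesis using * unfolding schwartz_def
    by (auto intro: smooth_add) (metis ennreal_add_less_top infinity_ennreal_def le_less_trans)
qed

lemma schwartz_cmult: "f \<in> schwartz \<Longrightarrow> (\<lambda>x. c * f x) \<in> schwartz"
proof -
  assume *: "f \<in> schwartz"
  have "schwartz_seminorm j (\<lambda>x. c * f x) \<le> ennreal (cmod c) * schwartz_seminorm j f" for j
    unfolding schwartz_seminorm_def using * by (intro wsup_cmult) (auto intro: schwartz_smooth)
  then have "schwartz_seminorm j (\<lambda>x. c * f x) < \<infinity>" for j
    using * unfolding schwartz_def
    by (intro le_less_trans[OF \<open>schwartz_seminorm j (\<lambda>x. c * f x) \<le> _\<close>]) (auto simp: ennreal_mult_less_top)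
  then show ?thesis using * unfolding schwartz_def by (auto intro: smooth_cmult)
qed

lemma slowly_increasing_0: "0 \<in> slowly_increasing"
  by (auto simp: slowly_increasing_def smooth_0 mderiv_0 intro!: exI[of _ "0::real"])

lemma slowly_increasing_add:
  "f \<in> slowly_increasing \<Longrightarrow> g \<in> slowly_increasing \<Longrightarrow> f + g \<in> slowly_increasing"
proof -
  assume *: "f \<in> slowly_increasing" "g \<in> slowly_increasing"
  have "\<exists>(N::nat) C. \<forall>x. cmod (mderiv \<alpha> (f + g) x) \<le> C * (1 + norm x) ^ N" for \<alpha>
  proof -
    obtain N C where 1: "\<And>x. cmod (mderiv \<alpha> f x) \<le> C * (1 + norm x) ^ N"
      using *(1) unfolding slowly_increasing_def by blast
    obtain M D where 2: "\<And>x. cmod (mderiv \<alpha> g x) \<le> D * (1 + norm x) ^ M"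
      using *(2) unfolding slowly_increasing_def by blast
    have "cmod (mderiv \<alpha> (f + g) x) \<le> (\<bar>C\<bar> + \<bar>D\<bar>) * (1 + norm x) ^ (N + M)" for x
    proof -
      have "C * (1 + norm x) ^ N \<le> \<bar>C\<bar> * (1 + norm x) ^ (N + M)"
           "D * (1 + norm x) ^ M \<le> \<bar>D\<bar> * (1 + norm x) ^ (N + M)"
        by (intro mult_mono power_increasing; simp)+
      then show ?thesis
        using 1[of x] 2[of x] norm_triangle_ineq[of "mderiv \<alpha> f x" "mderiv \<alpha> g x"]
          mderiv_add[of f g \<alpha>] *[THEN slowly_increasing_smooth] by (simp add: distrib_right)
    qed
    then show ?thesis by blast
  qed
  then show ?thesis using * unfolding slowly_increasing_def by (auto intro: smooth_add)
qed

lemma slowly_increasing_cmult: "f \<in> slowly_increasing \<Longrightarrow> (\<lambda>x. c * f x) \<in> slowly_increasing"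
proof -
  assume *: "f \<in> slowly_increasing"
  have "\<exists>(N::nat) C. \<forall>x. cmod (mderiv \<alpha> (\<lambda>x. c * f x) x) \<le> C * (1 + norm x) ^ N" for \<alpha>
  proof -
    obtain N C where 1: "\<And>x. cmod (mderiv \<alpha> f x) \<le> C * (1 + norm x) ^ N"
      using * unfolding slowly_increasing_def by blast
    have "cmod (mderiv \<alpha> (\<lambda>x. c * f x) x) \<le> (cmod c * C) * (1 + norm x) ^ N" for x
      using mult_left_mono[OF 1[of x], of "cmod c"] *
      by (simp add: mderiv_cmult slowly_increasing_smooth norm_mult mult_ac)
    then show ?thesis by blast
  qed
  then show ?thesis using * unfolding slowly_increasing_def by (auto intro: smooth_cmult)
qed

lemma schwartz_bound:
  assumes "f \<in> schwartz"
  obtains C where "C \<ge> 0" "\<And>\<alpha> x. \<alpha> \<in> multi_indices_le j \<Longrightarrow> (1 + norm x) ^ j * cmod (mderiv \<alpha> f x) \<le> C"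
proof -
  obtain C where C: "C \<ge> 0" "schwartz_seminorm j f = ennreal C"
    using assms unfolding schwartz_def by (auto simp: less_top_ennreal)
  have "(1 + norm x) ^ j * cmod (mderiv \<alpha> f x) \<le> C" if "\<alpha> \<in> multi_indices_le j" for \<alpha> x
  proof -
    have "ennreal ((1 + norm x) ^ j * cmod (mderiv \<alpha> f x)) \<le> schwartz_seminorm j f"
      unfolding schwartz_seminorm_def wsup_def using that
      by (intro SUP_upper2[where i = x] SUP_upper2[where i = \<alpha>]) auto
    then show ?thesis using C by (simp add: ennreal_le_iff)
  qed
  then show ?thesis using that C(1) by blast
qed

lemma schwartz_slowly_increasing: "schwartz \<subseteq> slowly_increasing"
proof
  fix f :: "real^'a \<Rightarrow> complex" assume f: "f \<in> schwartz"
  have "\<exists>(N::nat) C. \<forall>x. cmod (mderiv \<alpha> f x) \<le> C * (1 + norm x) ^ N" for \<alpha>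
  proof -
    obtain C where C: "\<And>\<beta> x. \<beta> \<in> multi_indices_le (sum \<alpha> UNIV) \<Longrightarrow>
        (1 + norm x) ^ (sum \<alpha> UNIV) * cmod (mderiv \<beta> f x) \<le> C"
      using schwartz_bound[OF f] by metis
    have "cmod (mderiv \<alpha> f x) \<le> C * (1 + norm x) ^ 0" for x
    proof -
      have "1 * cmod (mderiv \<alpha> f x) \<le> (1 + norm x) ^ (sum \<alpha> UNIV) * cmod (mderiv \<alpha> f x)"
        by (intro mult_right_mono one_le_power) auto
      also have "\<dots> \<le> C" by (intro C) (simp add: multi_indices_le_def)
      finally show ?thesis by simp
    qed
    then show ?thesis by blast
  qed
  then show "f \<in> slowly_increasing" using f unfolding slowly_increasing_def
    by (simp add: schwartz_smooth)
qed

lemma nets_in_eps: "u \<in> nets_in X \<Longrightarrow> 0 < \<epsilon> \<Longrightarrow> \<epsilon> \<le> 1 \<Longrightarrow> u \<epsilon> \<in> X"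
  by (simp add: nets_in_def)

lemma nets_in_0: "0 \<in> X \<Longrightarrow> 0 \<in> nets_in X"
  by (simp add: nets_in_def)

lemma nets_in_mono: "X \<subseteq> Y \<Longrightarrow> nets_in X \<subseteq> nets_in Y"
  by (auto simp: nets_in_def)

lemma nets_in_schwartz_slowly_increasing: "nets_in schwartz \<subseteq> nets_in slowly_increasing"
  by (rule nets_in_mono[OF schwartz_slowly_increasing])

lemma nets_in_slowly_increasing_smooth: "nets_in slowly_increasing \<subseteq> nets_in (Collect smooth)"
  by (rule nets_in_mono) (auto intro: slowly_increasing_smooth)

lemma nets_in_schwartz_smooth: "nets_in schwartz \<subseteq> nets_in (Collect smooth)"
  by (rule nets_in_mono) (auto intro: schwartz_smooth)

lemma nets_in_schwartz_closed:
  "0 \<in> nets_in schwartz"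
  "u \<in> nets_in schwartz \<Longrightarrow> v \<in> nets_in schwartz \<Longrightarrow> u + v \<in> nets_in schwartz"
  "u \<in> nets_in schwartz \<Longrightarrow> net_scale l u \<in> nets_in schwartz"
  by (auto simp: nets_in_def net_scale_def schwartz_0 schwartz_add schwartz_cmult)

lemma nets_in_slowly_increasing_closed:
  "0 \<in> nets_in slowly_increasing"
  "u \<in> nets_in slowly_increasing \<Longrightarrow> v \<in> nets_in slowly_increasing \<Longrightarrow> u + v \<in> nets_in slowly_increasing"
  "u \<in> nets_in slowly_increasing \<Longrightarrow> net_scale l u \<in> nets_in slowly_increasing"
  by (auto simp: nets_in_def net_scale_def slowly_increasing_0 slowly_increasing_add slowly_increasing_cmult)

lemma wsup_bigo_add:
  assumes "u \<in> nets_in (Collect smooth)" "v \<in> nets_in (Collect smooth)" "\<And>x. w x \<ge> 0"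
    "eps_bigo (\<lambda>\<epsilon>. wsup w A (u \<epsilon>)) b" "eps_bigo (\<lambda>\<epsilon>. wsup w A (v \<epsilon>)) b"
  shows "eps_bigo (\<lambda>\<epsilon>. wsup w A ((u + v) \<epsilon>)) b"
proof (rule eps_bigo_mono[OF eps_bigo_add[OF assms(4,5)]])
  fix \<epsilon> :: real assume "0 < \<epsilon>" "\<epsilon> \<le> 1"
  then show "wsup w A ((u + v) \<epsilon>) \<le> wsup w A (u \<epsilon>) + wsup w A (v \<epsilon>)"
    using assms(1-3) nets_in_eps by (auto intro!: wsup_add)
qed

lemma wsup_bigo_scale:
  assumes "u \<in> nets_in (Collect smooth)" "\<And>x. w x \<ge> 0"
    "eps_bigo (\<lambda>\<epsilon>. ennreal (cmod (l \<epsilon>))) a" "eps_bigo (\<lambda>\<epsilon>. wsup w A (u \<epsilon>)) b"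
  shows "eps_bigo (\<lambda>\<epsilon>. wsup w A (net_scale l u \<epsilon>)) (a + b)"
proof (rule eps_bigo_mono[OF eps_bigo_mult[OF assms(3,4)]])
  fix \<epsilon> :: real assume "0 < \<epsilon>" "\<epsilon> \<le> 1"
  then show "wsup w A (net_scale l u \<epsilon>) \<le> ennreal (cmod (l \<epsilon>)) * wsup w A (u \<epsilon>)"
    using assms(1,2) nets_in_eps unfolding net_scale_def by (auto intro!: wsup_cmult)
qed

lemma net_scale_simps:
  "net_scale l (u + v) = net_scale l u + net_scale l v"
  "net_scale l (u - v) = net_scale l u - net_scale l v"
  "net_scale (l + k) u = net_scale l u + net_scale k u"
  "net_scale (l - k) u = net_scale l u - net_scale k u"
  "net_scale l (net_scale k u) = net_scale (l * k) u"
  "net_scale 1 u = u" "net_scale (- 1) u = - u"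
  by (auto simp: net_scale_def fun_eq_iff algebra_simps)


section \<open>Generalized functions based on the Schwartz space\<close>

definition moderate_S :: "(real \<Rightarrow> real^'n::finite \<Rightarrow> complex) set" where
  "moderate_S = {u \<in> nets_in schwartz.
     \<forall>j. \<exists>N::nat. eps_bigo (\<lambda>\<epsilon>. schwartz_seminorm j (u \<epsilon>)) (- real N)}"

definition negligible_S :: "(real \<Rightarrow> real^'n::finite \<Rightarrow> complex) set" where
  "negligible_S = {u \<in> nets_in schwartz.
     \<forall>j. \<forall>q::nat. eps_bigo (\<lambda>\<epsilon>. schwartz_seminorm j (u \<epsilon>)) (real q)}"

lemma bigo_nat_all:
  assumes "\<And>q::nat. eps_bigo g (real q)"
  shows "eps_bigo g b"
proof -
  obtain q :: nat where "b \<le> real q" using real_arch_simple by blast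
  then show ?thesis using assms eps_bigo_weaken by blast
qed

lemma bigo_nat_ex:
  assumes "eps_bigo g b"
  shows "\<exists>N::nat. eps_bigo g (- real N)"
proof -
  obtain N :: nat where "- b \<le> real N" using real_arch_simple by blast
  then show ?thesis using eps_bigo_weaken[OF assms, of "- real N"] by auto
qed

lemma bigo_nat_ex2:
  assumes "eps_bigo g b" "eps_bigo h c"
  obtains N :: nat where "eps_bigo g (- real N)" "eps_bigo h (- real N)"
proof -
  obtain N :: nat where "- min b c \<le> real N" using real_arch_simple by blast
  then show ?thesis
    using that[of N] eps_bigo_weaken[OF assms(1), of "- real N"] eps_bigo_weaken[OF assms(2), of "- real N"]
    by auto
qed

lemma moderate_S_add: "u \<in> moderate_S \<Longrightarrow> v \<in> moderate_S \<Longrightarrow> u + v \<in> moderate_S"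
proof -
  assume *: "u \<in> moderate_S" "v \<in> moderate_S"
  have "\<exists>N::nat. eps_bigo (\<lambda>\<epsilon>. schwartz_seminorm j ((u + v) \<epsilon>)) (- real N)" for j
  proof -
    obtain N1 N2 :: nat where "eps_bigo (\<lambda>\<epsilon>. schwartz_seminorm j (u \<epsilon>)) (- real N1)"
      "eps_bigo (\<lambda>\<epsilon>. schwartz_seminorm j (v \<epsilon>)) (- real N2)"
      using * unfolding moderate_S_def by blast
    then obtain N :: nat where "eps_bigo (\<lambda>\<epsilon>. schwartz_seminorm j (u \<epsilon>)) (- real N)"
      "eps_bigo (\<lambda>\<epsilon>. schwartz_seminorm j (v \<epsilon>)) (- real N)" by (rule bigo_nat_ex2)
    then have "eps_bigo (\<lambda>\<epsilon>. schwartz_seminorm j ((u + v) \<epsilon>)) (- real N)"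
      using * nets_in_schwartz_smooth unfolding schwartz_seminorm_def moderate_S_def
      by (intro wsup_bigo_add) auto
    then show ?thesis by blast
  qed
  then show ?thesis using * nets_in_schwartz_closed(2) unfolding moderate_S_def by auto
qed

lemma moderate_S_scale: "l \<in> moderate_num \<Longrightarrow> u \<in> moderate_S \<Longrightarrow> net_scale l u \<in> moderate_S"
proof -
  assume *: "l \<in> moderate_num" "u \<in> moderate_S"
  obtain a where a: "eps_bigo (\<lambda>\<epsilon>. ennreal (cmod (l \<epsilon>))) a" using * moderate_num_ex by blast
  have "\<exists>N::nat. eps_bigo (\<lambda>\<epsilon>. schwartz_seminorm j (net_scale l u \<epsilon>)) (- real N)" for j
  proof -
    obtain N :: nat where "eps_bigo (\<lambda>\<epsilon>. schwartz_seminorm j (u \<epsilon>)) (- real N)"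
      using * unfolding moderate_S_def by blast
    then have "eps_bigo (\<lambda>\<epsilon>. schwartz_seminorm j (net_scale l u \<epsilon>)) (a + - real N)"
      using * nets_in_schwartz_smooth a unfolding schwartz_seminorm_def moderate_S_def
      by (intro wsup_bigo_scale) auto
    then show ?thesis by (rule bigo_nat_ex)
  qed
  then show ?thesis using * nets_in_schwartz_closed(3) unfolding moderate_S_def by auto
qed

lemma negligible_S_add: "u \<in> negligible_S \<Longrightarrow> v \<in> negligible_S \<Longrightarrow> u + v \<in> negligible_S"
proof -
  assume *: "u \<in> negligible_S" "v \<in> negligible_S"
  have "eps_bigo (\<lambda>\<epsilon>. schwartz_seminorm j ((u + v) \<epsilon>)) (real q)" for j and q :: nat
    using * nets_in_schwartz_smooth unfolding schwartz_seminorm_def negligible_S_def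
    by (intro wsup_bigo_add) auto
  then show ?thesis using * nets_in_schwartz_closed(2) unfolding negligible_S_def by auto
qed

lemma negligible_S_scale: "l \<in> moderate_num \<Longrightarrow> u \<in> negligible_S \<Longrightarrow> net_scale l u \<in> negligible_S"
proof -
  assume *: "l \<in> moderate_num" "u \<in> negligible_S"
  obtain a where a: "eps_bigo (\<lambda>\<epsilon>. ennreal (cmod (l \<epsilon>))) a" using * moderate_num_ex by blast
  have "eps_bigo (\<lambda>\<epsilon>. schwartz_seminorm j (net_scale l u \<epsilon>)) b" for j b
  proof -
    have "eps_bigo (\<lambda>\<epsilon>. schwartz_seminorm j (u \<epsilon>)) (b - a)"
      using * unfolding negligible_S_def by - (rule bigo_nat_all, auto)
    then have "eps_bigo (\<lambda>\<epsilon>. schwartz_seminorm j (net_scale l u \<epsilon>)) (a + (b - a))"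
      using * nets_in_schwartz_smooth a unfolding schwartz_seminorm_def negligible_S_def
      by (intro wsup_bigo_scale) auto
    then show ?thesis by simp
  qed
  then show ?thesis using * nets_in_schwartz_closed(3) unfolding negligible_S_def by auto
qed

lemma negligible_S_scale2: "l \<in> negligible_num \<Longrightarrow> u \<in> moderate_S \<Longrightarrow> net_scale l u \<in> negligible_S"
proof -
  assume *: "l \<in> negligible_num" "u \<in> moderate_S"
  have "eps_bigo (\<lambda>\<epsilon>. schwartz_seminorm j (net_scale l u \<epsilon>)) b" for j b
  proof -
    obtain N :: nat where "eps_bigo (\<lambda>\<epsilon>. schwartz_seminorm j (u \<epsilon>)) (- real N)"
      using * unfolding moderate_S_def by blast
    then have "eps_bigo (\<lambda>\<epsilon>. schwartz_seminorm j (net_scale l u \<epsilon>)) ((b + real N) + - real N)"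
      using * nets_in_schwartz_smooth unfolding schwartz_seminorm_def moderate_S_def negligible_num_all
      by (intro wsup_bigo_scale) auto
    then show ?thesis by simp
  qed
  then show ?thesis using * nets_in_schwartz_closed(3)
    unfolding negligible_S_def moderate_S_def by auto
qed

lemma moderate_S_0: "0 \<in> moderate_S"
  by (auto simp: moderate_S_def nets_in_schwartz_closed schwartz_seminorm_def)

lemma negligible_S_0: "0 \<in> negligible_S"
  by (auto simp: negligible_S_def nets_in_schwartz_closed schwartz_seminorm_def)

lemma moderate_num_m1: "- 1 \<in> moderate_num"
  using moderate_num_uminus[OF moderate_num_1] .

lemma moderate_S_uminus: "u \<in> moderate_S \<Longrightarrow> - u \<in> moderate_S"
  using moderate_S_scale[OF moderate_num_m1, of u] by (simp add: net_scale_simps)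

lemma negligible_S_uminus: "u \<in> negligible_S \<Longrightarrow> - u \<in> negligible_S"
  using negligible_S_scale[OF moderate_num_m1, of u] by (simp add: net_scale_simps)

lemma part_equivp_quotient:
  fixes E N :: "'a::ab_group_add set"
  assumes "0 \<in> E" "0 \<in> N" "\<And>u v. u \<in> N \<Longrightarrow> v \<in> N \<Longrightarrow> u + v \<in> N" "\<And>u. u \<in> N \<Longrightarrow> - u \<in> N"
  shows "part_equivp (\<lambda>u v. u \<in> E \<and> v \<in> E \<and> u - v \<in> N)"
proof (rule part_equivpI)
  show "\<exists>x. x \<in> E \<and> x \<in> E \<and> x - x \<in> N" using assms(1,2) by auto
  show "symp (\<lambda>z w. z \<in> E \<and> w \<in> E \<and> z - w \<in> N)"
    by (rule sympI) (metis minus_diff_eq assms(4))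
  show "transp (\<lambda>z w. z \<in> E \<and> w \<in> E \<and> z - w \<in> N)"
  proof (rule transpI, intro conjI)
    fix x y z :: 'a
    assume "x \<in> E \<and> y \<in> E \<and> x - y \<in> N" "y \<in> E \<and> z \<in> E \<and> y - z \<in> N"
    then show "x - z \<in> N" using assms(3)[of "x - y" "y - z"] by simp
  qed auto
qed

quotient_type 'n G_S = "real \<Rightarrow> (real, 'n::finite) vec \<Rightarrow> complex" /
  partial: "\<lambda>u v. u \<in> moderate_S \<and> v \<in> moderate_S \<and> u - v \<in> negligible_S"
  by (rule part_equivp_quotient[OF moderate_S_0 negligible_S_0 negligible_S_add negligible_S_uminus])

lemma diff_closed:
  fixes N :: "'a::ab_group_add set"
  assumes "\<And>u v. u \<in> N \<Longrightarrow> v \<in> N \<Longrightarrow> u + v \<in> N"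
  shows "u1 - u2 \<in> N \<Longrightarrow> v1 - v2 \<in> N \<Longrightarrow> u1 + v1 - (u2 + v2) \<in> N"
  using assms[of "u1 - u2" "v1 - v2"] by (simp add: algebra_simps)

lemma diff_uminus_closed:
  fixes N :: "'a::ab_group_add set"
  assumes "\<And>u. u \<in> N \<Longrightarrow> - u \<in> N"
  shows "u1 - u2 \<in> N \<Longrightarrow> - u1 - - u2 \<in> N"
  using assms[of "u1 - u2"] by simp

instantiation G_S :: (finite) ab_group_add
begin

lift_definition zero_G_S :: "'a G_S" is 0
  using moderate_S_0 negligible_S_0 by simp

lift_definition plus_G_S :: "'a G_S \<Rightarrow> 'a G_S \<Rightarrow> 'a G_S" is "(+)"
  using moderate_S_add diff_closed[OF negligible_S_add] by blast

lift_definition uminus_G_S :: "'a G_S \<Rightarrow> 'a G_S" is uminus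
  using moderate_S_uminus diff_uminus_closed[OF negligible_S_uminus] by blast

definition minus_G_S :: "'a G_S \<Rightarrow> 'a G_S \<Rightarrow> 'a G_S" where
  "minus_G_S u v = u + - v"

instance
proof
  fix a b c :: "'a G_S"
  note r = moderate_S_0 moderate_S_add moderate_S_uminus negligible_S_0
  show "a + b + c = a + (b + c)" by transfer (auto simp: add.assoc intro: r)
  show "a + b = b + a" by transfer (auto simp: add.commute intro: r)
  show "0 + a = a" by transfer (auto intro: r)
  show "- a + a = 0" by transfer (auto intro: r)
  show "a - b = a + - b" by (simp add: minus_G_S_def)
qed

end

lift_definition scale_S :: "gcomplex \<Rightarrow> 'n::finite G_S \<Rightarrow> 'n G_S" is net_scale
proof (intro conjI)
  fix l k :: "real \<Rightarrow> complex" and u v :: "real \<Rightarrow> real^'n \<Rightarrow> complex"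
  assume *: "l \<in> moderate_num \<and> k \<in> moderate_num \<and> l - k \<in> negligible_num"
    "u \<in> moderate_S \<and> v \<in> moderate_S \<and> u - v \<in> negligible_S"
  then show "net_scale l u \<in> moderate_S" "net_scale k v \<in> moderate_S"
    by (auto intro: moderate_S_scale)
  have "net_scale (l - k) u + net_scale k (u - v) \<in> negligible_S"
    using * by (intro negligible_S_add negligible_S_scale negligible_S_scale2) auto
  then show "net_scale l u - net_scale k v \<in> negligible_S" by (simp add: net_scale_simps)
qed

lemma module_S: "module (scale_S :: gcomplex \<Rightarrow> 'n::finite G_S \<Rightarrow> 'n G_S)"
proof
  fix a b :: gcomplex and x y :: "'n G_S"
  note r = moderate_S_add moderate_S_scale negligible_S_0 moderate_num_add moderate_num_mult
  show "scale_S a (x + y) = scale_S a x + scale_S a y"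
    by transfer (auto simp: net_scale_simps intro: r)
  show "scale_S (a + b) x = scale_S a x + scale_S b x"
    by transfer (auto simp: net_scale_simps intro: r)
  show "scale_S a (scale_S b x) = scale_S (a * b) x"
    by transfer (auto simp: net_scale_simps intro: r)
  show "scale_S 1 x = x"
    by transfer (auto simp: net_scale_simps intro: r)
qed

lift_definition P_S :: "nat \<Rightarrow> 'n::finite G_S \<Rightarrow> real"
  is "\<lambda>j u. exp_val (\<lambda>\<epsilon>. schwartz_seminorm j (u \<epsilon>))"
proof (rule exp_val_cong)
  fix j b and u v :: "real \<Rightarrow> real^'n \<Rightarrow> complex"
  assume *: "u \<in> moderate_S \<and> v \<in> moderate_S \<and> u - v \<in> negligible_S"
  have neg: "eps_bigo (\<lambda>\<epsilon>. schwartz_seminorm j (w \<epsilon>)) b" if "w \<in> negligible_S" for w :: "real \<Rightarrow> real^'n \<Rightarrow> complex"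
    using that unfolding negligible_S_def by - (rule bigo_nat_all, auto)
  have d: "u - v \<in> negligible_S" "v - u \<in> negligible_S" using * negligible_S_uminus[of "u - v"] by auto
  have sm: "u - v \<in> nets_in (Collect smooth)" "v - u \<in> nets_in (Collect smooth)"
    "u \<in> nets_in (Collect smooth)" "v \<in> nets_in (Collect smooth)"
    using * d nets_in_schwartz_smooth unfolding negligible_S_def moderate_S_def by auto
  show "eps_bigo (\<lambda>\<epsilon>. schwartz_seminorm j (u \<epsilon>)) b = eps_bigo (\<lambda>\<epsilon>. schwartz_seminorm j (v \<epsilon>)) b"
    using neg[OF d(1)] neg[OF d(2)] unfolding schwartz_seminorm_def
    using wsup_bigo_add[OF sm(1) sm(4), of "\<lambda>x. (1 + norm x) ^ j" "multi_indices_le j" b]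
      wsup_bigo_add[OF sm(2) sm(3), of "\<lambda>x. (1 + norm x) ^ j" "multi_indices_le j" b] by auto
qed

definition top_S :: "'n::finite G_S topology" where
  "top_S = seminorm_topology UNIV (range P_S)"


section \<open>Tempered generalized functions\<close>

definition moderate_tau :: "(real \<Rightarrow> real^'n::finite \<Rightarrow> complex) set" where
  "moderate_tau = {u \<in> nets_in slowly_increasing.
     \<forall>\<alpha>. \<exists>N::nat. eps_bigo (\<lambda>\<epsilon>. wsup (tempered_weight N) {\<alpha>} (u \<epsilon>)) (- real N)}"

definition negligible_tau :: "(real \<Rightarrow> real^'n::finite \<Rightarrow> complex) set" where
  "negligible_tau = {u \<in> nets_in slowly_increasing.
     \<forall>\<alpha>. \<exists>N::nat. \<forall>q::nat. eps_bigo (\<lambda>\<epsilon>. wsup (tempered_weight N) {\<alpha>} (u \<epsilon>)) (real q)}"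

lemma tau_weaken:
  assumes "eps_bigo (\<lambda>\<epsilon>. wsup (tempered_weight N) A (u \<epsilon>)) b" "N \<le> M" "a \<le> b"
  shows "eps_bigo (\<lambda>\<epsilon>. wsup (tempered_weight M) A (u \<epsilon>)) a"
  by (rule eps_bigo_weaken[OF _ assms(3)], rule eps_bigo_mono[OF assms(1)], rule wsup_mono)
     (auto intro: tempered_weight_antimono[OF assms(2)])

lemma moderate_tau_add: "u \<in> moderate_tau \<Longrightarrow> v \<in> moderate_tau \<Longrightarrow> u + v \<in> moderate_tau"
proof -
  assume *: "u \<in> moderate_tau" "v \<in> moderate_tau"
  have "\<exists>N::nat. eps_bigo (\<lambda>\<epsilon>. wsup (tempered_weight N) {\<alpha>} ((u + v) \<epsilon>)) (- real N)" for \<alpha>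
  proof -
    obtain N1 N2 :: nat where "eps_bigo (\<lambda>\<epsilon>. wsup (tempered_weight N1) {\<alpha>} (u \<epsilon>)) (- real N1)"
      "eps_bigo (\<lambda>\<epsilon>. wsup (tempered_weight N2) {\<alpha>} (v \<epsilon>)) (- real N2)"
      using * unfolding moderate_tau_def by blast
    then have "eps_bigo (\<lambda>\<epsilon>. wsup (tempered_weight (N1 + N2)) {\<alpha>} (u \<epsilon>)) (- real (N1 + N2))"
      "eps_bigo (\<lambda>\<epsilon>. wsup (tempered_weight (N1 + N2)) {\<alpha>} (v \<epsilon>)) (- real (N1 + N2))"
      by (auto elim: tau_weaken)
    then have "eps_bigo (\<lambda>\<epsilon>. wsup (tempered_weight (N1 + N2)) {\<alpha>} ((u + v) \<epsilon>)) (- real (N1 + N2))"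
      using * nets_in_slowly_increasing_smooth unfolding moderate_tau_def
      by (intro wsup_bigo_add) (auto simp: tempered_weight_nonneg)
    then show ?thesis by blast
  qed
  then show ?thesis using * nets_in_slowly_increasing_closed(2) unfolding moderate_tau_def by auto
qed

lemma moderate_tau_scale: "l \<in> moderate_num \<Longrightarrow> u \<in> moderate_tau \<Longrightarrow> net_scale l u \<in> moderate_tau"
proof -
  assume *: "l \<in> moderate_num" "u \<in> moderate_tau"
  obtain K :: nat where K: "eps_bigo (\<lambda>\<epsilon>. ennreal (cmod (l \<epsilon>))) (- real K)"
    using * unfolding moderate_num_def by blast
  have "\<exists>N::nat. eps_bigo (\<lambda>\<epsilon>. wsup (tempered_weight N) {\<alpha>} (net_scale l u \<epsilon>)) (- real N)" for \<alpha>
  proof -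
    obtain N :: nat where N: "eps_bigo (\<lambda>\<epsilon>. wsup (tempered_weight N) {\<alpha>} (u \<epsilon>)) (- real N)"
      using * unfolding moderate_tau_def by blast
    then have "eps_bigo (\<lambda>\<epsilon>. wsup (tempered_weight N) {\<alpha>} (net_scale l u \<epsilon>)) (- real K + - real N)"
      using * nets_in_slowly_increasing_smooth K unfolding moderate_tau_def
      by (intro wsup_bigo_scale) (auto simp: tempered_weight_nonneg)
    then have "eps_bigo (\<lambda>\<epsilon>. wsup (tempered_weight (K + N)) {\<alpha>} (net_scale l u \<epsilon>)) (- real (K + N))"
      by (rule tau_weaken) auto
    then show ?thesis by blast
  qed
  then show ?thesis using * nets_in_slowly_increasing_closed(3) unfolding moderate_tau_def by auto
qed

lemma negligible_tau_add: "u \<in> negligible_tau \<Longrightarrow> v \<in> negligible_tau \<Longrightarrow> u + v \<in> negligible_tau"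
proof -
  assume *: "u \<in> negligible_tau" "v \<in> negligible_tau"
  have "\<exists>N::nat. \<forall>q::nat. eps_bigo (\<lambda>\<epsilon>. wsup (tempered_weight N) {\<alpha>} ((u + v) \<epsilon>)) (real q)" for \<alpha>
  proof -
    obtain N1 N2 :: nat where "\<And>q::nat. eps_bigo (\<lambda>\<epsilon>. wsup (tempered_weight N1) {\<alpha>} (u \<epsilon>)) (real q)"
      "\<And>q::nat. eps_bigo (\<lambda>\<epsilon>. wsup (tempered_weight N2) {\<alpha>} (v \<epsilon>)) (real q)"
      using * unfolding negligible_tau_def by blast
    then have "eps_bigo (\<lambda>\<epsilon>. wsup (tempered_weight (N1 + N2)) {\<alpha>} (u \<epsilon>)) (real q)"
      "eps_bigo (\<lambda>\<epsilon>. wsup (tempered_weight (N1 + N2)) {\<alpha>} (v \<epsilon>)) (real q)" for q :: nat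
      by (blast intro: tau_weaken[OF _ le_add1 order_refl], blast intro: tau_weaken[OF _ le_add2 order_refl])
    then have "eps_bigo (\<lambda>\<epsilon>. wsup (tempered_weight (N1 + N2)) {\<alpha>} ((u + v) \<epsilon>)) (real q)" for q :: nat
      using * nets_in_slowly_increasing_smooth unfolding negligible_tau_def
      by (intro wsup_bigo_add) (auto simp: tempered_weight_nonneg)
    then show ?thesis by blast
  qed
  then show ?thesis using * nets_in_slowly_increasing_closed(2) unfolding negligible_tau_def by auto
qed

lemma negligible_tau_scale: "l \<in> moderate_num \<Longrightarrow> u \<in> negligible_tau \<Longrightarrow> net_scale l u \<in> negligible_tau"
proof -
  assume *: "l \<in> moderate_num" "u \<in> negligible_tau"
  obtain a where a: "eps_bigo (\<lambda>\<epsilon>. ennreal (cmod (l \<epsilon>))) a" using * moderate_num_ex by blast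
  have "\<exists>N::nat. \<forall>q::nat. eps_bigo (\<lambda>\<epsilon>. wsup (tempered_weight N) {\<alpha>} (net_scale l u \<epsilon>)) (real q)" for \<alpha>
  proof -
    obtain N :: nat where "\<And>q::nat. eps_bigo (\<lambda>\<epsilon>. wsup (tempered_weight N) {\<alpha>} (u \<epsilon>)) (real q)"
      using * unfolding negligible_tau_def by blast
    then have "eps_bigo (\<lambda>\<epsilon>. wsup (tempered_weight N) {\<alpha>} (u \<epsilon>)) (b - a)" for b
      by (rule bigo_nat_all)
    then have "eps_bigo (\<lambda>\<epsilon>. wsup (tempered_weight N) {\<alpha>} (net_scale l u \<epsilon>)) (a + (b - a))" for b
      using * nets_in_slowly_increasing_smooth a unfolding negligible_tau_def
      by (intro wsup_bigo_scale) (auto simp: tempered_weight_nonneg)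
    then show ?thesis by auto
  qed
  then show ?thesis using * nets_in_slowly_increasing_closed(3) unfolding negligible_tau_def by auto
qed

lemma negligible_tau_scale2: "l \<in> negligible_num \<Longrightarrow> u \<in> moderate_tau \<Longrightarrow> net_scale l u \<in> negligible_tau"
proof -
  assume *: "l \<in> negligible_num" "u \<in> moderate_tau"
  have "\<exists>N::nat. \<forall>q::nat. eps_bigo (\<lambda>\<epsilon>. wsup (tempered_weight N) {\<alpha>} (net_scale l u \<epsilon>)) (real q)" for \<alpha>
  proof -
    obtain N :: nat where "eps_bigo (\<lambda>\<epsilon>. wsup (tempered_weight N) {\<alpha>} (u \<epsilon>)) (- real N)"
      using * unfolding moderate_tau_def by blast
    then have "eps_bigo (\<lambda>\<epsilon>. wsup (tempered_weight N) {\<alpha>} (net_scale l u \<epsilon>)) ((b + real N) + - real N)" for b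
      using * nets_in_slowly_increasing_smooth unfolding moderate_tau_def negligible_num_all
      by (intro wsup_bigo_scale) (auto simp: tempered_weight_nonneg)
    then show ?thesis by auto
  qed
  then show ?thesis using * nets_in_slowly_increasing_closed(3)
    unfolding negligible_tau_def moderate_tau_def by auto
qed

lemma moderate_tau_0: "0 \<in> moderate_tau"
  by (auto simp: moderate_tau_def nets_in_slowly_increasing_closed)

lemma negligible_tau_0: "0 \<in> negligible_tau"
  by (auto simp: negligible_tau_def nets_in_slowly_increasing_closed)

lemma moderate_tau_uminus: "u \<in> moderate_tau \<Longrightarrow> - u \<in> moderate_tau"
  using moderate_tau_scale[OF moderate_num_m1, of u] by (simp add: net_scale_simps)

lemma negligible_tau_uminus: "u \<in> negligible_tau \<Longrightarrow> - u \<in> negligible_tau"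
  using negligible_tau_scale[OF moderate_num_m1, of u] by (simp add: net_scale_simps)

quotient_type 'n G_tau = "real \<Rightarrow> (real, 'n::finite) vec \<Rightarrow> complex" /
  partial: "\<lambda>u v. u \<in> moderate_tau \<and> v \<in> moderate_tau \<and> u - v \<in> negligible_tau"
  by (rule part_equivp_quotient[OF moderate_tau_0 negligible_tau_0 negligible_tau_add negligible_tau_uminus])

instantiation G_tau :: (finite) ab_group_add
begin

lift_definition zero_G_tau :: "'a G_tau" is 0
  using moderate_tau_0 negligible_tau_0 by simp

lift_definition plus_G_tau :: "'a G_tau \<Rightarrow> 'a G_tau \<Rightarrow> 'a G_tau" is "(+)"
  using moderate_tau_add diff_closed[OF negligible_tau_add] by blast

lift_definition uminus_G_tau :: "'a G_tau \<Rightarrow> 'a G_tau" is uminus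
  using moderate_tau_uminus diff_uminus_closed[OF negligible_tau_uminus] by blast

definition minus_G_tau :: "'a G_tau \<Rightarrow> 'a G_tau \<Rightarrow> 'a G_tau" where
  "minus_G_tau u v = u + - v"

instance
proof
  fix a b c :: "'a G_tau"
  note r = moderate_tau_0 moderate_tau_add moderate_tau_uminus negligible_tau_0
  show "a + b + c = a + (b + c)" by transfer (auto simp: add.assoc intro: r)
  show "a + b = b + a" by transfer (auto simp: add.commute intro: r)
  show "0 + a = a" by transfer (auto intro: r)
  show "- a + a = 0" by transfer (auto intro: r)
  show "a - b = a + - b" by (simp add: minus_G_tau_def)
qed

end

lift_definition scale_tau :: "gcomplex \<Rightarrow> 'n::finite G_tau \<Rightarrow> 'n G_tau" is net_scale
proof (intro conjI)
  fix l k :: "real \<Rightarrow> complex" and u v :: "real \<Rightarrow> real^'n \<Rightarrow> complex"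
  assume *: "l \<in> moderate_num \<and> k \<in> moderate_num \<and> l - k \<in> negligible_num"
    "u \<in> moderate_tau \<and> v \<in> moderate_tau \<and> u - v \<in> negligible_tau"
  then show "net_scale l u \<in> moderate_tau" "net_scale k v \<in> moderate_tau"
    by (auto intro: moderate_tau_scale)
  have "net_scale (l - k) u + net_scale k (u - v) \<in> negligible_tau"
    using * by (intro negligible_tau_add negligible_tau_scale negligible_tau_scale2) auto
  then show "net_scale l u - net_scale k v \<in> negligible_tau" by (simp add: net_scale_simps)
qed

lemma module_tau: "module (scale_tau :: gcomplex \<Rightarrow> 'n::finite G_tau \<Rightarrow> 'n G_tau)"
proof
  fix a b :: gcomplex and x y :: "'n G_tau"
  note r = moderate_tau_add moderate_tau_scale negligible_tau_0 moderate_num_add moderate_num_mult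
  show "scale_tau a (x + y) = scale_tau a x + scale_tau a y"
    by transfer (auto simp: net_scale_simps intro: r)
  show "scale_tau (a + b) x = scale_tau a x + scale_tau b x"
    by transfer (auto simp: net_scale_simps intro: r)
  show "scale_tau a (scale_tau b x) = scale_tau (a * b) x"
    by transfer (auto simp: net_scale_simps intro: r)
  show "scale_tau 1 x = x"
    by transfer (auto simp: net_scale_simps intro: r)
qed


section \<open>The topology of the tempered generalized functions\<close>

text \<open>
  All the quotients \<open>\<G>\<^sup>m\<^sub>N\<^sub>,\<^sub>\<S>\<close>,
  \<open>\<G>\<^sup>m\<^sub>\<tau>\<^sub>,\<^sub>\<S>\<close> and
  \<open>\<G>\<^sub>\<tau>\<^sub>,\<^sub>\<S>\<close> are subsets of one type, that of the nets in
  \<open>\<O>\<^sub>M\<close> modulo \<open>\<N>\<^sub>\<S>\<close>.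
\<close>

quotient_type 'n OM_S = "real \<Rightarrow> (real, 'n::finite) vec \<Rightarrow> complex" /
  partial: "\<lambda>u v. u \<in> nets_in slowly_increasing \<and> v \<in> nets_in slowly_increasing \<and> u - v \<in> negligible_S"
  by (rule part_equivp_quotient[OF nets_in_slowly_increasing_closed(1)
        negligible_S_0 negligible_S_add negligible_S_uminus])

lemma nets_in_slowly_increasing_uminus:
  "u \<in> nets_in slowly_increasing \<Longrightarrow> - u \<in> nets_in slowly_increasing"
  using nets_in_slowly_increasing_closed(3)[of u "- 1"] by (simp add: net_scale_simps)

instantiation OM_S :: (finite) ab_group_add
begin

lift_definition zero_OM_S :: "'a OM_S" is 0
  using nets_in_slowly_increasing_closed(1) negligible_S_0 by simp

lift_definition plus_OM_S :: "'a OM_S \<Rightarrow> 'a OM_S \<Rightarrow> 'a OM_S" is "(+)"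
  using nets_in_slowly_increasing_closed(2) diff_closed[OF negligible_S_add] by blast

lift_definition uminus_OM_S :: "'a OM_S \<Rightarrow> 'a OM_S" is uminus
  using nets_in_slowly_increasing_uminus diff_uminus_closed[OF negligible_S_uminus] by blast

definition minus_OM_S :: "'a OM_S \<Rightarrow> 'a OM_S \<Rightarrow> 'a OM_S" where
  "minus_OM_S u v = u + - v"

instance
proof
  fix a b c :: "'a OM_S"
  note r = nets_in_slowly_increasing_closed nets_in_slowly_increasing_uminus negligible_S_0
  show "a + b + c = a + (b + c)" by transfer (auto simp: add.assoc intro: r)
  show "a + b = b + a" by transfer (auto simp: add.commute intro: r)
  show "0 + a = a" by transfer (auto intro: r)
  show "- a + a = 0" by transfer (auto intro: r)
  show "a - b = a + - b" by (simp add: minus_OM_S_def)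
qed

end

definition smult_OM_S :: "gcomplex \<Rightarrow> 'n::finite OM_S \<Rightarrow> 'n OM_S set" where
  "smult_OM_S l u = {abs_OM_S (net_scale k w) | k w.
     k \<in> moderate_num \<and> abs_gcomplex k = l \<and> w \<in> nets_in slowly_increasing \<and> abs_OM_S w = u}"

definition tempered_seminorm :: "nat \<Rightarrow> nat \<Rightarrow> (real^'n::finite \<Rightarrow> complex) \<Rightarrow> ennreal" where
  "tempered_seminorm m N = wsup (tempered_weight N) (multi_indices_le m)"

definition moderate_mN :: "nat \<Rightarrow> nat \<Rightarrow> (real \<Rightarrow> real^'n::finite \<Rightarrow> complex) set" where
  "moderate_mN m N = {u \<in> nets_in slowly_increasing.
     \<exists>M::nat. eps_bigo (\<lambda>\<epsilon>. tempered_seminorm m N (u \<epsilon>)) (- real M)}"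

definition G_mN :: "nat \<Rightarrow> nat \<Rightarrow> 'n::finite OM_S set" where
  "G_mN m N = abs_OM_S ` moderate_mN m N"

lemma tempered_seminorm_le_schwartz:
  "tempered_seminorm m N f \<le> schwartz_seminorm m f"
  unfolding tempered_seminorm_def schwartz_seminorm_def
  by (intro wsup_mono tempered_weight_le) auto

lemma tempered_seminorm_negligible:
  "u \<in> negligible_S \<Longrightarrow> eps_bigo (\<lambda>\<epsilon>. tempered_seminorm m N (u \<epsilon>)) b"
  by (rule eps_bigo_mono[OF bigo_nat_all tempered_seminorm_le_schwartz]) (simp add: negligible_S_def)

lift_definition P_mN :: "nat \<Rightarrow> nat \<Rightarrow> 'n::finite OM_S \<Rightarrow> real"
  is "\<lambda>m N u. exp_val (\<lambda>\<epsilon>. tempered_seminorm m N (u \<epsilon>))"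
proof (rule exp_val_cong)
  fix m N b and u v :: "real \<Rightarrow> real^'n \<Rightarrow> complex"
  assume *: "u \<in> nets_in slowly_increasing \<and> v \<in> nets_in slowly_increasing \<and> u - v \<in> negligible_S"
  have d: "u - v \<in> negligible_S" "v - u \<in> negligible_S" using * negligible_S_uminus[of "u - v"] by auto
  have sm: "u - v \<in> nets_in (Collect smooth)" "v - u \<in> nets_in (Collect smooth)"
    "u \<in> nets_in (Collect smooth)" "v \<in> nets_in (Collect smooth)"
    using * d nets_in_schwartz_smooth nets_in_slowly_increasing_smooth
    unfolding negligible_S_def by auto
  show "eps_bigo (\<lambda>\<epsilon>. tempered_seminorm m N (u \<epsilon>)) b = eps_bigo (\<lambda>\<epsilon>. tempered_seminorm m N (v \<epsilon>)) b"
    using tempered_seminorm_negligible[OF d(1), of m N b] tempered_seminorm_negligible[OF d(2), of m N b]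
    unfolding tempered_seminorm_def
    using wsup_bigo_add[OF sm(1) sm(4), of "tempered_weight N" "multi_indices_le m" b]
      wsup_bigo_add[OF sm(2) sm(3), of "tempered_weight N" "multi_indices_le m" b]
    by (auto simp: tempered_weight_nonneg)
qed

definition top_mN :: "nat \<Rightarrow> nat \<Rightarrow> 'n::finite OM_S topology" where
  "top_mN m N = seminorm_topology (G_mN m N) {P_mN m N}"

definition G_m :: "nat \<Rightarrow> 'n::finite OM_S set" where
  "G_m m = (\<Union>N. G_mN m N)"

definition top_m :: "nat \<Rightarrow> 'n::finite OM_S topology" where
  "top_m m = finest_lc smult_OM_S (G_m m) (range (\<lambda>N. (top_mN m N, \<lambda>u. u)))"

definition G_tau_S :: "'n::finite OM_S set" where
  "G_tau_S = (\<Inter>m. G_m m)"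

definition top_tau_S :: "'n::finite OM_S topology" where
  "top_tau_S = topology_generated_by {U \<inter> G_tau_S | U m. openin (top_m m) U}"

text \<open>The surjection from \<^const>\<open>G_tau_S\<close> onto \<open>\<G>\<^sub>\<tau>\<close>, identity on representatives.\<close>

definition proj_tau :: "'n::finite OM_S \<Rightarrow> 'n G_tau" where
  "proj_tau u = abs_G_tau (rep_OM_S u)"

definition top_tau :: "'n::finite G_tau topology" where
  "top_tau = finest_lc (\<lambda>l u. {scale_tau l u}) UNIV {(top_tau_S, proj_tau)}"

lemma negligible_S_moderate_mN: "negligible_S \<subseteq> moderate_mN m N"
  using nets_in_schwartz_slowly_increasing tempered_seminorm_negligible
  unfolding moderate_mN_def negligible_S_def[unfolded atomize_eq] by (fastforce simp: negligible_S_def)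

lemma moderate_mN_add: "u \<in> moderate_mN m N \<Longrightarrow> v \<in> moderate_mN m N \<Longrightarrow> u + v \<in> moderate_mN m N"
proof -
  assume *: "u \<in> moderate_mN m N" "v \<in> moderate_mN m N"
  obtain N1 N2 :: nat where "eps_bigo (\<lambda>\<epsilon>. tempered_seminorm m N (u \<epsilon>)) (- real N1)"
      "eps_bigo (\<lambda>\<epsilon>. tempered_seminorm m N (v \<epsilon>)) (- real N2)"
    using * unfolding moderate_mN_def by blast
  then obtain K :: nat where "eps_bigo (\<lambda>\<epsilon>. tempered_seminorm m N (u \<epsilon>)) (- real K)"
      "eps_bigo (\<lambda>\<epsilon>. tempered_seminorm m N (v \<epsilon>)) (- real K)" by (rule bigo_nat_ex2)
  then have "eps_bigo (\<lambda>\<epsilon>. tempered_seminorm m N ((u + v) \<epsilon>)) (- real K)"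
    using * nets_in_slowly_increasing_smooth unfolding tempered_seminorm_def moderate_mN_def
    by (intro wsup_bigo_add) (auto simp: tempered_weight_nonneg)
  then show ?thesis using * nets_in_slowly_increasing_closed(2) unfolding moderate_mN_def by auto
qed

lemma abs_OM_S_eq:
  assumes "u \<in> nets_in slowly_increasing" "v \<in> nets_in slowly_increasing"
  shows "abs_OM_S u = abs_OM_S v \<longleftrightarrow> u - v \<in> negligible_S"
  using Quotient_rel[OF Quotient_OM_S, of u v] assms negligible_S_0 by auto

lemma rep_OM_S:
  fixes u :: "'a::finite OM_S"
  shows
  "rep_OM_S u \<in> nets_in slowly_increasing" "abs_OM_S (rep_OM_S u) = u"
  "w \<in> nets_in slowly_increasing \<Longrightarrow> (w :: real \<Rightarrow> real^'a \<Rightarrow> complex) - rep_OM_S (abs_OM_S w) \<in> negligible_S"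
proof -
  show 1: "rep_OM_S u \<in> nets_in slowly_increasing" for u :: "'a OM_S"
    using Quotient_rep_reflp[OF Quotient_OM_S] by blast
  show 2: "abs_OM_S (rep_OM_S u) = u" for u :: "'a OM_S"
    by (rule Quotient_abs_rep[OF Quotient_OM_S])
  show "w - rep_OM_S (abs_OM_S w) \<in> negligible_S"
    if "w \<in> nets_in slowly_increasing"
    using abs_OM_S_eq[OF that 1[of "abs_OM_S w"]] 2 by simp
qed

lemma G_mN_iff: "u \<in> G_mN m N \<longleftrightarrow> rep_OM_S u \<in> moderate_mN m N"
proof
  assume "u \<in> G_mN m N"
  then obtain w where w: "w \<in> moderate_mN m N" "u = abs_OM_S w" unfolding G_mN_def by blast
  then have "w - rep_OM_S u \<in> negligible_S" using rep_OM_S(3) unfolding moderate_mN_def by blast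
  then have "- (w - rep_OM_S u) \<in> moderate_mN m N"
    using negligible_S_uminus negligible_S_moderate_mN by blast
  from moderate_mN_add[OF w(1) this] show "rep_OM_S u \<in> moderate_mN m N" by simp
next
  assume "rep_OM_S u \<in> moderate_mN m N"
  then show "u \<in> G_mN m N" unfolding G_mN_def using rep_OM_S(2) by (metis imageI)
qed

lemma moderate_tau_eq: "moderate_tau = (\<Inter>m. \<Union>N. moderate_mN m N)"
proof (intro set_eqI iffI INT_I)
  fix u :: "real \<Rightarrow> real^'a \<Rightarrow> complex" and m
  assume u: "u \<in> moderate_tau"
  have fin: "finite (multi_indices_le m :: ('a \<Rightarrow> nat) set)"
  proof (rule finite_subset)
    show "multi_indices_le m \<subseteq> PiE (UNIV :: 'a set) (\<lambda>_. {..m})"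
    proof
      fix \<alpha> :: "'a \<Rightarrow> nat" assume a: "\<alpha> \<in> multi_indices_le m"
      have "\<alpha> i \<le> m" for i
        using member_le_sum[of i UNIV \<alpha>] a unfolding multi_indices_le_def by simp
      then show "\<alpha> \<in> PiE UNIV (\<lambda>_. {..m})" by (simp add: PiE_UNIV_domain)
    qed
  qed (simp add: finite_PiE)
  have "\<exists>N::nat. eps_bigo (\<lambda>\<epsilon>. wsup (tempered_weight N) A (u \<epsilon>)) (- real N)"
    if "finite A" for A
    using that
  proof induction
    case empty
    then show ?case by (simp add: wsup_def bot_ennreal)
  next
    case (insert \<alpha> A)
    obtain N1 where N1: "eps_bigo (\<lambda>\<epsilon>. wsup (tempered_weight N1) A (u \<epsilon>)) (- real N1)"
      using insert by blast
    obtain N2 :: nat where N2: "eps_bigo (\<lambda>\<epsilon>. wsup (tempered_weight N2) {\<alpha>} (u \<epsilon>)) (- real N2)"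
      using u unfolding moderate_tau_def by blast
    let ?N = "N1 + N2"
    have "eps_bigo (\<lambda>\<epsilon>. wsup (tempered_weight ?N) A (u \<epsilon>)) (- real ?N)"
      "eps_bigo (\<lambda>\<epsilon>. wsup (tempered_weight ?N) {\<alpha>} (u \<epsilon>)) (- real ?N)"
      by (rule tau_weaken[OF N1] tau_weaken[OF N2]; simp)+
    then have "eps_bigo (\<lambda>\<epsilon>. wsup (tempered_weight ?N) A (u \<epsilon>) + wsup (tempered_weight ?N) {\<alpha>} (u \<epsilon>)) (- real ?N)"
      by (rule eps_bigo_add)
    then have "eps_bigo (\<lambda>\<epsilon>. wsup (tempered_weight ?N) (insert \<alpha> A) (u \<epsilon>)) (- real ?N)"
    proof (rule eps_bigo_mono)
      fix \<epsilon>
      show "wsup (tempered_weight ?N) (insert \<alpha> A) (u \<epsilon>)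
        \<le> wsup (tempered_weight ?N) A (u \<epsilon>) + wsup (tempered_weight ?N) {\<alpha>} (u \<epsilon>)"
        unfolding wsup_def[of _ "insert \<alpha> A"]
      proof (intro SUP_least)
        fix x \<beta> assume "\<beta> \<in> insert \<alpha> A"
        then have "ennreal (tempered_weight ?N x * cmod (mderiv \<beta> (u \<epsilon>) x)) \<le> wsup (tempered_weight ?N) A (u \<epsilon>)
          \<or> ennreal (tempered_weight ?N x * cmod (mderiv \<beta> (u \<epsilon>) x)) \<le> wsup (tempered_weight ?N) {\<alpha>} (u \<epsilon>)"
          unfolding wsup_def by (auto intro!: SUP_upper2[where i = x] SUP_upper2[where i = \<beta>] SUP_upper)
        then show "ennreal (tempered_weight ?N x * cmod (mderiv \<beta> (u \<epsilon>) x)) \<le>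
            wsup (tempered_weight ?N) A (u \<epsilon>) + wsup (tempered_weight ?N) {\<alpha>} (u \<epsilon>)"
          by (auto intro: add_increasing add_increasing2)
      qed
    qed
    then show ?case by blast
  qed
  from this[OF fin] show "u \<in> (\<Union>N. moderate_mN m N)"
    using u unfolding moderate_mN_def moderate_tau_def tempered_seminorm_def by blast
next
  fix u :: "real \<Rightarrow> real^'a \<Rightarrow> complex"
  assume u: "u \<in> (\<Inter>m. \<Union>N. moderate_mN m N)"
  have "\<exists>N::nat. eps_bigo (\<lambda>\<epsilon>. wsup (tempered_weight N) {\<alpha>} (u \<epsilon>)) (- real N)" for \<alpha>
  proof -
    obtain N M :: nat where "eps_bigo (\<lambda>\<epsilon>. tempered_seminorm (sum \<alpha> UNIV) N (u \<epsilon>)) (- real M)"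
      using u unfolding moderate_mN_def by blast
    then have "eps_bigo (\<lambda>\<epsilon>. wsup (tempered_weight N) {\<alpha>} (u \<epsilon>)) (- real M)"
      unfolding tempered_seminorm_def
      by (rule eps_bigo_mono) (auto intro!: wsup_mono simp: multi_indices_le_def)
    then have "eps_bigo (\<lambda>\<epsilon>. wsup (tempered_weight (N + M)) {\<alpha>} (u \<epsilon>)) (- real (N + M))"
      by (rule tau_weaken) auto
    then show ?thesis by blast
  qed
  then show "u \<in> moderate_tau" using u unfolding moderate_tau_def moderate_mN_def by auto
qed

lemma G_tau_S_eq: "G_tau_S = abs_OM_S ` moderate_tau"
proof -
  have "u \<in> G_tau_S \<longleftrightarrow> rep_OM_S u \<in> moderate_tau" for u :: "'a OM_S"
    unfolding G_tau_S_def G_m_def moderate_tau_eq by (simp add: G_mN_iff)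
  moreover have "rep_OM_S (abs_OM_S w) \<in> moderate_tau"
    if w: "w \<in> moderate_tau" for w :: "real \<Rightarrow> real^'a \<Rightarrow> complex"
  proof -
    have "abs_OM_S w \<in> G_mN m N" if "w \<in> moderate_mN m N" for m N
      using that unfolding G_mN_def by blast
    then show ?thesis using w unfolding moderate_tau_eq by (fastforce simp: G_mN_iff)
  qed
  ultimately show ?thesis by (auto simp: image_iff) (metis rep_OM_S(2))
qed

lemma moderate_S_tau: "moderate_S \<subseteq> moderate_tau"
proof
  fix u :: "real \<Rightarrow> real^'a \<Rightarrow> complex" assume u: "u \<in> moderate_S"
  have "u \<in> moderate_mN m 0" for m
  proof -
    obtain M :: nat where "eps_bigo (\<lambda>\<epsilon>. schwartz_seminorm m (u \<epsilon>)) (- real M)"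
      using u unfolding moderate_S_def by blast
    then have "eps_bigo (\<lambda>\<epsilon>. tempered_seminorm m 0 (u \<epsilon>)) (- real M)"
      by (rule eps_bigo_mono[OF _ tempered_seminorm_le_schwartz])
    then show ?thesis using u nets_in_schwartz_slowly_increasing
      unfolding moderate_mN_def moderate_S_def by blast
  qed
  then show "u \<in> moderate_tau" unfolding moderate_tau_eq by blast
qed

lemma negligible_S_tau: "negligible_S \<subseteq> negligible_tau"
proof
  fix u :: "real \<Rightarrow> real^'a \<Rightarrow> complex" assume u: "u \<in> negligible_S"
  have "eps_bigo (\<lambda>\<epsilon>. wsup (tempered_weight 0) {\<alpha>} (u \<epsilon>)) b" for \<alpha> b
    using tempered_seminorm_negligible[OF u, of "sum \<alpha> UNIV" 0 b]
    unfolding tempered_seminorm_def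
    by (rule eps_bigo_mono) (auto intro!: wsup_mono simp: multi_indices_le_def)
  then show "u \<in> negligible_tau" using u nets_in_schwartz_slowly_increasing
    unfolding negligible_tau_def negligible_S_def by blast
qed

lemma proj_tau_abs:
  fixes u :: "real \<Rightarrow> real^'a \<Rightarrow> complex"
  assumes "u \<in> moderate_tau"
  shows "proj_tau (abs_OM_S u) = abs_G_tau u"
proof -
  have u: "u \<in> nets_in slowly_increasing" using assms by (simp add: moderate_tau_def)
  have d: "u - rep_OM_S (abs_OM_S u) \<in> negligible_tau"
    using rep_OM_S(3)[OF u] negligible_S_tau by blast
  have "negligible_tau \<subseteq> (moderate_tau :: (real \<Rightarrow> real^'a \<Rightarrow> complex) set)"
  proof
    fix w :: "real \<Rightarrow> real^'a \<Rightarrow> complex" assume w: "w \<in> negligible_tau"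
    have "\<exists>N::nat. eps_bigo (\<lambda>\<epsilon>. wsup (tempered_weight N) {\<alpha>} (w \<epsilon>)) (- real N)" for \<alpha>
    proof -
      obtain N :: nat where "\<And>q::nat. eps_bigo (\<lambda>\<epsilon>. wsup (tempered_weight N) {\<alpha>} (w \<epsilon>)) (real q)"
        using w unfolding negligible_tau_def by blast
      from bigo_nat_all[OF this] show ?thesis by blast
    qed
    then show "w \<in> moderate_tau" using w unfolding negligible_tau_def moderate_tau_def by blast
  qed
  then have "- (u - rep_OM_S (abs_OM_S u)) \<in> moderate_tau" using d moderate_tau_uminus by blast
  from moderate_tau_add[OF assms this] have "rep_OM_S (abs_OM_S u) \<in> moderate_tau" by simp
  then show ?thesis unfolding proj_tau_def
    using Quotient_rel[OF Quotient_G_tau, of u "rep_OM_S (abs_OM_S u)"] assms d negligible_tau_0 by auto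
qed


section \<open>The embeddings\<close>

lift_definition embed_S_tau :: "'n::finite G_S \<Rightarrow> 'n G_tau" is "\<lambda>u. u"
  using moderate_S_tau negligible_S_tau by blast

definition dual_S :: "('n::finite G_S \<Rightarrow> gcomplex) set" where
  "dual_S = {T. module_hom scale_S (*) T \<and> continuous_map top_S euclidean T}"

text \<open>
  The topology of uniform convergence on bounded sets. The value 0 is inserted so that the supremum
  over the empty bounded set is 0.
\<close>

definition top_dual_S :: "('n::finite G_S \<Rightarrow> gcomplex) topology" where
  "top_dual_S = seminorm_topology dual_S
     {\<lambda>T. Sup (insert 0 ((\<lambda>u. gabs (T u)) ` B)) | B. lc_bounded (\<lambda>l u. {scale_S l u}) UNIV top_S B}"

definition net_integral ::
    "(real \<Rightarrow> real^'n::finite \<Rightarrow> complex) \<Rightarrow> (real \<Rightarrow> real^'n \<Rightarrow> complex) \<Rightarrow> real \<Rightarrow> complex" where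
  "net_integral u v = (\<lambda>\<epsilon>. LINT y|lborel. u \<epsilon> y * v \<epsilon> y)"

text \<open>
  The chosen representatives are immaterial: for \<open>u\<close> moderate in the tempered sense and
  \<open>v\<close> in \<^const>\<open>moderate_S\<close>, the class of \<open>net_integral u v\<close> depends on the classes of
  \<open>u\<close> and \<open>v\<close> only.
\<close>

definition pairing :: "'n::finite G_tau \<Rightarrow> 'n G_S \<Rightarrow> gcomplex" where
  "pairing u v = abs_gcomplex (net_integral (rep_G_tau u) (rep_G_S v))"

end

(*
On nets of rapidly decreasing functions the embedding into tempered generalized functions is injective
by interpolation: the square of a weighted derivative is a negligible factor with weight
(1 + |x|)^(-N) times a moderate factor with weight (1 + |x|)^(N + 2j).
The pairing satisfies |int u v| <= I * sup (1 + |x|)^(-N) |u| * sup (1 + |x|)^(N + n + 2) |v|, where I is the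
integral of (1 + |x|)^(-n-2). Hence the supremum of |int u v|_e over v in a bounded set B is an
ultra-pseudo-seminorm which is already continuous on the steps with m = 0 of the inductive limit, and this
gives the continuity of the pairing.
For its injectivity, a net u whose zero-order tempered estimate fails at some order does so at moderate
points x_eps. Gaussians concentrated at x_eps at a scale eps^P with P large reproduce u(x_eps) up to a
smaller error, so that the resulting integrals are not negligible. The derivatives are then negligible by
second-order Taylor expansion.
*)

theory Submission
  imports Defs "HOL-Computational_Algebra.Polynomial"
begin

section \<open>Ultra-pseudo-seminorms\<close>

text \<open>The topology \<open>top_tau\<close> is given by universal properties, and this shapes
  both continuity proofs. Into \<open>top_tau\<close> one composes: the embedding factors as
  \<open>proj_tau\<close> after a map into \<open>OM_S\<close> that reaches the step with weight
  exponent 0. Out of \<open>top_tau\<close> one tests a seminorm on one step at a time; its constant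
  may depend on N, and this freedom absorbs the Schwartz order N + n + 2. The pairing therefore has
  to live on the steps too, where multiplication by scalars is many-valued; integration removes the
  ambiguity, because a negligible number times a moderate integral is negligible. Injectivity of the
  pairing is tested at one point x_eps for each eps. A priori these points may escape to infinity at
  any speed, and Gaussians centred there need not form a moderate net. Asking for the estimate with
  one more power of 1 + |x| than the a priori bound on u has forces 1 + |x_eps| to be at most a
  constant times a power of 1/eps; the enlarged exponent does not depend on the order q, as
  \<open>negligible_tau\<close> requires.\<close>

lemma exp_val_mult_le:
  assumes g: "\<exists>a. eps_bigo g a" and h: "\<exists>a. eps_bigo h a"
    and le: "\<And>\<epsilon>. 0 < \<epsilon> \<Longrightarrow> \<epsilon> \<le> 1 \<Longrightarrow> k \<epsilon> \<le> ennreal C * (g \<epsilon> * h \<epsilon>)"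
  shows "exp_val k \<le> exp_val g * exp_val h"
proof -
  have C: "eps_bigo (\<lambda>_. ennreal C) 0"
    unfolding eps_bigo_def by (rule exI[of _ C], rule eventually_mono[OF eventually_eps]) simp
  \<comment> \<open>\<open>exp_val\<close> may be 0, where no logarithm is available; both factors
    are enlarged by \<open>e\<close>, and the limit \<open>e\<close> to 0 is taken at the
    end.\<close>
  have *: "exp_val k \<le> (exp_val g + e) * (exp_val h + e)" if "e > 0" for e
  proof -
    define s t where "s = exp_val g + e" and "t = exp_val h + e"
    have pos: "s > 0" "t > 0" using that exp_val_nonneg[of g] exp_val_nonneg[of h] by (auto simp: s_def t_def)
    have "eps_bigo g (- ln s)" "eps_bigo h (- ln t)"
      using that pos by (auto intro!: exp_val_less g h simp: s_def t_def)
    then have "eps_bigo k (0 + (- ln s + - ln t))"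
      by (intro eps_bigo_mono[OF eps_bigo_mult[OF C eps_bigo_mult] le])
    from exp_val_le[OF this] have "exp_val k \<le> exp (ln s) * exp (ln t)" by (simp add: exp_add[symmetric] add.commute)
    then show ?thesis using pos by (simp add: s_def t_def)
  qed
  have "((\<lambda>e. (exp_val g + e) * (exp_val h + e)) \<longlongrightarrow> (exp_val g + 0) * (exp_val h + 0)) (at_right 0)"
    by (intro tendsto_intros)
  moreover have "\<forall>\<^sub>F e in at_right 0. exp_val k \<le> (exp_val g + e) * (exp_val h + e)"
    using * eventually_at_right_less by (rule eventually_mono[rotated])
  ultimately show ?thesis
    using tendsto_lowerbound[of _ _ "at_right (0::real)"] by fastforce
qed

lemma gabs_mult_le: "gabs (z * w) \<le> gabs z * gabs w"
  by transfer
     (auto intro!: exp_val_mult_le[where C = 1] simp: norm_mult ennreal_mult moderate_num_ex)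

lemma gabs_1: "gabs 1 = 1"
proof (rule antisym)
  show "gabs 1 \<le> 1"
  proof transfer
    have "eps_bigo (\<lambda>\<epsilon>. ennreal (cmod (1 \<epsilon>))) 0"
      unfolding eps_bigo_def
      by (rule exI[of _ 1], rule eventually_mono[OF eventually_eps]) simp
    from exp_val_le[OF this] show "exp_val (\<lambda>\<epsilon>. ennreal (cmod (1 \<epsilon>))) \<le> 1" by simp
  qed
  \<comment> \<open>Submultiplicativity gives the lower bound: \<open>gabs 1\<close> is positive and
    at most its own square.\<close>
  have "gabs 1 > 0" using gabs_eq_0[of 1] gabs_nonneg[of 1] by simp
  then show "1 \<le> gabs 1" using gabs_mult_le[of 1 1] by simp
qed

lemma negligible_num_vanishing: "(\<And>\<epsilon>. 0 < \<epsilon> \<Longrightarrow> \<epsilon> \<le> 1 \<Longrightarrow> z \<epsilon> = 0) \<Longrightarrow> z \<in> negligible_num"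
  unfolding negligible_num_def by (auto intro: eps_bigo_mono[OF eps_bigo_zero])

lemma abs_gcomplex_eqI:
  assumes "z \<in> moderate_num" "w \<in> moderate_num" "z - w \<in> negligible_num"
  shows "abs_gcomplex z = abs_gcomplex w"
  using Quotient_rel[OF Quotient_gcomplex, of z w] assms negligible_num_0 by auto

lemma abs_gcomplex_eqD:
  assumes "z \<in> moderate_num" "w \<in> moderate_num" "abs_gcomplex z = abs_gcomplex w"
  shows "z - w \<in> negligible_num"
  using Quotient_rel[OF Quotient_gcomplex, of z w] assms negligible_num_0 by auto

lemma gabs_0 [simp]: "gabs 0 = 0"
  by (simp add: gabs_eq_0)

abbreviation gmonomial :: "complex \<Rightarrow> real \<Rightarrow> gcomplex" where
  "gmonomial c a \<equiv> abs_gcomplex (\<lambda>\<epsilon>. c * of_real (\<epsilon> powr a))"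

lemma gmonomial_inverse:
  assumes "c \<noteq> 0"
  shows "gmonomial (inverse c) (- a) * gmonomial c a = 1"
proof -
  let ?z = "(\<lambda>\<epsilon>. inverse c * of_real (\<epsilon> powr - a)) * (\<lambda>\<epsilon>. c * of_real (\<epsilon> powr a))"
  have "gmonomial (inverse c) (- a) * gmonomial c a = abs_gcomplex ?z"
    using moderate_num_powr negligible_num_0 by (intro times_gcomplex.abs_eq) auto
  also have "\<dots> = abs_gcomplex 1"
  proof (rule abs_gcomplex_eqI)
    show "?z - 1 \<in> negligible_num"
      using assms by (intro negligible_num_vanishing)
        (auto simp: powr_minus field_simps simp flip: of_real_inverse of_real_mult)
  qed (intro moderate_num_mult moderate_num_powr moderate_num_1)+
  finally show ?thesis by (simp add: one_gcomplex.abs_eq)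
qed

lemma gabs_gmonomial_le: "gabs (gmonomial c a) \<le> exp (- a)"
proof -
  have "gabs (gmonomial c a) = exp_val (\<lambda>\<epsilon>. ennreal (cmod (c * of_real (\<epsilon> powr a))))"
    using moderate_num_powr negligible_num_0 by (intro gabs.abs_eq) auto
  also have "\<dots> \<le> exp (- a)"
    by (rule exp_val_le, unfold eps_bigo_def, rule exI[of _ "cmod c"]) (simp add: norm_mult)
  finally show ?thesis .
qed

text \<open>The lower bound comes from the inverse monomial: both factors of 1 obey the upper bound
  \<open>gabs_gmonomial_le\<close>, so neither can be smaller than it.\<close>

lemma gabs_gmonomial:
  assumes "c \<noteq> 0"
  shows "gabs (gmonomial c a) = exp (- a)"
proof -
  have "1 \<le> gabs (gmonomial (inverse c) (- a)) * gabs (gmonomial c a)"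
    using gabs_mult_le[of "gmonomial (inverse c) (- a)" "gmonomial c a"] assms
    by (simp add: gmonomial_inverse gabs_1)
  also have "\<dots> \<le> exp a * gabs (gmonomial c a)"
    using gabs_gmonomial_le[of "inverse c" "- a"] by (intro mult_right_mono gabs_nonneg) auto
  finally have "exp (- a) \<le> gabs (gmonomial c a)" by (simp add: exp_minus field_simps)
  then show ?thesis using gabs_gmonomial_le[of c a] by simp
qed

text \<open>The homogeneity axiom for monomial scalars is automatic, because these are invertible with
  \<open>gabs\<close> inverse to each other.\<close>

lemma homogeneous_gmonomial:
  assumes "c \<noteq> 0" and le: "\<And>l u. P (s l u) \<le> gabs l * P u"
    and s: "\<And>l k u. s l (s k u) = s (l * k) u" "\<And>u. s 1 u = u"
  shows "P (s (gmonomial c a) u) = gabs (gmonomial c a) * P u"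
proof (rule antisym[OF le])
  have "P u = P (s (gmonomial (inverse c) (- a)) (s (gmonomial c a) u))"
    using assms(1) by (simp add: s gmonomial_inverse)
  also have "\<dots> \<le> exp a * P (s (gmonomial c a) u)"
    using le[of "gmonomial (inverse c) (- a)"] assms(1) by (simp add: gabs_gmonomial)
  finally show "gabs (gmonomial c a) * P u \<le> P (s (gmonomial c a) u)"
    using assms(1) by (simp add: gabs_gmonomial exp_minus field_simps)
qed

lemma gabs_gmonomial_mult: "c \<noteq> 0 \<Longrightarrow> gabs (gmonomial c a * z) = gabs (gmonomial c a) * gabs z"
  by (rule homogeneous_gmonomial) (auto intro: gabs_mult_le simp: mult.assoc)

text \<open>Used for the pairing on \<open>G_tau\<close> and for its lift to \<open>G_m 0\<close>.
  On the latter, scalar multiplication is many-valued, so that \<open>homogeneous_gmonomial\<close>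
  does not apply; homogeneity is taken from each \<open>T v\<close> separately.\<close>

lemma ultra_pseudo_seminorm_Sup:
  assumes "0 \<in> M"
    and add: "\<And>v u w. v \<in> B \<Longrightarrow> u \<in> M \<Longrightarrow> w \<in> M \<Longrightarrow> T v (u + w) = T v u + T v w"
    and scale: "\<And>v l u w. v \<in> B \<Longrightarrow> u \<in> M \<Longrightarrow> w \<in> S l u \<Longrightarrow> T v w = l * T v u"
    and bdd: "\<And>u. u \<in> M \<Longrightarrow> bdd_above ((\<lambda>v. gabs (T v u)) ` B)"
  shows "ultra_pseudo_seminorm S M (\<lambda>u. Sup (insert 0 ((\<lambda>v. gabs (T v u)) ` B)))"
    (is "ultra_pseudo_seminorm S M ?P")
proof -
  have zero: "T v 0 = 0" if "v \<in> B" for v using add[OF that assms(1,1)] by simp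
  have up: "gabs (T v u) \<le> ?P u" if "v \<in> B" "u \<in> M" for v u
    using that bdd by (intro cSup_upper) auto
  have up0: "0 \<le> ?P u" if "u \<in> M" for u
    using that bdd by (intro cSup_upper) auto
  have least: "?P u \<le> c" if "0 \<le> c" "\<And>v. v \<in> B \<Longrightarrow> gabs (T v u) \<le> c" for u c
    using that by (intro cSup_least) auto
  show ?thesis
    unfolding ultra_pseudo_seminorm_def
  proof (intro conjI allI ballI impI)
    show "?P 0 = 0" using up0[OF assms(1)] by (intro antisym least) (auto simp: zero)
    fix u assume u: "u \<in> M"
    show "0 \<le> ?P u" by (rule up0[OF u])
    show ge: "?P w \<le> gabs l * ?P u" if w: "w \<in> S l u" for l w
    proof (rule least)
      fix v assume v: "v \<in> B"
      have "gabs (T v w) \<le> gabs l * gabs (T v u)" using scale[OF v u w] gabs_mult_le by simp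
      also have "\<dots> \<le> gabs l * ?P u" by (intro mult_left_mono up v u gabs_nonneg)
      finally show "gabs (T v w) \<le> gabs l * ?P u" .
    qed (use up0[OF u] gabs_nonneg in simp)
    show "?P w = gabs (gmonomial c a) * ?P u" if c: "c \<noteq> 0" and w: "w \<in> S (gmonomial c a) u" for c a w
    proof (rule antisym[OF ge[OF w]])
      have eq: "gabs (T v w) = exp (- a) * gabs (T v u)" if "v \<in> B" for v
        using scale[OF that u w] gabs_gmonomial_mult[OF c] gabs_gmonomial[OF c] by simp
      \<comment> \<open>\<open>w\<close> is not known to lie in \<open>M\<close>, so boundedness at
        \<open>w\<close> is derived from that at \<open>u\<close>.\<close>
      have bw: "bdd_above (insert 0 ((\<lambda>v. gabs (T v w)) ` B))"
      proof (rule bdd_aboveI)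
        show "x \<le> exp (- a) * ?P u" if "x \<in> insert 0 ((\<lambda>v. gabs (T v w)) ` B)" for x
          using that up0[OF u] up[OF _ u] by (auto simp: eq)
      qed
      have "?P u \<le> exp a * ?P w"
      proof (rule least)
        show "0 \<le> exp a * ?P w" using bw by (intro mult_nonneg_nonneg cSup_upper) auto
        fix v assume v: "v \<in> B"
        have "gabs (T v u) = exp a * gabs (T v w)" by (simp add: eq[OF v] exp_minus)
        also have "\<dots> \<le> exp a * ?P w" using v bw by (intro mult_left_mono cSup_upper) auto
        finally show "gabs (T v u) \<le> exp a * ?P w" .
      qed
      then show "gabs (gmonomial c a) * ?P u \<le> ?P w"
        by (simp add: gabs_gmonomial[OF c] exp_minus field_simps)
    qed
    fix w assume w: "w \<in> M"
    show "?P (u + w) \<le> max (?P u) (?P w)"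
    proof (rule least)
      fix v assume v: "v \<in> B"
      show "gabs (T v (u + w)) \<le> max (?P u) (?P w)"
        using gabs_ultra[of "T v u" "T v w"] up[OF v u] up[OF v w] add[OF v u w] by auto
    qed (use up0[OF u] in auto)
  qed
qed

section \<open>The defining seminorms of \<open>G_S\<close>\<close>

lemma schwartz_seminorm_bigo: "u \<in> moderate_S \<Longrightarrow> \<exists>b. eps_bigo (\<lambda>\<epsilon>. schwartz_seminorm j (u \<epsilon>)) b"
  unfolding moderate_S_def by blast

lemma ultra_pseudo_seminorm_P_S: "ultra_pseudo_seminorm (\<lambda>l u. {scale_S l u}) UNIV (P_S j)"
proof -
  have sc: "P_S j (scale_S l u) \<le> gabs l * P_S j u" for l and u :: "'a G_S"
  proof transfer
    fix j and l :: "real \<Rightarrow> complex" and u :: "real \<Rightarrow> real^'a \<Rightarrow> complex"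
    assume l: "l \<in> moderate_num \<and> l \<in> moderate_num \<and> l - l \<in> negligible_num"
      and u: "u \<in> moderate_S \<and> u \<in> moderate_S \<and> u - u \<in> negligible_S"
    show "exp_val (\<lambda>\<epsilon>. schwartz_seminorm j (net_scale l u \<epsilon>))
        \<le> exp_val (\<lambda>\<epsilon>. ennreal (cmod (l \<epsilon>))) * exp_val (\<lambda>\<epsilon>. schwartz_seminorm j (u \<epsilon>))"
    proof (rule exp_val_mult_le[where C = 1])
      fix \<epsilon> :: real assume "0 < \<epsilon>" "\<epsilon> \<le> 1"
      then have "smooth (u \<epsilon>)" using u nets_in_schwartz_smooth nets_in_eps unfolding moderate_S_def by blast
      then show "schwartz_seminorm j (net_scale l u \<epsilon>)
          \<le> ennreal 1 * (ennreal (cmod (l \<epsilon>)) * schwartz_seminorm j (u \<epsilon>))"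
        unfolding schwartz_seminorm_def net_scale_def by (simp add: wsup_cmult)
    qed (use l u schwartz_seminorm_bigo moderate_num_ex in blast)+
  qed
  have add: "P_S j (u + v) \<le> max (P_S j u) (P_S j v)" for u v :: "'a G_S"
  proof transfer
    fix j and u v :: "real \<Rightarrow> real^'a \<Rightarrow> complex"
    assume u: "u \<in> moderate_S \<and> u \<in> moderate_S \<and> u - u \<in> negligible_S"
      and v: "v \<in> moderate_S \<and> v \<in> moderate_S \<and> v - v \<in> negligible_S"
    show "exp_val (\<lambda>\<epsilon>. schwartz_seminorm j ((u + v) \<epsilon>))
        \<le> max (exp_val (\<lambda>\<epsilon>. schwartz_seminorm j (u \<epsilon>))) (exp_val (\<lambda>\<epsilon>. schwartz_seminorm j (v \<epsilon>)))"
    proof (rule exp_val_max)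
      fix \<epsilon> :: real assume "0 < \<epsilon>" "\<epsilon> \<le> 1"
      then have "smooth (u \<epsilon>)" "smooth (v \<epsilon>)"
        using u v nets_in_schwartz_smooth nets_in_eps unfolding moderate_S_def by blast+
      then show "schwartz_seminorm j ((u + v) \<epsilon>) \<le> schwartz_seminorm j (u \<epsilon>) + schwartz_seminorm j (v \<epsilon>)"
        unfolding schwartz_seminorm_def by (simp add: wsup_add)
    qed (use u v schwartz_seminorm_bigo in blast)+
  qed
  have nonneg: "0 \<le> P_S j u" for u :: "'a G_S" by transfer (rule exp_val_nonneg)
  have zero: "P_S j (0 :: 'a G_S) = 0"
  proof transfer
    fix j
    show "exp_val (\<lambda>\<epsilon>. schwartz_seminorm j ((0 :: real \<Rightarrow> real^'a \<Rightarrow> complex) \<epsilon>)) = 0"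
      by (subst exp_val_eq_0) (auto simp: schwartz_seminorm_def)
  qed
  have "P_S j (scale_S (gmonomial c a) u) = gabs (gmonomial c a) * P_S j u"
    if "c \<noteq> 0" for c a and u :: "'a G_S"
    by (rule homogeneous_gmonomial[OF that sc])
       (simp_all add: module.scale_scale[OF module_S] module.scale_one[OF module_S])
  then show ?thesis unfolding ultra_pseudo_seminorm_def using sc add nonneg zero by auto
qed

text \<open>\<open>lc_bounded\<close> tests with continuous seminorms only; this lemma turns
  boundedness into numerical bounds in \<open>lc_bounded_P_S\<close>. It rests on the reverse
  triangle inequality.\<close>

lemma continuous_map_P_S: "continuous_map top_S euclideanreal (P_S j)"
  unfolding continuous_map_def
proof (intro conjI allI impI)
  fix U :: "real set" assume U: "openin euclideanreal U"
  have "openin top_S {x :: 'a G_S. P_S j x \<in> U}"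
    unfolding top_S_def openin_seminorm_topology
  proof (intro conjI ballI)
    fix u :: "'a G_S"
    assume "u \<in> {x. P_S j x \<in> U}"
    then obtain e where e: "e > 0" "ball (P_S j u) e \<subseteq> U"
      using U by (auto elim: openE)
    have "P_S j v \<in> U" if "P_S j (v - u) < e" for v
    proof -
      note P = ultra_pseudo_seminormD[OF ultra_pseudo_seminorm_P_S[of j]]
      \<comment> \<open>Symmetry is not an axiom; it follows from the scaling inequality for the
        scalar -1, whose \<open>gabs\<close> is 1.\<close>
      have "P_S j (u - v) = P_S j (v - u)"
      proof -
        have "P_S j (scale_S (- 1) w) \<le> P_S j w" for w :: "'a G_S"
        proof -
          have "P_S j (scale_S (- 1) w) \<le> gabs (- 1) * P_S j w"
            using ultra_pseudo_seminorm_P_S[of j] unfolding ultra_pseudo_seminorm_def by blast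
          then show ?thesis by (simp add: gabs_uminus gabs_1)
        qed
        from this[of "u - v"] this[of "v - u"] show ?thesis
          by (simp add: module.scale_minus_left[OF module_S] module.scale_one[OF module_S])
      qed
      then have "\<bar>P_S j u - P_S j v\<bar> \<le> P_S j (v - u)"
        using P(3)[of "v - u" u] P(3)[of "u - v" v] P(2)[of u] P(2)[of v] P(2)[of "v - u"] by auto
      then show ?thesis using e(2) that by (auto simp: dist_real_def)
    qed
    then show "\<exists>F0 \<delta>. finite F0 \<and> F0 \<subseteq> range P_S \<and> 0 < \<delta> \<and> {v \<in> UNIV. \<forall>P\<in>F0. P (v - u) < \<delta>}
        \<subseteq> {x. P_S j x \<in> U}"
      using e(1) by (intro exI[of _ "{P_S j}"] exI[of _ e]) auto
  qed simp
  then show "openin top_S {x \<in> topspace top_S. (P_S j :: 'a G_S \<Rightarrow> real) x \<in> U}"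
    by (simp add: top_S_def)
qed (simp add: top_S_def)

lemma lc_bounded_P_S:
  assumes "lc_bounded (\<lambda>l u. {scale_S l u}) UNIV top_S B"
  obtains C where "C \<ge> 0" "\<And>v. v \<in> B \<Longrightarrow> P_S j v \<le> C"
proof -
  have "bdd_above (P_S j ` B)"
    using assms ultra_pseudo_seminorm_P_S[of j] continuous_map_P_S[of j]
    unfolding lc_bounded_def by (auto elim!: allE[of _ "P_S j"])
  then obtain C where C: "\<And>v. v \<in> B \<Longrightarrow> P_S j v \<le> C" by (auto simp: bdd_above_def)
  show ?thesis by (rule that[of "max C 0"]) (auto intro: C max.coboundedI1)
qed


section \<open>The integration pairing\<close>

text \<open>On the shell k <= |x| <= k + 1 the integrand is at most (1 + k)^(-n-2), and the shell is
  enlarged to the ball of radius k + 1, of volume proportional to (k + 1)^n. Balls cost one power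
  more than shells, hence the exponent n + 2; what remains is the series of inverse squares.\<close>

lemma integrable_inverse_power_norm:
  "integrable lborel (\<lambda>x::real^'n::finite. 1 / (1 + norm x) ^ (CARD('n) + 2))"
proof (rule integrableI_bounded)
  let ?K = "CARD('n) + 2"
  let ?c = "\<lambda>k::nat. 1 / (1 + real k) ^ ?K"
  let ?V = "unit_ball_vol (real DIM(real^'n))"
  have dom: "ennreal (norm (1 / (1 + norm x) ^ ?K)) \<le> (\<Sum>k. ennreal (?c k) * indicator (cball 0 (real k + 1)) x)"
    for x :: "real^'n"
  proof -
    define k where "k = nat \<lfloor>norm x\<rfloor>"
    have "real k = of_int \<lfloor>norm x\<rfloor>" by (simp add: k_def)
    then have k: "real k \<le> norm x" "norm x \<le> real k + 1" by linarith+
    have "1 / (1 + norm x) ^ ?K \<le> ?c k"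
      using k by (intro divide_left_mono power_mono mult_pos_pos zero_less_power) (auto intro: add_pos_nonneg)
    then have "ennreal (norm (1 / (1 + norm x) ^ ?K)) \<le> ennreal (?c k) * indicator (cball 0 (real k + 1)) x"
      using k by (auto simp: indicator_def intro!: ennreal_leI)
    also have "\<dots> \<le> (\<Sum>k. ennreal (?c k) * indicator (cball 0 (real k + 1)) x)"
      using sum_le_suminf[OF summableI, of "{k}" "\<lambda>k. ennreal (?c k) * indicator (cball 0 (real k + 1)) x"]
      by (simp only: sum.insert[OF finite.emptyI] sum.empty empty_iff not_False_eq_True add_0_right) simp
    finally show ?thesis .
  qed
  have shell: "ennreal (?c k) * emeasure lborel (cball 0 (real k + 1) :: (real^'n) set)
      = ennreal (?V * (1 / (real k + 1)\<^sup>2))" for k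
  proof -
    have "ennreal (?c k) * emeasure lborel (cball 0 (real k + 1) :: (real^'n) set)
        = ennreal (?c k * (?V * (real k + 1) ^ CARD('n)))"
      by (subst emeasure_cball) (auto simp: ennreal_mult[symmetric])
    also have "?c k * (?V * (real k + 1) ^ CARD('n)) = ?V * (1 / (real k + 1)\<^sup>2)"
      using zero_less_power[of "real k + 1" "CARD('n)"]
      by (simp add: power_add add.commute[of 1] power2_eq_square)
    finally show ?thesis .
  qed
  have sm: "summable (\<lambda>k::nat. ?V * (1 / (real k + 1)\<^sup>2))"
    using sums_summable[OF inverse_squares_sums] by (intro summable_mult) (simp add: add.commute)
  have "(\<integral>\<^sup>+x. ennreal (norm (1 / (1 + norm (x::real^'n)) ^ ?K)) \<partial>lborel)
      \<le> (\<integral>\<^sup>+x. (\<Sum>k. ennreal (?c k) * indicator (cball 0 (real k + 1)) (x::real^'n)) \<partial>lborel)"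
    by (intro nn_integral_mono dom)
  also have "\<dots> = (\<Sum>k. ennreal (?c k) * emeasure lborel (cball 0 (real k + 1) :: (real^'n) set))"
    by (subst nn_integral_suminf)
       (auto simp: nn_integral_cmult_indicator intro!: borel_measurable_times_ennreal borel_measurable_indicator)
  also have "\<dots> = (\<Sum>k. ennreal (?V * (1 / (real k + 1)\<^sup>2)))" by (simp only: shell)
  also have "\<dots> = ennreal (\<Sum>k. ?V * (1 / (real k + 1)\<^sup>2))"
    using sm by (intro suminf_ennreal2) auto
  also have "\<dots> < \<infinity>" by simp
  finally show "(\<integral>\<^sup>+x. ennreal (norm (1 / (1 + norm (x::real^'n)) ^ ?K)) \<partial>lborel) < \<infinity>" .
qed (auto intro!: borel_measurable_continuous_onI continuous_intros simp: add_nonneg_eq_0_iff)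

lemma wsup_upper: "\<alpha> \<in> A \<Longrightarrow> ennreal (w x * cmod (mderiv \<alpha> f x)) \<le> wsup w A f"
  unfolding wsup_def by (intro SUP_upper2[where i = x] SUP_upper2[where i = \<alpha>]) auto

lemma mderiv_zero_index [simp]: "mderiv (\<lambda>_. 0) f = f"
proof -
  have "foldr (\<lambda>i. pder i ^^ (0::nat)) xs f = f" for xs by (induction xs) auto
  then show ?thesis unfolding mderiv_def by simp
qed

lemma multi_indices_le_0: "multi_indices_le 0 = {\<lambda>_. 0}"
  by (auto simp: multi_indices_le_def fun_eq_iff)

lemma zero_index_le: "(\<lambda>_. 0) \<in> multi_indices_le m"
  by (simp add: multi_indices_le_def)

lemma smooth_continuous: "smooth f \<Longrightarrow> continuous_on UNIV f"
  using smoothD(2)[of f "[]"] by simp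

text \<open>Formulated in \<open>ennreal\<close>, where the seminorms may be infinite, so that it
  yields the integrability of products as well as the estimate of their integrals.\<close>

lemma nn_integral_product_bound:
  fixes f g :: "real^'n::finite \<Rightarrow> complex"
  shows "(\<integral>\<^sup>+x. ennreal (cmod (f x * g x)) \<partial>lborel)
    \<le> ennreal (LINT x|lborel. 1 / (1 + norm (x::real^'n)) ^ (CARD('n) + 2))
      * (tempered_seminorm 0 N f * schwartz_seminorm (N + (CARD('n) + 2)) g)"
proof -
  let ?K = "CARD('n) + 2"
  let ?T = "tempered_seminorm 0 N f" and ?S = "schwartz_seminorm (N + ?K) g"
  have pt: "ennreal (cmod (f x * g x)) \<le> ennreal (1 / (1 + norm x) ^ ?K) * (?T * ?S)" for x
  proof -
    have pos: "(1 + norm x) ^ j > 0" for j by (intro zero_less_power add_pos_nonneg) auto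
    have "cmod (f x * g x) = 1 / (1 + norm x) ^ ?K
        * ((tempered_weight N x * cmod (f x)) * ((1 + norm x) ^ (N + ?K) * cmod (g x)))"
      unfolding tempered_weight_def power_add using pos[of N] pos[of ?K] pos[of 2] pos[of "CARD('n)"]
      by (simp add: norm_mult field_simps power_add)
    then have "ennreal (cmod (f x * g x)) = ennreal (1 / (1 + norm x) ^ ?K)
        * (ennreal (tempered_weight N x * cmod (f x)) * ennreal ((1 + norm x) ^ (N + ?K) * cmod (g x)))"
      by (simp add: ennreal_mult[symmetric] tempered_weight_nonneg)
    also have "\<dots> \<le> ennreal (1 / (1 + norm x) ^ ?K) * (?T * ?S)"
      using wsup_upper[OF zero_index_le[of 0], of "tempered_weight N" x f]
        wsup_upper[OF zero_index_le[of "N + ?K"], of "\<lambda>x. (1 + norm x) ^ (N + ?K)" x g]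
      unfolding tempered_seminorm_def schwartz_seminorm_def
      by (intro mult_left_mono mult_mono) auto
    finally show ?thesis .
  qed
  have meas: "(\<lambda>x::real^'n. 1 / (1 + norm x) ^ ?K) \<in> borel_measurable lborel"
    using integrable_inverse_power_norm by blast
  have "(\<integral>\<^sup>+x. ennreal (cmod (f x * g x)) \<partial>lborel)
      \<le> (\<integral>\<^sup>+x. ennreal (1 / (1 + norm (x::real^'n)) ^ ?K) * (?T * ?S) \<partial>lborel)"
    by (intro nn_integral_mono pt)
  also have "\<dots> = (\<integral>\<^sup>+x. ennreal (1 / (1 + norm (x::real^'n)) ^ ?K) \<partial>lborel) * (?T * ?S)"
    using meas by (intro nn_integral_multc) auto
  also have "(\<integral>\<^sup>+x. ennreal (1 / (1 + norm (x::real^'n)) ^ ?K) \<partial>lborel)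
      = ennreal (LINT x|lborel. 1 / (1 + norm (x::real^'n)) ^ ?K)"
    using integrable_inverse_power_norm by (intro nn_integral_eq_integral) auto
  finally show ?thesis .
qed

lemma slowly_increasing_tempered_finite:
  fixes f :: "real^'a::finite \<Rightarrow> complex"
  assumes "f \<in> slowly_increasing"
  obtains N where "tempered_seminorm 0 N f < \<infinity>"
proof -
  obtain N C where "\<forall>x. cmod (mderiv (\<lambda>_. 0) f x) \<le> C * (1 + norm x) ^ N"
    using assms unfolding slowly_increasing_def by blast
  then have C: "cmod (f x) \<le> C * (1 + norm x) ^ N" for x by simp
  have "tempered_seminorm 0 N f \<le> ennreal C"
    unfolding tempered_seminorm_def wsup_def multi_indices_le_0
  proof (intro SUP_least)
    fix x :: "real^'a" and \<alpha> :: "'a \<Rightarrow> nat" assume "\<alpha> \<in> {\<lambda>_. 0}"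
    moreover have "(1 + norm x) ^ N > 0" by (intro zero_less_power add_pos_nonneg) auto
    ultimately show "ennreal (tempered_weight N x * cmod (mderiv \<alpha> f x)) \<le> ennreal C"
      using C[of x] by (auto simp: tempered_weight_def field_simps intro!: ennreal_leI)
  qed
  also have "\<dots> < \<infinity>" by simp
  finally show ?thesis by (rule that)
qed

lemma integrable_product:
  assumes f: "f \<in> slowly_increasing" and g: "g \<in> schwartz"
  shows "integrable lborel (\<lambda>x. f x * g x)"
proof (rule integrableI_bounded)
  show "(\<lambda>x. f x * g x) \<in> borel_measurable lborel"
    using smooth_continuous[OF slowly_increasing_smooth[OF f]] smooth_continuous[OF schwartz_smooth[OF g]]
    by (auto intro!: borel_measurable_continuous_onI continuous_on_mult)
  obtain N where "tempered_seminorm 0 N f < \<infinity>"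
    using slowly_increasing_tempered_finite[OF f] .
  moreover have "schwartz_seminorm (N + (CARD('a) + 2)) g < \<infinity>"
    using g unfolding schwartz_def by blast
  ultimately show "(\<integral>\<^sup>+x. ennreal (cmod (f x * g x)) \<partial>lborel) < \<infinity>"
    by (intro le_less_trans[OF nn_integral_product_bound[of f g N]]) (simp add: ennreal_mult_less_top)
qed

lemma net_integral_bound:
  fixes u v :: "real \<Rightarrow> real^'n::finite \<Rightarrow> complex"
  assumes "u \<in> nets_in slowly_increasing" "v \<in> nets_in schwartz" "0 < \<epsilon>" "\<epsilon> \<le> 1"
  shows "ennreal (cmod (net_integral u v \<epsilon>))
    \<le> ennreal (LINT x|lborel. 1 / (1 + norm (x::real^'n)) ^ (CARD('n) + 2))
      * (tempered_seminorm 0 N (u \<epsilon>) * schwartz_seminorm (N + (CARD('n) + 2)) (v \<epsilon>))"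
proof -
  have "integrable lborel (\<lambda>x. u \<epsilon> x * v \<epsilon> x)"
    using nets_in_eps[OF assms(1)] nets_in_eps[OF assms(2)] assms(3,4) by (simp add: integrable_product)
  then have "ennreal (cmod (net_integral u v \<epsilon>)) \<le> (\<integral>\<^sup>+x. ennreal (cmod (u \<epsilon> x * v \<epsilon> x)) \<partial>lborel)"
    unfolding net_integral_def by (rule integral_norm_bound_ennreal)
  also note nn_integral_product_bound[of "u \<epsilon>" "v \<epsilon>" N]
  finally show ?thesis .
qed

lemma net_integral_bigo:
  fixes u v :: "real \<Rightarrow> real^'n::finite \<Rightarrow> complex"
  assumes u: "u \<in> nets_in slowly_increasing" "eps_bigo (\<lambda>\<epsilon>. tempered_seminorm 0 N (u \<epsilon>)) a"
    and v: "v \<in> nets_in schwartz" "eps_bigo (\<lambda>\<epsilon>. schwartz_seminorm (N + (CARD('n) + 2)) (v \<epsilon>)) b"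
  shows "eps_bigo (\<lambda>\<epsilon>. ennreal (cmod (net_integral u v \<epsilon>))) (a + b)"
proof -
  have "eps_bigo (\<lambda>_. ennreal C) 0" for C
    unfolding eps_bigo_def by (rule exI[of _ C], rule eventually_mono[OF eventually_eps]) simp
  from eps_bigo_mult[OF this eps_bigo_mult[OF u(2) v(2)]]
  have "eps_bigo (\<lambda>\<epsilon>. ennreal (cmod (net_integral u v \<epsilon>))) (0 + (a + b))"
    by (rule eps_bigo_mono) (rule net_integral_bound[OF u(1) v(1)])
  then show ?thesis by simp
qed

section \<open>Independence of representatives and bilinearity of the pairing\<close>

lemma moderate_mN_mono:
  assumes "N \<le> M"
  shows "moderate_mN m N \<subseteq> moderate_mN m M"
  using tau_weaken[OF _ assms order_refl] unfolding moderate_mN_def tempered_seminorm_def by blast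

lemma moderate_mN_slow: "u \<in> moderate_mN m N \<Longrightarrow> u \<in> nets_in slowly_increasing"
  by (simp add: moderate_mN_def)

lemma moderate_S_schwartz: "v \<in> moderate_S \<Longrightarrow> v \<in> nets_in schwartz"
  by (simp add: moderate_S_def)

lemma negligible_S_schwartz: "v \<in> negligible_S \<Longrightarrow> v \<in> nets_in schwartz"
  by (simp add: negligible_S_def)

lemma net_integral_moderate:
  assumes u: "u \<in> moderate_mN 0 N" and v: "v \<in> moderate_S"
  shows "net_integral u v \<in> moderate_num"
proof -
  obtain a where "eps_bigo (\<lambda>\<epsilon>. tempered_seminorm 0 N (u \<epsilon>)) a"
    using u unfolding moderate_mN_def by blast
  moreover obtain b where "eps_bigo (\<lambda>\<epsilon>. schwartz_seminorm (N + (CARD('a) + 2)) (v \<epsilon>)) b"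
    using schwartz_seminorm_bigo[OF v] by blast
  ultimately show ?thesis
    by (rule moderate_numI[OF net_integral_bigo[OF moderate_mN_slow[OF u] _ moderate_S_schwartz[OF v]]])
qed

lemma net_integral_negligible_left:
  assumes u: "u \<in> nets_in slowly_increasing"
      "\<And>q::nat. eps_bigo (\<lambda>\<epsilon>. tempered_seminorm 0 N (u \<epsilon>)) (real q)"
    and v: "v \<in> moderate_S"
  shows "net_integral u v \<in> negligible_num"
proof -
  obtain b where b: "eps_bigo (\<lambda>\<epsilon>. schwartz_seminorm (N + (CARD('a) + 2)) (v \<epsilon>)) b"
    using schwartz_seminorm_bigo[OF v] by blast
  have "eps_bigo (\<lambda>\<epsilon>. ennreal (cmod (net_integral u v \<epsilon>))) ((c - b) + b)" for c
    using bigo_nat_all[OF u(2)] by (rule net_integral_bigo[OF u(1) _ moderate_S_schwartz[OF v] b])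
  then show ?thesis by (simp add: negligible_num_all)
qed

lemma net_integral_negligible_right:
  assumes u: "u \<in> moderate_mN 0 N" and v: "v \<in> negligible_S"
  shows "net_integral u v \<in> negligible_num"
proof -
  obtain a where a: "eps_bigo (\<lambda>\<epsilon>. tempered_seminorm 0 N (u \<epsilon>)) a"
    using u unfolding moderate_mN_def by blast
  have "eps_bigo (\<lambda>\<epsilon>. schwartz_seminorm j (v \<epsilon>)) c" for j c
    by (rule bigo_nat_all) (use v in \<open>simp add: negligible_S_def\<close>)
  then have "eps_bigo (\<lambda>\<epsilon>. ennreal (cmod (net_integral u v \<epsilon>))) (a + (c - a))" for c
    by (rule net_integral_bigo[OF moderate_mN_slow[OF u] a negligible_S_schwartz[OF v]])
  then show ?thesis by (simp add: negligible_num_all)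
qed

text \<open>Only a congruence: for parameters outside (0,1] nothing is known about integrability,
  and the two sides may differ there.\<close>

lemma net_integral_add_left:
  assumes "u \<in> nets_in slowly_increasing" "u' \<in> nets_in slowly_increasing" "v \<in> nets_in schwartz"
  shows "net_integral (u + u') v - (net_integral u v + net_integral u' v) \<in> negligible_num"
proof (rule negligible_num_vanishing)
  fix \<epsilon> :: real assume "0 < \<epsilon>" "\<epsilon> \<le> 1"
  then have "integrable lborel (\<lambda>x. u \<epsilon> x * v \<epsilon> x)" "integrable lborel (\<lambda>x. u' \<epsilon> x * v \<epsilon> x)"
    using nets_in_eps[OF assms(1)] nets_in_eps[OF assms(2)] nets_in_eps[OF assms(3)]
    by (auto intro!: integrable_product)
  then show "(net_integral (u + u') v - (net_integral u v + net_integral u' v)) \<epsilon> = 0"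
    by (simp add: net_integral_def distrib_right)
qed

lemma net_integral_add_right:
  assumes "u \<in> nets_in slowly_increasing" "v \<in> nets_in schwartz" "v' \<in> nets_in schwartz"
  shows "net_integral u (v + v') - (net_integral u v + net_integral u v') \<in> negligible_num"
proof (rule negligible_num_vanishing)
  fix \<epsilon> :: real assume "0 < \<epsilon>" "\<epsilon> \<le> 1"
  then have "integrable lborel (\<lambda>x. u \<epsilon> x * v \<epsilon> x)" "integrable lborel (\<lambda>x. u \<epsilon> x * v' \<epsilon> x)"
    using nets_in_eps[OF assms(1)] nets_in_eps[OF assms(2)] nets_in_eps[OF assms(3)]
    by (auto intro!: integrable_product)
  then show "(net_integral u (v + v') - (net_integral u v + net_integral u v')) \<epsilon> = 0"
    by (simp add: net_integral_def distrib_left)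
qed

lemma net_integral_scale_left: "net_integral (net_scale l u) v = l * net_integral u v"
  by (simp add: net_integral_def net_scale_def fun_eq_iff mult.assoc)

lemma net_integral_scale_right: "net_integral u (net_scale l v) = l * net_integral u v"
  by (simp add: net_integral_def net_scale_def fun_eq_iff mult.left_commute)

lemma moderate_mN_uminus: "u \<in> moderate_mN m N \<Longrightarrow> - u \<in> moderate_mN m N"
proof -
  assume u: "u \<in> moderate_mN m N"
  then obtain M :: nat where M: "eps_bigo (\<lambda>\<epsilon>. tempered_seminorm m N (u \<epsilon>)) (- real M)"
    unfolding moderate_mN_def by blast
  have one: "eps_bigo (\<lambda>\<epsilon>. ennreal (cmod (- 1))) 0"
    unfolding eps_bigo_def by (rule exI[of _ 1], rule eventually_mono[OF eventually_eps]) simp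
  have "eps_bigo (\<lambda>\<epsilon>. tempered_seminorm m N (net_scale (- 1) u \<epsilon>)) (0 + (- real M))"
    using moderate_mN_slow[OF u] nets_in_slowly_increasing_smooth one M unfolding tempered_seminorm_def
    by (intro wsup_bigo_scale) (auto simp: tempered_weight_nonneg)
  then show ?thesis using nets_in_slowly_increasing_uminus[OF moderate_mN_slow[OF u]]
    by (auto simp: net_scale_simps moderate_mN_def)
qed

lemma moderate_mN_diff: "u \<in> moderate_mN m N \<Longrightarrow> v \<in> moderate_mN m N \<Longrightarrow> u - v \<in> moderate_mN m N"
  using moderate_mN_add[OF _ moderate_mN_uminus, of u m N v] by simp

lemma abs_gcomplex_add:
  "z \<in> moderate_num \<Longrightarrow> w \<in> moderate_num \<Longrightarrow> abs_gcomplex (z + w) = abs_gcomplex z + abs_gcomplex w"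
  using negligible_num_0 by (simp add: plus_gcomplex.abs_eq)

lemma abs_gcomplex_mult:
  "z \<in> moderate_num \<Longrightarrow> w \<in> moderate_num \<Longrightarrow> abs_gcomplex (z * w) = abs_gcomplex z * abs_gcomplex w"
  using negligible_num_0 by (simp add: times_gcomplex.abs_eq)

lemma abs_net_integral_add_left:
  assumes "u \<in> moderate_mN 0 N" "u' \<in> moderate_mN 0 N" "v \<in> moderate_S"
  shows "abs_gcomplex (net_integral (u + u') v)
    = abs_gcomplex (net_integral u v) + abs_gcomplex (net_integral u' v)"
proof -
  note m = net_integral_moderate[OF assms(1,3)] net_integral_moderate[OF assms(2,3)]
  show ?thesis
    unfolding abs_gcomplex_add[OF m, symmetric]
    by (rule abs_gcomplex_eqI[OF net_integral_moderate[OF moderate_mN_add[OF assms(1,2)] assms(3)]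
        moderate_num_add[OF m] net_integral_add_left[OF assms(1,2)[THEN moderate_mN_slow]
        assms(3)[THEN moderate_S_schwartz]]])
qed

lemma abs_net_integral_add_right:
  assumes "u \<in> moderate_mN 0 N" "v \<in> moderate_S" "v' \<in> moderate_S"
  shows "abs_gcomplex (net_integral u (v + v'))
    = abs_gcomplex (net_integral u v) + abs_gcomplex (net_integral u v')"
proof -
  note m = net_integral_moderate[OF assms(1,2)] net_integral_moderate[OF assms(1,3)]
  show ?thesis
    unfolding abs_gcomplex_add[OF m, symmetric]
    by (rule abs_gcomplex_eqI[OF net_integral_moderate[OF assms(1) moderate_S_add[OF assms(2,3)]]
        moderate_num_add[OF m] net_integral_add_right[OF assms(1)[THEN moderate_mN_slow]
        assms(2,3)[THEN moderate_S_schwartz]]])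
qed

text \<open>Telescoping: u v - u' v' = (u - u') v + u' (v - v'). For u - u' a zero-order estimate is
  asked, so that differences in \<open>negligible_tau\<close> and in \<open>negligible_S\<close> are
  both covered.\<close>

lemma abs_net_integral_cong:
  assumes u: "u \<in> moderate_mN 0 N" "u' \<in> moderate_mN 0 N"
      "\<And>q::nat. eps_bigo (\<lambda>\<epsilon>. tempered_seminorm 0 N ((u - u') \<epsilon>)) (real q)"
    and v: "v \<in> moderate_S" "v' \<in> moderate_S" "v - v' \<in> negligible_S"
  shows "abs_gcomplex (net_integral u v) = abs_gcomplex (net_integral u' v')"
proof -
  have d: "u - u' \<in> moderate_mN 0 N" using u by (intro moderate_mN_diff)
  have d': "v - v' \<in> moderate_S" using moderate_S_add[OF v(1) moderate_S_uminus[OF v(2)]] by simp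
  have "net_integral (u - u') v \<in> negligible_num"
    using u(3) v(1) by (intro net_integral_negligible_left[OF moderate_mN_slow[OF d]])
  then have "abs_gcomplex (net_integral (u - u') v) = 0"
    unfolding zero_gcomplex_def
    by (intro abs_gcomplex_eqI net_integral_moderate[OF d v(1)] moderate_num_0) simp
  moreover have "net_integral u' (v - v') \<in> negligible_num"
    by (rule net_integral_negligible_right[OF u(2) v(3)])
  then have "abs_gcomplex (net_integral u' (v - v')) = 0"
    unfolding zero_gcomplex_def
    by (intro abs_gcomplex_eqI net_integral_moderate[OF u(2) d'] moderate_num_0) simp
  ultimately show ?thesis
    using abs_net_integral_add_left[OF u(2) d v(1)] abs_net_integral_add_right[OF u(2) v(2) d'] by simp
qed

lemma moderate_tau_mN:
  assumes "u \<in> moderate_tau"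
  obtains N where "u \<in> moderate_mN 0 N"
  using assms unfolding moderate_tau_eq by blast

lemma rep_G_S: "rep_G_S v \<in> moderate_S" "abs_G_S (rep_G_S v) = v"
  using Quotient_rep_reflp[OF Quotient_G_S, of v] Quotient_abs_rep[OF Quotient_G_S] by auto

lemma rep_G_tau: "rep_G_tau u \<in> moderate_tau" "abs_G_tau (rep_G_tau u) = u"
  using Quotient_rep_reflp[OF Quotient_G_tau, of u] Quotient_abs_rep[OF Quotient_G_tau] by auto

lemma abs_G_S_eq_iff:
  "u \<in> moderate_S \<Longrightarrow> v \<in> moderate_S \<Longrightarrow> abs_G_S u = abs_G_S v \<longleftrightarrow> u - v \<in> negligible_S"
  using Quotient_rel[OF Quotient_G_S, of u v] negligible_S_0 by auto

lemma abs_G_tau_eq_iff: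
  "u \<in> moderate_tau \<Longrightarrow> v \<in> moderate_tau \<Longrightarrow> abs_G_tau u = abs_G_tau v \<longleftrightarrow> u - v \<in> negligible_tau"
  using Quotient_rel[OF Quotient_G_tau, of u v] negligible_tau_0 by auto

lemma rep_abs_G_S: "v \<in> moderate_S \<Longrightarrow> rep_G_S (abs_G_S v) - v \<in> negligible_S"
  using abs_G_S_eq_iff rep_G_S by blast

lemma pairing_abs:
  assumes u: "u \<in> moderate_tau" and v: "v \<in> moderate_S"
  shows "pairing (abs_G_tau u) (abs_G_S v) = abs_gcomplex (net_integral u v)"
proof -
  let ?u = "rep_G_tau (abs_G_tau u)"
  have "?u - u \<in> negligible_tau" using abs_G_tau_eq_iff rep_G_tau u by blast
  then obtain K where K: "\<And>q::nat. eps_bigo (\<lambda>\<epsilon>. wsup (tempered_weight K) {\<lambda>_. 0} ((?u - u) \<epsilon>)) (real q)"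
    unfolding negligible_tau_def by blast
  obtain N M where N: "u \<in> moderate_mN 0 N" and M: "?u \<in> moderate_mN 0 M"
    using moderate_tau_mN[OF u] moderate_tau_mN[OF rep_G_tau(1)] by metis
  \<comment> \<open>A common weight for both representatives and their difference: a larger exponent
    only weakens a tempered estimate.\<close>
  let ?N = "N + M + K"
  have "eps_bigo (\<lambda>\<epsilon>. tempered_seminorm 0 ?N ((?u - u) \<epsilon>)) (real q)" for q
    unfolding tempered_seminorm_def multi_indices_le_0 by (rule tau_weaken[OF K]) auto
  moreover have "u \<in> moderate_mN 0 ?N" "?u \<in> moderate_mN 0 ?N"
    using N M moderate_mN_mono[of N ?N] moderate_mN_mono[of M ?N] by auto
  ultimately show ?thesis unfolding pairing_def
    using rep_G_S(1) v rep_abs_G_S[OF v] by (intro abs_net_integral_cong)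
qed

text \<open>The pairing on the steps of the inductive limit. It is introduced as a separate map
  because \<open>G_m 0\<close> contains classes outside \<open>G_tau_S\<close>, on which
  \<open>proj_tau\<close> has no meaning.\<close>

definition pairing_OM :: "'n::finite OM_S \<Rightarrow> 'n G_S \<Rightarrow> gcomplex" where
  "pairing_OM u v = abs_gcomplex (net_integral (rep_OM_S u) (rep_G_S v))"

lemma pairing_OM_abs:
  assumes u: "u \<in> moderate_mN 0 N" and v: "v \<in> moderate_S"
  shows "pairing_OM (abs_OM_S u) (abs_G_S v) = abs_gcomplex (net_integral u v)"
proof -
  let ?u = "rep_OM_S (abs_OM_S u)"
  have "u - ?u \<in> negligible_S" using rep_OM_S(3)[OF moderate_mN_slow[OF u]] .
  then have "eps_bigo (\<lambda>\<epsilon>. tempered_seminorm 0 N ((?u - u) \<epsilon>)) (real q)" for q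
    using tempered_seminorm_negligible[OF negligible_S_uminus, of "u - ?u" 0 N "real q"] by simp
  moreover have "?u \<in> moderate_mN 0 N"
    using u by (simp flip: G_mN_iff add: G_mN_def)
  ultimately show ?thesis unfolding pairing_OM_def
    using rep_G_S(1) u v rep_abs_G_S[OF v] by (intro abs_net_integral_cong)
qed

lemma pairing_OM_proj_tau:
  assumes "u \<in> G_tau_S"
  shows "pairing (proj_tau u) v = pairing_OM u v"
proof -
  obtain w where w: "w \<in> moderate_tau" "u = abs_OM_S w" using assms unfolding G_tau_S_eq by blast
  obtain N where "w \<in> moderate_mN 0 N" using moderate_tau_mN[OF w(1)] .
  then show ?thesis
    using pairing_OM_abs[OF _ rep_G_S(1), of w N v] pairing_abs[OF w(1) rep_G_S(1), of v]
      proj_tau_abs[OF w(1)] w(2) rep_G_S(2)[of v] by simp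
qed

lemma gabs_net_integral_le:
  fixes v :: "real \<Rightarrow> real^'n::finite \<Rightarrow> complex"
  assumes u: "u \<in> moderate_mN 0 N" and v: "v \<in> moderate_S"
  shows "gabs (abs_gcomplex (net_integral u v)) \<le>
    exp_val (\<lambda>\<epsilon>. tempered_seminorm 0 N (u \<epsilon>)) * exp_val (\<lambda>\<epsilon>. schwartz_seminorm (N + (CARD('n) + 2)) (v \<epsilon>))"
proof -
  have "gabs (abs_gcomplex (net_integral u v)) = exp_val (\<lambda>\<epsilon>. ennreal (cmod (net_integral u v \<epsilon>)))"
    using net_integral_moderate[OF u v] negligible_num_0 by (simp add: gabs.abs_eq)
  also have "\<dots> \<le> exp_val (\<lambda>\<epsilon>. tempered_seminorm 0 N (u \<epsilon>))
      * exp_val (\<lambda>\<epsilon>. schwartz_seminorm (N + (CARD('n) + 2)) (v \<epsilon>))"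
    using u by (intro exp_val_mult_le[OF _ schwartz_seminorm_bigo[OF v]
          net_integral_bound[OF moderate_mN_slow[OF u] moderate_S_schwartz[OF v]]])
      (auto simp: moderate_mN_def)
  finally show ?thesis .
qed

lemma gabs_pairing_OM_le:
  fixes v :: "'n::finite G_S"
  assumes "u \<in> G_mN 0 N"
  shows "gabs (pairing_OM u v) \<le> P_mN 0 N u * P_S (N + (CARD('n) + 2)) v"
proof -
  have "P_mN 0 N u = exp_val (\<lambda>\<epsilon>. tempered_seminorm 0 N (rep_OM_S u \<epsilon>))"
    using P_mN.abs_eq[of "rep_OM_S u" 0 N] by (simp add: rep_OM_S negligible_S_0)
  moreover have "P_S j v = exp_val (\<lambda>\<epsilon>. schwartz_seminorm j (rep_G_S v \<epsilon>))" for j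
    using P_S.abs_eq[of "rep_G_S v" j] by (simp add: rep_G_S negligible_S_0)
  ultimately show ?thesis unfolding pairing_OM_def
    using gabs_net_integral_le[of "rep_OM_S u" N "rep_G_S v"] assms by (simp add: G_mN_iff rep_G_S(1))
qed

text \<open>The steps increase with \<open>N\<close>, so two elements of the union meet in one of
  them.\<close>

lemma G_m_common:
  assumes "u \<in> G_m m" "w \<in> G_m m"
  obtains a b N where "a \<in> moderate_mN m N" "b \<in> moderate_mN m N" "u = abs_OM_S a" "w = abs_OM_S b"
proof -
  obtain a b N M where "a \<in> moderate_mN m N" "b \<in> moderate_mN m M" "u = abs_OM_S a" "w = abs_OM_S b"
    using assms unfolding G_m_def G_mN_def by blast
  then show ?thesis
    using that[of a "N + M" b] moderate_mN_mono[of N "N + M" m] moderate_mN_mono[of M "N + M" m] by auto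
qed

lemma abs_OM_S_add:
  "a \<in> nets_in slowly_increasing \<Longrightarrow> b \<in> nets_in slowly_increasing \<Longrightarrow>
    abs_OM_S a + abs_OM_S b = abs_OM_S (a + b)"
  by (simp add: plus_OM_S.abs_eq negligible_S_0)

lemma pairing_OM_add:
  assumes "u \<in> G_m 0" "w \<in> G_m 0"
  shows "pairing_OM (u + w) v = pairing_OM u v + pairing_OM w v"
proof -
  obtain a b N where ab: "a \<in> moderate_mN 0 N" "b \<in> moderate_mN 0 N" "u = abs_OM_S a" "w = abs_OM_S b"
    by (rule G_m_common[OF assms])
  then have "u + w = abs_OM_S (a + b)" by (simp add: abs_OM_S_add moderate_mN_slow)
  then show ?thesis
    using ab pairing_OM_abs[OF _ rep_G_S(1), of _ N v] moderate_mN_add[OF ab(1,2)]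
      abs_net_integral_add_left[OF ab(1,2) rep_G_S(1), of v] by (simp add: rep_G_S(2))
qed

lemma moderate_mN_scale:
  assumes k: "k \<in> moderate_num" and u: "u \<in> moderate_mN m N"
  shows "net_scale k u \<in> moderate_mN m N"
proof -
  obtain a where a: "eps_bigo (\<lambda>\<epsilon>. ennreal (cmod (k \<epsilon>))) a" using k moderate_num_ex by blast
  obtain M :: nat where "eps_bigo (\<lambda>\<epsilon>. tempered_seminorm m N (u \<epsilon>)) (- real M)"
    using u unfolding moderate_mN_def by blast
  with a have "eps_bigo (\<lambda>\<epsilon>. tempered_seminorm m N (net_scale k u \<epsilon>)) (a + - real M)"
    using moderate_mN_slow[OF u] nets_in_slowly_increasing_smooth unfolding tempered_seminorm_def
    by (intro wsup_bigo_scale) (auto simp: tempered_weight_nonneg)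
  then show ?thesis using bigo_nat_ex nets_in_slowly_increasing_closed(3)[OF moderate_mN_slow[OF u]]
    unfolding moderate_mN_def by blast
qed

lemma pairing_OM_smult:
  assumes "u \<in> G_m 0" "w \<in> smult_OM_S l u"
  shows "pairing_OM w v = l * pairing_OM u v"
proof -
  obtain k b where b: "k \<in> moderate_num" "l = abs_gcomplex k" "b \<in> nets_in slowly_increasing"
      "u = abs_OM_S b" "w = abs_OM_S (net_scale k b)"
    using assms(2) unfolding smult_OM_S_def by blast
  obtain a N where a: "a \<in> moderate_mN 0 N" "u = abs_OM_S a"
    using assms(1) unfolding G_m_def G_mN_def by blast
  \<comment> \<open>The representative \<open>b\<close> that produced the product need not be the
    moderate one, but it differs from \<open>a\<close> by an element of \<open>negligible_S\<close>
    and so is moderate with the same \<open>N\<close>.\<close>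
  have "b - a \<in> negligible_S" using abs_OM_S_eq[OF b(3) moderate_mN_slow[OF a(1)]] a(2) b(4) by simp
  then have "a + (b - a) \<in> moderate_mN 0 N"
    using negligible_S_moderate_mN a(1) by (intro moderate_mN_add) auto
  then have m: "b \<in> moderate_mN 0 N" by simp
  show ?thesis
    using pairing_OM_abs[OF m rep_G_S(1), of v]
      pairing_OM_abs[OF moderate_mN_scale[OF b(1) m] rep_G_S(1), of v]
      abs_gcomplex_mult[OF b(1) net_integral_moderate[OF m rep_G_S(1)], of v]
    by (simp add: rep_G_S(2) b net_integral_scale_left)
qed

lemma pairing_add_left: "pairing (u + w) v = pairing u v + pairing w v"
proof -
  have "u + w = abs_G_tau (rep_G_tau u + rep_G_tau w)"
    using plus_G_tau.abs_eq[of "rep_G_tau u" "rep_G_tau w"] by (simp add: rep_G_tau negligible_tau_0)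
  moreover obtain N M where "rep_G_tau u \<in> moderate_mN 0 N" "rep_G_tau w \<in> moderate_mN 0 M"
    using moderate_tau_mN[OF rep_G_tau(1)] by metis
  then have "rep_G_tau u \<in> moderate_mN 0 (N + M)" "rep_G_tau w \<in> moderate_mN 0 (N + M)"
    using moderate_mN_mono[of N "N + M" 0] moderate_mN_mono[of M "N + M" 0] by auto
  ultimately show ?thesis
    using pairing_abs[OF moderate_tau_add rep_G_S(1), of "rep_G_tau u" "rep_G_tau w" v]
      abs_net_integral_add_left[OF _ _ rep_G_S(1), of "rep_G_tau u" "N + M" "rep_G_tau w" v]
    by (simp add: rep_G_S(2) rep_G_tau(1) pairing_def)
qed

lemma pairing_add_right: "pairing u (v + w) = pairing u v + pairing u w"
proof -
  have "v + w = abs_G_S (rep_G_S v + rep_G_S w)"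
    using plus_G_S.abs_eq[of "rep_G_S v" "rep_G_S w"] by (simp add: rep_G_S negligible_S_0)
  moreover obtain N where "rep_G_tau u \<in> moderate_mN 0 N" using moderate_tau_mN[OF rep_G_tau(1)] .
  ultimately show ?thesis
    using pairing_abs[OF rep_G_tau(1) moderate_S_add, of "rep_G_S v" "rep_G_S w" u]
      abs_net_integral_add_right[of "rep_G_tau u" N "rep_G_S v" "rep_G_S w"]
    by (simp add: rep_G_S(1) rep_G_tau(2) pairing_def)
qed

lemma rep_gcomplex: "rep_gcomplex l \<in> moderate_num" "abs_gcomplex (rep_gcomplex l) = l"
  using Quotient_rep_reflp[OF Quotient_gcomplex, of l] Quotient_abs_rep[OF Quotient_gcomplex] by auto

lemma pairing_scale_left: "pairing (scale_tau l u) v = l * pairing u v"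
proof -
  have "scale_tau l u = abs_G_tau (net_scale (rep_gcomplex l) (rep_G_tau u))"
    using scale_tau.abs_eq[of "rep_gcomplex l" "rep_G_tau u"] 
    by (simp add: rep_G_tau rep_gcomplex negligible_tau_0 negligible_num_0)
  moreover obtain N where N: "rep_G_tau u \<in> moderate_mN 0 N" using moderate_tau_mN[OF rep_G_tau(1)] .
  ultimately show ?thesis
    using pairing_abs[OF moderate_tau_scale[OF rep_gcomplex(1) rep_G_tau(1)] rep_G_S(1), of l u v]
      abs_gcomplex_mult[OF rep_gcomplex(1) net_integral_moderate[OF N rep_G_S(1)], of l v]
    by (simp add: rep_G_S(2) net_integral_scale_left rep_gcomplex(2) pairing_def)
qed

lemma pairing_scale_right: "pairing u (scale_S l v) = l * pairing u v"
proof -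
  have "scale_S l v = abs_G_S (net_scale (rep_gcomplex l) (rep_G_S v))"
    using scale_S.abs_eq[of "rep_gcomplex l" "rep_G_S v"] 
    by (simp add: rep_G_S rep_gcomplex negligible_S_0 negligible_num_0)
  moreover obtain N where N: "rep_G_tau u \<in> moderate_mN 0 N" using moderate_tau_mN[OF rep_G_tau(1)] .
  ultimately show ?thesis
    using pairing_abs[OF rep_G_tau(1) moderate_S_scale[OF rep_gcomplex(1) rep_G_S(1)], of u l v]
      abs_gcomplex_mult[OF rep_gcomplex(1) net_integral_moderate[OF N rep_G_S(1)], of l v]
    by (simp add: rep_G_tau(2) net_integral_scale_right rep_gcomplex(2) pairing_def)
qed

text \<open>\<open>C\<close> and \<open>j\<close> depend on \<open>u\<close>. This gives the
  continuity of the pairing in \<open>v\<close> and the finiteness of its suprema over bounded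
  sets.\<close>

lemma gabs_pairing_le:
  fixes u :: "'n::finite G_tau"
  obtains C j where "C \<ge> 0" "\<And>v. gabs (pairing u v) \<le> C * P_S j v"
proof -
  obtain N where N: "rep_G_tau u \<in> moderate_mN 0 N" using moderate_tau_mN[OF rep_G_tau(1)] .
  have "P_S j v = exp_val (\<lambda>\<epsilon>. schwartz_seminorm j (rep_G_S v \<epsilon>))" for j and v :: "'n G_S"
    using P_S.abs_eq[of "rep_G_S v" j] by (simp add: rep_G_S negligible_S_0)
  then have "gabs (pairing u v)
      \<le> exp_val (\<lambda>\<epsilon>. tempered_seminorm 0 N (rep_G_tau u \<epsilon>)) * P_S (N + (CARD('n) + 2)) v" for v
    using gabs_net_integral_le[OF N rep_G_S(1)] unfolding pairing_def by metis
  then show ?thesis by (rule that[OF exp_val_nonneg])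
qed


section \<open>Topologies and continuity\<close>

lemma continuous_map_seminorm_singleton:
  assumes f: "f ` M \<subseteq> M'" and Q: "Q \<in> F" and c: "c \<ge> 0"
    and le: "\<And>u v. u \<in> M \<Longrightarrow> v \<in> M \<Longrightarrow> P (f v - f u) \<le> c * Q (v - u)"
  shows "continuous_map (seminorm_topology M F) (seminorm_topology M' {P}) f"
  unfolding continuous_map_def topspace_seminorm_topology
proof (intro conjI allI impI)
  show "f \<in> M \<rightarrow> M'" using f by auto
  fix U assume U: "openin (seminorm_topology M' {P}) U"
  show "openin (seminorm_topology M F) {x \<in> M. f x \<in> U}"
    unfolding openin_seminorm_topology
  proof (intro conjI ballI)
    fix u assume u: "u \<in> {x \<in> M. f x \<in> U}"
    then obtain F0 \<delta> where \<delta>: "F0 \<subseteq> {P}" "\<delta> > 0" "{v \<in> M'. \<forall>P\<in>F0. P (v - f u) < \<delta>} \<subseteq> U"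
      using U unfolding openin_seminorm_topology by blast
    \<comment> \<open>Dividing by c + 1 instead of c also covers c = 0.\<close>
    have "f v \<in> U" if v: "v \<in> M" "Q (v - u) < \<delta> / (c + 1)" for v
    proof -
      have "c * Q (v - u) < \<delta>"
      \<comment> \<open>\<open>Q\<close> is just a real function here, and a negative value makes
        the bound trivial.\<close>
      proof (cases "Q (v - u) \<ge> 0")
        case True
        then have "c * Q (v - u) \<le> (c + 1) * Q (v - u)" by (simp add: distrib_right)
        also have "\<dots> < \<delta>" using v(2) c by (simp add: field_simps)
        finally show ?thesis .
      next
        case False
        then have "c * Q (v - u) \<le> 0" using c by (simp add: mult_nonneg_nonpos)
        then show ?thesis using \<delta>(2) by simp
      qed
      then have "P (f v - f u) < \<delta>" using le[of u v] u v(1) by simp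
      then show ?thesis using \<delta>(1,3) f v(1) by blast
    qed
    then have "{v \<in> M. \<forall>P\<in>{Q}. P (v - u) < \<delta> / (c + 1)} \<subseteq> {x \<in> M. f x \<in> U}" by auto
    then show "\<exists>F0 \<delta>. finite F0 \<and> F0 \<subseteq> F \<and> \<delta> > 0 \<and> {v \<in> M. \<forall>P\<in>F0. P (v - u) < \<delta>} \<subseteq> {x \<in> M. f x \<in> U}"
      using Q \<delta>(2) c by (intro exI[of _ "{Q}"] exI[of _ "\<delta> / (c + 1)"] conjI) auto
  qed auto
qed

section \<open>The universal property of finest topologies\<close>

lemma is_finest_lc_finest_lc:
  assumes "\<And>u v. u \<in> M \<Longrightarrow> v \<in> M \<Longrightarrow> u - v \<in> M"
    and "\<And>X f. (X, f) \<in> I \<Longrightarrow> f ` topspace X \<subseteq> M"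
  shows "is_finest_lc S M I (finest_lc S M I)"
  by (subst finest_lc_eq[OF assms]; (assumption | rule is_finest_lc_seminorm[OF assms])+)

lemma topspace_finest_lc:
  assumes "\<And>u v. u \<in> M \<Longrightarrow> v \<in> M \<Longrightarrow> u - v \<in> M"
    and "\<And>X f. (X, f) \<in> I \<Longrightarrow> f ` topspace X \<subseteq> M"
  shows "topspace (finest_lc S M I) = M"
  by (subst finest_lc_eq[OF assms]) auto

lemma continuous_map_finest_lc:
  assumes "\<And>u v. u \<in> M \<Longrightarrow> v \<in> M \<Longrightarrow> u - v \<in> M"
    and "\<And>X f. (X, f) \<in> I \<Longrightarrow> f ` topspace X \<subseteq> M" and "(X, f) \<in> I"
  shows "continuous_map X (finest_lc S M I) f"
proof -
  have "is_finest_lc S M I (finest_lc S M I)" by (rule is_finest_lc_finest_lc[OF assms(1,2)])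
  then show ?thesis using assms(3) unfolding is_finest_lc_def by blast
qed

text \<open>The tool for continuity out of a finest topology: a seminorm that is continuous along
  all the given maps belongs to the generating family of \<open>finest_lc_eq\<close>, so its balls
  are open.\<close>

lemma openin_finest_lc_ball:
  assumes M: "\<And>u v. u \<in> M \<Longrightarrow> v \<in> M \<Longrightarrow> u - v \<in> M"
    and I: "\<And>X f. (X, f) \<in> I \<Longrightarrow> f ` topspace X \<subseteq> M"
    and P: "ultra_pseudo_seminorm S M P"
    and cont: "\<And>X f. (X, f) \<in> I \<Longrightarrow> continuous_map X (seminorm_topology M {P}) f"
    and u: "u \<in> M"
  shows "openin (finest_lc S M I) {v \<in> M. P (v - u) < \<delta>}"
  by (subst finest_lc_eq[OF M I]; assumption?; rule openin_seminorm_ball[OF P M u])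
     (use P cont in auto)

lemma abs_OM_S_diff:
  assumes "a \<in> nets_in slowly_increasing" "b \<in> nets_in slowly_increasing"
  shows "abs_OM_S a - abs_OM_S b = abs_OM_S (a - b)"
proof -
  have "abs_OM_S a + - abs_OM_S b = abs_OM_S a + abs_OM_S (- b)"
    using assms by (simp add: uminus_OM_S.abs_eq negligible_S_0)
  also have "\<dots> = abs_OM_S (a - b)"
    using abs_OM_S_add[OF assms(1) nets_in_slowly_increasing_uminus[OF assms(2)]] by simp
  finally show ?thesis by simp
qed

lemma G_mN_diff:
  assumes "u \<in> G_mN m N" "w \<in> G_mN m N"
  shows "u - w \<in> G_mN m N"
proof -
  obtain a b where "a \<in> moderate_mN m N" "b \<in> moderate_mN m N" "u = abs_OM_S a" "w = abs_OM_S b"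
    using assms unfolding G_mN_def by blast
  then show ?thesis
    using moderate_mN_diff[of a m N b] by (auto simp: G_mN_def abs_OM_S_diff moderate_mN_slow)
qed

lemma G_m_diff:
  assumes "u \<in> G_m m" "w \<in> G_m m"
  shows "u - w \<in> G_m m"
proof -
  obtain a b N where ab: "a \<in> moderate_mN m N" "b \<in> moderate_mN m N" "u = abs_OM_S a" "w = abs_OM_S b"
    by (rule G_m_common[OF assms])
  then have "u - w \<in> G_mN m N" by (intro G_mN_diff) (auto simp: G_mN_def)
  then show ?thesis unfolding G_m_def by blast
qed

lemma top_m_sources:
  "(X, f) \<in> range (\<lambda>N. (top_mN m N, \<lambda>u. u)) \<Longrightarrow> f ` topspace X \<subseteq> G_m m"
  by (auto simp: top_mN_def G_m_def)

lemma topspace_top_m [simp]: "topspace (top_m m) = G_m m"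
  unfolding top_m_def by (rule topspace_finest_lc[OF G_m_diff top_m_sources])

lemma continuous_map_top_mN: "continuous_map (top_mN m N) (top_m m) (\<lambda>u. u)"
  unfolding top_m_def by (rule continuous_map_finest_lc[OF G_m_diff top_m_sources]) auto

lemma topspace_top_tau_S [simp]: "topspace top_tau_S = G_tau_S"
proof -
  have "\<Union>{U \<inter> G_tau_S | U m. openin (top_m m) U} = (G_tau_S :: 'a OM_S set)"
  proof
    have "G_tau_S \<subseteq> (G_m 0 :: 'a OM_S set)" unfolding G_tau_S_def by blast
    moreover have "openin (top_m 0) (G_m 0 :: 'a OM_S set)"
      using openin_topspace[of "top_m 0"] by simp
    ultimately show "(G_tau_S :: 'a OM_S set) \<subseteq> \<Union>{U \<inter> G_tau_S | U m. openin (top_m m) U}" by blast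
  qed auto
  then show ?thesis unfolding top_tau_S_def by (simp add: topology_generated_by_topspace)
qed

lemma openin_top_tau_S: "openin (top_m m) U \<Longrightarrow> openin top_tau_S (U \<inter> G_tau_S)"
  unfolding top_tau_S_def by (rule topology_generated_by_Basis) blast

section \<open>Continuity of the embedding of \<open>G_S\<close>\<close>

lemma continuous_map_proj_tau: "continuous_map top_tau_S top_tau proj_tau"
  unfolding top_tau_def by (rule continuous_map_finest_lc) auto

text \<open>The lift of \<open>embed_S_tau\<close> along \<open>proj_tau\<close> (see
  \<open>embed_S_tau_eq\<close>), needed because \<open>top_tau\<close> is described by the map
  \<open>proj_tau\<close> into it.\<close>

definition embed_S_OM :: "'n::finite G_S \<Rightarrow> 'n OM_S" where
  "embed_S_OM v = abs_OM_S (rep_G_S v)"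

lemma moderate_S_slow: "v \<in> moderate_S \<Longrightarrow> v \<in> nets_in slowly_increasing"
  using nets_in_schwartz_slowly_increasing moderate_S_schwartz by blast

lemma embed_S_OM_abs:
  assumes "v \<in> moderate_S"
  shows "embed_S_OM (abs_G_S v) = abs_OM_S v"
  unfolding embed_S_OM_def
  by (subst abs_OM_S_eq)
     (use rep_abs_G_S[OF assms] moderate_S_slow[OF assms] moderate_S_slow[OF rep_G_S(1)] in auto)

lemma moderate_S_diff: "u \<in> moderate_S \<Longrightarrow> v \<in> moderate_S \<Longrightarrow> u - v \<in> moderate_S"
  using moderate_S_add[OF _ moderate_S_uminus, of u v] by simp

lemma abs_G_S_diff:
  assumes "a \<in> moderate_S" "b \<in> moderate_S"
  shows "abs_G_S a - abs_G_S b = abs_G_S (a - b)"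
proof -
  have "abs_G_S a + - abs_G_S b = abs_G_S a + abs_G_S (- b)"
    using assms by (simp add: uminus_G_S.abs_eq negligible_S_0)
  also have "\<dots> = abs_G_S (a - b)"
    using assms moderate_S_uminus[OF assms(2)] by (simp add: plus_G_S.abs_eq negligible_S_0)
  finally show ?thesis by simp
qed

lemma embed_S_OM_diff: "embed_S_OM v - embed_S_OM w = embed_S_OM (v - w)"
proof -
  have "v - w = abs_G_S (rep_G_S v - rep_G_S w)"
    using abs_G_S_diff[OF rep_G_S(1) rep_G_S(1), of v w] by (simp add: rep_G_S(2))
  then show ?thesis
    using embed_S_OM_abs[OF moderate_S_diff[OF rep_G_S(1) rep_G_S(1)], of v w]
      abs_OM_S_diff[OF moderate_S_slow[OF rep_G_S(1)] moderate_S_slow[OF rep_G_S(1)], of v w]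
    by (simp add: embed_S_OM_def)
qed

lemma moderate_S_mN: "moderate_S \<subseteq> moderate_mN m 0"
proof
  fix u :: "real \<Rightarrow> real^'a \<Rightarrow> complex" assume u: "u \<in> moderate_S"
  obtain M :: nat where "eps_bigo (\<lambda>\<epsilon>. schwartz_seminorm m (u \<epsilon>)) (- real M)"
    using u unfolding moderate_S_def by blast
  then have "eps_bigo (\<lambda>\<epsilon>. tempered_seminorm m 0 (u \<epsilon>)) (- real M)"
    by (rule eps_bigo_mono[OF _ tempered_seminorm_le_schwartz])
  then show "u \<in> moderate_mN m 0" using moderate_S_slow[OF u] unfolding moderate_mN_def by blast
qed

lemma embed_S_OM_in: "embed_S_OM v \<in> G_mN m 0" "embed_S_OM v \<in> G_tau_S"
  using moderate_S_mN moderate_S_tau rep_G_S(1) unfolding embed_S_OM_def G_mN_def G_tau_S_eq by blast+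

lemma P_mN_embed_S_OM: "P_mN m 0 (embed_S_OM v) \<le> P_S m v"
proof -
  have "P_mN m 0 (embed_S_OM v) = exp_val (\<lambda>\<epsilon>. tempered_seminorm m 0 (rep_G_S v \<epsilon>))"
    using P_mN.abs_eq[of "rep_G_S v" m 0]
    by (simp add: moderate_S_slow rep_G_S(1) negligible_S_0 embed_S_OM_def)
  also have "\<dots> \<le> max (exp_val (\<lambda>\<epsilon>. schwartz_seminorm m (rep_G_S v \<epsilon>)))
      (exp_val (\<lambda>\<epsilon>. schwartz_seminorm m (rep_G_S v \<epsilon>)))"
    using schwartz_seminorm_bigo[OF rep_G_S(1)[of v], of m]
    by (intro exp_val_max add_increasing2 tempered_seminorm_le_schwartz) auto
  also have "\<dots> = P_S m v"
    using P_S.abs_eq[of "rep_G_S v" m] by (simp add: rep_G_S negligible_S_0)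
  finally show ?thesis .
qed

text \<open>For each \<open>m\<close> the map factors through the single step with \<open>N\<close>
  = 0, where \<open>P_mN m 0\<close> is dominated by \<open>P_S m\<close>; the inclusion of a step
  into the inductive limit is continuous.\<close>

lemma continuous_map_embed_S_OM: "continuous_map top_S top_tau_S embed_S_OM"
  unfolding top_tau_S_def
proof (rule continuous_on_generated_topo)
  have "\<Union>{U \<inter> G_tau_S | U m. openin (top_m m) U} = (G_tau_S :: 'a OM_S set)"
    using topspace_top_tau_S unfolding top_tau_S_def topology_generated_by_topspace .
  then show "embed_S_OM ` topspace top_S
      \<subseteq> \<Union>{U \<inter> G_tau_S | (U :: 'a OM_S set) m. openin (top_m m) U}"
    using embed_S_OM_in(2) by auto
  fix V :: "'a OM_S set" assume "V \<in> {U \<inter> G_tau_S | U m. openin (top_m m) U}"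
  then obtain U m where U: "V = U \<inter> G_tau_S" "openin (top_m m) U" by blast
  have "continuous_map top_S (top_mN m 0) (embed_S_OM :: 'a G_S \<Rightarrow> _)"
    unfolding top_S_def top_mN_def
    by (rule continuous_map_seminorm_singleton[where Q = "P_S m" and c = 1])
       (auto simp: embed_S_OM_in embed_S_OM_diff P_mN_embed_S_OM)
  from continuous_map_compose[OF this continuous_map_top_mN] U(2)
  have "openin top_S {v \<in> topspace top_S. (embed_S_OM :: 'a G_S \<Rightarrow> _) v \<in> U}"
    by (auto simp: o_def continuous_map_def)
  moreover have "embed_S_OM -` V \<inter> topspace top_S = {v \<in> topspace top_S. (embed_S_OM :: 'a G_S \<Rightarrow> _) v \<in> U}"
    using U(1) embed_S_OM_in(2) by auto
  ultimately show "openin top_S (embed_S_OM -` V \<inter> topspace top_S)" by simp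
qed

lemma embed_S_tau_abs: "u \<in> moderate_S \<Longrightarrow> embed_S_tau (abs_G_S u) = abs_G_tau u"
  by (simp add: embed_S_tau.abs_eq negligible_S_0)

lemma embed_S_tau_eq: "embed_S_tau v = proj_tau (embed_S_OM v)"
proof -
  have "rep_G_S v \<in> moderate_tau" using rep_G_S(1) moderate_S_tau by blast
  then show ?thesis
    using embed_S_tau_abs[OF rep_G_S(1), of v] by (simp add: rep_G_S(2) embed_S_OM_def proj_tau_abs)
qed

lemma continuous_map_embed_S_tau: "continuous_map top_S top_tau embed_S_tau"
  using continuous_map_compose[OF continuous_map_embed_S_OM continuous_map_proj_tau]
  by (simp add: o_def embed_S_tau_eq[abs_def])

lemma module_hom_embed_S_tau: "module_hom scale_S scale_tau (embed_S_tau :: 'n::finite G_S \<Rightarrow> 'n G_tau)"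
  unfolding module_hom_iff
proof (intro conjI allI module_S module_tau)
  fix x y :: "'n G_S" and l
  have r: "\<And>u :: real \<Rightarrow> real^'n \<Rightarrow> complex. u \<in> moderate_S \<Longrightarrow> u \<in> moderate_tau" using moderate_S_tau by blast
  show "embed_S_tau (x + y) = embed_S_tau x + embed_S_tau y"
    by transfer (auto intro: r moderate_S_add negligible_tau_0)
  show "embed_S_tau (scale_S l x) = scale_tau l (embed_S_tau x)"
    by transfer (auto intro: r moderate_S_scale negligible_tau_0)
qed

lemma topspace_top_tau [simp]: "topspace top_tau = UNIV"
  unfolding top_tau_def by (rule topspace_finest_lc) auto

section \<open>Continuity of the pairing\<close>

definition sup_pairing :: "'n::finite G_S set \<Rightarrow> 'n G_tau \<Rightarrow> real" where
  "sup_pairing B u = Sup (insert 0 ((\<lambda>v. gabs (pairing u v)) ` B))"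

text \<open>On \<open>G_tau_S\<close> this is \<open>sup_pairing B\<close> after
  \<open>proj_tau\<close>. It makes sense on all of \<open>G_m 0\<close>, so its continuity can be
  tested on the steps.\<close>

definition sup_pairing_OM :: "'n::finite G_S set \<Rightarrow> 'n OM_S \<Rightarrow> real" where
  "sup_pairing_OM B u = Sup (insert 0 ((\<lambda>v. gabs (pairing_OM u v)) ` B))"

lemma proj_tau_diff:
  assumes "u \<in> G_tau_S" "w \<in> G_tau_S"
  shows "proj_tau u - proj_tau w = proj_tau (u - w)" "u - w \<in> G_tau_S"
proof -
  obtain a b where ab: "a \<in> moderate_tau" "b \<in> moderate_tau" "u = abs_OM_S a" "w = abs_OM_S b"
    using assms unfolding G_tau_S_eq by blast
  have d: "a - b \<in> moderate_tau" using moderate_tau_add[OF ab(1) moderate_tau_uminus[OF ab(2)]] by simp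
  have e: "u - w = abs_OM_S (a - b)"
    using ab by (simp add: abs_OM_S_diff moderate_tau_def)
  have "abs_G_tau a - abs_G_tau b = abs_G_tau (a - b)"
  proof -
    have "abs_G_tau a + - abs_G_tau b = abs_G_tau a + abs_G_tau (- b)"
      using ab by (simp add: uminus_G_tau.abs_eq negligible_tau_0)
    also have "\<dots> = abs_G_tau (a - b)"
      using ab moderate_tau_uminus[OF ab(2)] by (simp add: plus_G_tau.abs_eq negligible_tau_0)
    finally show ?thesis by simp
  qed
  then show "proj_tau u - proj_tau w = proj_tau (u - w)" unfolding e unfolding ab(3,4)
    using proj_tau_abs[OF ab(1)] proj_tau_abs[OF ab(2)] proj_tau_abs[OF d] by simp
  show "u - w \<in> G_tau_S" using e d unfolding G_tau_S_eq by blast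
qed

context
  fixes B :: "'n::finite G_S set"
  assumes B: "lc_bounded (\<lambda>l u. {scale_S l u}) UNIV top_S B"
begin

text \<open>The constant is a bound of \<open>P_S (N + (CARD('n) + 2))\<close> on \<open>B\<close>
  and so depends on \<open>N\<close>.\<close>

lemma sup_pairing_OM_le:
  obtains C where "C \<ge> 0" "\<And>u. u \<in> G_mN 0 N \<Longrightarrow> sup_pairing_OM B u \<le> C * P_mN 0 N u"
    "\<And>u v. u \<in> G_mN 0 N \<Longrightarrow> v \<in> B \<Longrightarrow> gabs (pairing_OM u v) \<le> C * P_mN 0 N u"
proof -
  obtain C where C: "C \<ge> 0" "\<And>v. v \<in> B \<Longrightarrow> P_S (N + (CARD('n) + 2)) v \<le> C"
    by (rule lc_bounded_P_S[OF B]) blast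
  have nn: "P_mN 0 N u \<ge> 0" for u :: "'n OM_S" by transfer (rule exp_val_nonneg)
  have le: "gabs (pairing_OM u v) \<le> C * P_mN 0 N u" if "u \<in> G_mN 0 N" "v \<in> B" for u v
  proof -
    have "gabs (pairing_OM u v) \<le> P_mN 0 N u * P_S (N + (CARD('n) + 2)) v"
      by (rule gabs_pairing_OM_le[OF that(1)])
    also have "\<dots> \<le> P_mN 0 N u * C" by (intro mult_left_mono C(2) that(2) nn)
    finally show ?thesis by (simp add: mult.commute)
  qed
  have "sup_pairing_OM B u \<le> C * P_mN 0 N u" if "u \<in> G_mN 0 N" for u
    unfolding sup_pairing_OM_def using le[OF that] C(1) nn[of u] by (intro cSup_least) auto
  then show ?thesis using that[OF C(1) _ le] by blast
qed

lemma ultra_pseudo_seminorm_sup_pairing_OM: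
  "ultra_pseudo_seminorm smult_OM_S (G_m 0) (sup_pairing_OM B)"
  unfolding sup_pairing_OM_def[abs_def]
proof (rule ultra_pseudo_seminorm_Sup)
  have "embed_S_OM 0 \<in> G_m 0" using embed_S_OM_in(1) unfolding G_m_def by blast
  from G_m_diff[OF this this] show "0 \<in> G_m 0" by simp
  show "bdd_above ((\<lambda>v. gabs (pairing_OM u v)) ` B)" if u: "u \<in> G_m 0" for u :: "'n OM_S"
  proof -
    obtain N where "u \<in> G_mN 0 N" using u unfolding G_m_def by blast
    with sup_pairing_OM_le[of N] show ?thesis by (metis bdd_aboveI2)
  qed
qed (auto intro: pairing_OM_add pairing_OM_smult)

lemma ultra_pseudo_seminorm_sup_pairing:
  "ultra_pseudo_seminorm (\<lambda>l u. {scale_tau l u}) UNIV (sup_pairing B)"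
  unfolding sup_pairing_def[abs_def]
proof (rule ultra_pseudo_seminorm_Sup)
  show "bdd_above ((\<lambda>v. gabs (pairing u v)) ` B)" for u :: "'n G_tau"
  proof -
    obtain C j where C: "C \<ge> 0" "\<And>v. gabs (pairing u v) \<le> C * P_S j v" by (rule gabs_pairing_le[of u]) blast
    obtain D where D: "\<And>v. v \<in> B \<Longrightarrow> P_S j v \<le> D" by (rule lc_bounded_P_S[OF B]) blast
    show ?thesis
    proof (rule bdd_aboveI2)
      fix v assume "v \<in> B"
      then show "gabs (pairing u v) \<le> C * D" using C(2)[of v] mult_left_mono[OF D C(1)] by fastforce
    qed
  qed
qed (auto simp: pairing_add_left pairing_scale_left)

text \<open>The inductive limit asks for continuity on each step separately, so a constant for each
  \<open>N\<close> is enough.\<close>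

lemma openin_top_m_ball:
  assumes "u \<in> G_m 0"
  shows "openin (top_m 0) {w \<in> G_m 0. sup_pairing_OM B (w - u) < \<delta>}"
  unfolding top_m_def
proof (rule openin_finest_lc_ball[OF G_m_diff top_m_sources ultra_pseudo_seminorm_sup_pairing_OM])
  fix X :: "'n OM_S topology" and f :: "'n OM_S \<Rightarrow> 'n OM_S" assume "(X, f) \<in> range (\<lambda>N. (top_mN 0 N, \<lambda>u. u))"
  then obtain N where X: "X = top_mN 0 N" "f = (\<lambda>u. u)" by blast
  obtain C where C: "C \<ge> 0" "\<And>u. u \<in> G_mN 0 N \<Longrightarrow> sup_pairing_OM B u \<le> C * P_mN 0 N u"
    using sup_pairing_OM_le[of N] by metis
  show "continuous_map X (seminorm_topology (G_m 0) {sup_pairing_OM B}) f"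
    unfolding X top_mN_def
    by (rule continuous_map_seminorm_singleton[where Q = "P_mN 0 N" and c = C])
       (auto simp: G_m_def intro: C G_mN_diff)
qed (assumption | fact assms)+

text \<open>The traces on \<open>G_tau_S\<close> of the open sets of every \<open>top_m\<close> are
  open in \<open>top_tau_S\<close>; here those of \<open>top_m 0\<close> suffice, because the
  estimate of the integral involves no derivative of u.\<close>

lemma continuous_map_proj_tau_sup_pairing:
  "continuous_map top_tau_S (seminorm_topology UNIV {sup_pairing B}) proj_tau"
  unfolding continuous_map_def
proof (intro conjI allI impI)
  fix U assume U: "openin (seminorm_topology UNIV {sup_pairing B}) U"
  show "openin top_tau_S {u \<in> topspace top_tau_S. proj_tau u \<in> U}"
  proof (subst openin_subopen, intro ballI)
    fix u assume u: "u \<in> {u \<in> topspace top_tau_S. proj_tau u \<in> U}"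
    then obtain F0 \<delta> where \<delta>: "F0 \<subseteq> {sup_pairing B}" "\<delta> > 0"
        "{v \<in> UNIV. \<forall>P\<in>F0. P (v - proj_tau u) < \<delta>} \<subseteq> U"
      using U unfolding openin_seminorm_topology by blast
    have uG: "u \<in> G_tau_S" using u by simp
    then have uG0: "u \<in> G_m 0" unfolding G_tau_S_def by blast
    let ?W = "{w \<in> G_m 0. sup_pairing_OM B (w - u) < \<delta>} \<inter> G_tau_S"
    have "proj_tau w \<in> U" if w: "w \<in> ?W" for w
    proof -
      have "sup_pairing B (proj_tau w - proj_tau u) = sup_pairing_OM B (w - u)"
        using w uG proj_tau_diff[of w u]
        by (simp add: sup_pairing_def sup_pairing_OM_def pairing_OM_proj_tau)
      then have "\<forall>P\<in>F0. P (proj_tau w - proj_tau u) < \<delta>" using w \<delta>(1) by auto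
      then show ?thesis using \<delta>(3) by blast
    qed
    moreover have "u \<in> ?W"
      using uG uG0 \<delta>(2) ultra_pseudo_seminormD(1)[OF ultra_pseudo_seminorm_sup_pairing_OM] by simp
    ultimately show "\<exists>T. openin top_tau_S T \<and> u \<in> T \<and> T \<subseteq> {u \<in> topspace top_tau_S. proj_tau u \<in> U}"
      using openin_top_tau_S[OF openin_top_m_ball[OF uG0]] by (intro exI[of _ ?W]) auto
  qed
qed simp

text \<open>The universal property again, now for the surjection \<open>proj_tau\<close>. The
  \<open>sup_pairing B\<close> are the defining seminorms of \<open>top_dual_S\<close> pulled back
  along the pairing.\<close>

lemma openin_top_tau_ball: "openin top_tau {w. sup_pairing B (w - u) < \<delta>}"
  using openin_finest_lc_ball[of UNIV "{(top_tau_S, proj_tau)}" "\<lambda>l u. {scale_tau l u}" "sup_pairing B" u \<delta>]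
    ultra_pseudo_seminorm_sup_pairing continuous_map_proj_tau_sup_pairing
  unfolding top_tau_def by auto

end

lemma pairing_diff_left: "pairing (u - w) v = pairing u v - pairing w v"
  using pairing_add_left[of "u - w" w v] by simp

lemma pairing_diff_right: "pairing u (v - w) = pairing u v - pairing u w"
  using pairing_add_right[of u "v - w" w] by simp

lemma module_gcomplex: "module ((*) :: gcomplex \<Rightarrow> gcomplex \<Rightarrow> gcomplex)"
  by standard (auto simp: algebra_simps)

lemma continuous_map_pairing_right: "continuous_map top_S euclidean (pairing u)"
  unfolding continuous_map_def
proof (intro conjI allI impI)
  fix U :: "gcomplex set" assume U: "openin euclidean U"
  obtain C j where C: "C \<ge> 0" "\<And>v. gabs (pairing u v) \<le> C * P_S j v" by (rule gabs_pairing_le[of u]) blast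
  have "openin top_S {v. pairing u v \<in> U}"
    unfolding top_S_def openin_seminorm_topology
  proof (intro conjI ballI)
    fix v assume "v \<in> {v. pairing u v \<in> U}"
    then obtain e where e: "e > 0" "ball (pairing u v) e \<subseteq> U" using U by (auto elim: openE)
    have "pairing u w \<in> U" if "P_S j (w - v) < e / (C + 1)" for w
    proof -
      have P: "P_S j (w - v) \<ge> 0" using ultra_pseudo_seminormD(2)[OF ultra_pseudo_seminorm_P_S] by blast
      have "dist (pairing u v) (pairing u w) = gabs (pairing u (w - v))"
        by (subst dist_commute) (simp add: dist_gcomplex_def pairing_diff_right)
      also have "\<dots> \<le> (C + 1) * P_S j (w - v)" using C(2)[of "w - v"] P by (simp add: distrib_right)
      also have "\<dots> < e" using that C(1) by (simp add: field_simps)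
      finally show ?thesis using e(2) by auto
    qed
    then show "\<exists>F0 \<delta>. finite F0 \<and> F0 \<subseteq> range P_S \<and> 0 < \<delta> \<and> {w \<in> UNIV. \<forall>P\<in>F0. P (w - v) < \<delta>}
        \<subseteq> {v. pairing u v \<in> U}"
      using e(1) C(1) by (intro exI[of _ "{P_S j}"] exI[of _ "e / (C + 1)"]) auto
  qed simp
  then show "openin top_S {v \<in> topspace top_S. pairing u v \<in> U}" by (simp add: top_S_def)
qed simp

lemma pairing_dual_S: "pairing u \<in> dual_S"
  unfolding dual_S_def module_hom_iff
  by (auto simp: module_S module_gcomplex pairing_add_right pairing_scale_right continuous_map_pairing_right)

lemma module_hom_pairing:
  "module_hom scale_tau (\<lambda>l T v. l * T v) (pairing :: 'n::finite G_tau \<Rightarrow> 'n G_S \<Rightarrow> gcomplex)"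
  unfolding module_hom_iff
proof (intro conjI allI module_tau)
  show "module (\<lambda>l (T :: 'n G_S \<Rightarrow> gcomplex) v. l * T v)"
    by standard (auto simp: fun_eq_iff algebra_simps)
qed (auto simp: fun_eq_iff pairing_add_left pairing_scale_left)

lemma continuous_map_pairing: "continuous_map top_tau top_dual_S pairing"
  unfolding continuous_map_def
proof (intro conjI allI impI)
  show "pairing \<in> topspace top_tau \<rightarrow> topspace top_dual_S"
    using pairing_dual_S by (auto simp: top_dual_S_def)
  fix U :: "('a G_S \<Rightarrow> gcomplex) set" assume U: "openin top_dual_S U"
  show "openin top_tau {u \<in> topspace top_tau. pairing u \<in> U}"
  proof (subst openin_subopen, intro ballI)
    fix u assume "u \<in> {u \<in> topspace top_tau. pairing u \<in> U}"
    then have u: "pairing u \<in> U" by simp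
    let ?F = "{\<lambda>T. Sup (insert 0 ((\<lambda>u. gabs (T u)) ` B)) | B. lc_bounded (\<lambda>l u. {scale_S l u}) UNIV top_S B}"
    obtain F0 \<delta> where F0: "finite F0" "F0 \<subseteq> ?F" "\<delta> > 0" "{T \<in> dual_S. \<forall>P\<in>F0. P (T - pairing u) < \<delta>} \<subseteq> U"
      using U u unfolding top_dual_S_def openin_seminorm_topology by blast
    let ?W = "\<lambda>P. {w. P (pairing w - pairing u) < \<delta>}"
    have W: "openin top_tau (?W P) \<and> u \<in> ?W P" if P0: "P \<in> F0" for P
    proof -
      obtain B where B: "lc_bounded (\<lambda>l u. {scale_S l u}) UNIV top_S B"
          and P: "P = (\<lambda>T. Sup (insert 0 ((\<lambda>u. gabs (T u)) ` B)))"
        using F0(2) P0 by blast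
      have *: "P (pairing w - pairing u) = sup_pairing B (w - u)" for w
        by (simp add: P sup_pairing_def pairing_diff_left)
      show ?thesis unfolding *
        using openin_top_tau_ball[OF B] F0(3) ultra_pseudo_seminormD(1)[OF ultra_pseudo_seminorm_sup_pairing[OF B]]
        by simp
    qed
    have "openin top_tau (topspace top_tau \<inter> \<Inter>(?W ` F0))"
      using F0(1) W openin_topspace[of "top_tau :: 'a G_tau topology"]
      by (intro openin_Int_Inter) auto
    moreover have "u \<in> topspace top_tau \<inter> \<Inter>(?W ` F0)" using W by simp
    moreover have "topspace top_tau \<inter> \<Inter>(?W ` F0) \<subseteq> {u \<in> topspace top_tau. pairing u \<in> U}"
      using F0(4) pairing_dual_S by auto
    ultimately show "\<exists>T. openin top_tau T \<and> u \<in> T \<and> T \<subseteq> {u \<in> topspace top_tau. pairing u \<in> U}" by blast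
  qed
qed


section \<open>Zero-order estimates\<close>

lemma finite_multi_indices_le: "finite (multi_indices_le m :: ('n::finite \<Rightarrow> nat) set)"
proof (rule finite_subset)
  show "multi_indices_le m \<subseteq> PiE (UNIV :: 'n set) (\<lambda>_. {..m})"
  proof
    fix \<alpha> :: "'n \<Rightarrow> nat" assume a: "\<alpha> \<in> multi_indices_le m"
    have "\<alpha> i \<le> m" for i
      using member_le_sum[of i UNIV \<alpha>] a unfolding multi_indices_le_def by simp
    then show "\<alpha> \<in> PiE UNIV (\<lambda>_. {..m})" by (simp add: PiE_UNIV_domain)
  qed
qed (simp add: finite_PiE)

lemma wsup_singleton: "wsup w {\<alpha>} f = wsup w {\<lambda>_. 0} (mderiv \<alpha> f)"
  by (simp add: wsup_def)

lemma wsup_le_iff: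
  assumes "\<And>x. w x \<ge> 0" "c \<ge> 0"
  shows "wsup w A f \<le> ennreal c \<longleftrightarrow> (\<forall>x. \<forall>\<alpha>\<in>A. w x * cmod (mderiv \<alpha> f x) \<le> c)"
  using assms unfolding wsup_def by (auto simp: SUP_le_iff ennreal_le_iff)

text \<open>Trades suprema in \<open>ennreal\<close> for pointwise real inequalities with one
  constant, the form suited to computation.\<close>

lemma wsup_bigo_iff:
  assumes w: "\<And>x. w x \<ge> 0"
  shows "eps_bigo (\<lambda>\<epsilon>. wsup w A (u \<epsilon>)) b \<longleftrightarrow> (\<exists>C\<ge>0. \<forall>\<^sub>F \<epsilon> in at_right 0.
    \<forall>x. \<forall>\<alpha>\<in>A. w x * cmod (mderiv \<alpha> (u \<epsilon>) x) \<le> C * \<epsilon> powr b)" (is "?L \<longleftrightarrow> ?R")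
proof
  assume ?L
  then obtain C where C: "C \<ge> 0" "\<forall>\<^sub>F \<epsilon> in at_right 0. wsup w A (u \<epsilon>) \<le> ennreal (C * \<epsilon> powr b)"
    by (rule eps_bigo_obtain)
  have "\<forall>\<^sub>F \<epsilon> in at_right 0. \<forall>x. \<forall>\<alpha>\<in>A. w x * cmod (mderiv \<alpha> (u \<epsilon>) x) \<le> C * \<epsilon> powr b"
    using C(2) by eventually_elim (use C(1) w in \<open>simp add: wsup_le_iff\<close>)
  then show ?R using C(1) by blast
next
  assume ?R
  then obtain C where C: "C \<ge> 0"
      "\<forall>\<^sub>F \<epsilon> in at_right 0. \<forall>x. \<forall>\<alpha>\<in>A. w x * cmod (mderiv \<alpha> (u \<epsilon>) x) \<le> C * \<epsilon> powr b" by blast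
  have "\<forall>\<^sub>F \<epsilon> in at_right 0. wsup w A (u \<epsilon>) \<le> ennreal (C * \<epsilon> powr b)"
    using C(2) by eventually_elim (use C(1) w in \<open>simp add: wsup_le_iff\<close>)
  then show ?L unfolding eps_bigo_def by blast
qed

lemma tempered_bigo_iff:
  "eps_bigo (\<lambda>\<epsilon>. wsup (tempered_weight N) A (u \<epsilon>)) b \<longleftrightarrow> (\<exists>C\<ge>0. \<forall>\<^sub>F \<epsilon> in at_right 0.
    \<forall>x. \<forall>\<alpha>\<in>A. cmod (mderiv \<alpha> (u \<epsilon>) x) \<le> C * \<epsilon> powr b * (1 + norm x) ^ N)"
proof -
  have "tempered_weight N x * a \<le> c \<longleftrightarrow> a \<le> c * (1 + norm x) ^ N" for x :: "real^'a" and a c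
  proof -
    have "(1 + norm x) ^ N > 0" by (intro zero_less_power add_pos_nonneg) auto
    then show ?thesis by (simp add: tempered_weight_def field_simps)
  qed
  then show ?thesis by (simp add: wsup_bigo_iff[OF tempered_weight_nonneg])
qed

lemma wsup_bigo_finite_indices:
  assumes "finite A" and w: "\<And>x. w x \<ge> 0" and "\<And>\<alpha>. \<alpha> \<in> A \<Longrightarrow> eps_bigo (\<lambda>\<epsilon>. wsup w {\<alpha>} (u \<epsilon>)) b"
  shows "eps_bigo (\<lambda>\<epsilon>. wsup w A (u \<epsilon>)) b"
  using assms(1,3)
proof (induction A)
  case empty
  then show ?case by (simp add: wsup_def bot_ennreal)
next
  case (insert \<alpha> A)
  have "eps_bigo (\<lambda>\<epsilon>. wsup w A (u \<epsilon>)) b" "eps_bigo (\<lambda>\<epsilon>. wsup w {\<alpha>} (u \<epsilon>)) b"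
    using insert by auto
  from eps_bigo_add[OF this] show ?case
  proof (rule eps_bigo_mono)
    fix \<epsilon> :: real
    show "wsup w (insert \<alpha> A) (u \<epsilon>) \<le> wsup w A (u \<epsilon>) + wsup w {\<alpha>} (u \<epsilon>)"
      unfolding wsup_def[of w "insert \<alpha> A"]
    proof (intro SUP_least)
      fix x \<beta> assume "\<beta> \<in> insert \<alpha> A"
      then show "ennreal (w x * cmod (mderiv \<beta> (u \<epsilon>) x)) \<le> wsup w A (u \<epsilon>) + wsup w {\<alpha>} (u \<epsilon>)"
        by (auto intro: add_increasing add_increasing2 wsup_upper)
    qed
  qed
qed

text \<open>The square of \<open>(1 + |x|)\<^sup>j |\<partial>\<^sup>\<alpha>u|\<close> is the product of a negligible factor weighted by
  \<open>(1 + |x|)\<^sup>-\<^sup>N\<close> and a moderate one weighted by \<open>(1 + |x|)\<^sup>N\<^sup>+\<^sup>2\<^sup>j\<close>.\<close>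

lemma moderate_S_negligible_tau:
  fixes u :: "real \<Rightarrow> real^'n::finite \<Rightarrow> complex"
  assumes u: "u \<in> moderate_S" and n: "u \<in> negligible_tau"
  shows "u \<in> negligible_S"
proof -
  have "eps_bigo (\<lambda>\<epsilon>. wsup (\<lambda>x. (1 + norm x) ^ j) {\<alpha>} (u \<epsilon>)) (real q)"
    if \<alpha>: "\<alpha> \<in> multi_indices_le j" for j q and \<alpha> :: "'n \<Rightarrow> nat"
  proof -
    obtain N where N: "\<And>q::nat. eps_bigo (\<lambda>\<epsilon>. wsup (tempered_weight N) {\<alpha>} (u \<epsilon>)) (real q)"
      using n unfolding negligible_tau_def by blast
    define J where "J = N + (j + j)"
    have \<alpha>J: "\<alpha> \<in> multi_indices_le J" using \<alpha> by (simp add: multi_indices_le_def J_def)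
    obtain b where "eps_bigo (\<lambda>\<epsilon>. schwartz_seminorm J (u \<epsilon>)) b" using schwartz_seminorm_bigo[OF u] by blast
    then obtain D where D: "D \<ge> 0" "\<forall>\<^sub>F \<epsilon> in at_right 0. \<forall>x. \<forall>\<alpha>\<in>multi_indices_le J.
        (1 + norm x) ^ J * cmod (mderiv \<alpha> (u \<epsilon>) x) \<le> D * \<epsilon> powr b"
      unfolding schwartz_seminorm_def by (subst (asm) wsup_bigo_iff) auto
    \<comment> \<open>The order 2q - b cancels the order b of the moderate factor, so the product is
      of order 2q and its square root of order q. Both factors contain the same derivative: the
      interpolation is between weights, not between derivatives.\<close>
    obtain C where C: "C \<ge> 0" "\<forall>\<^sub>F \<epsilon> in at_right 0. \<forall>x.
        cmod (mderiv \<alpha> (u \<epsilon>) x) \<le> C * \<epsilon> powr (2 * real q - b) * (1 + norm x) ^ N"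
      using bigo_nat_all[OF N, of "2 * real q - b"] unfolding tempered_bigo_iff by auto
    have "\<forall>\<^sub>F \<epsilon> in at_right 0. \<forall>x. (1 + norm x) ^ j * cmod (mderiv \<alpha> (u \<epsilon>) x) \<le> sqrt (C * D) * \<epsilon> powr real q"
      using C(2) D(2) eventually_eps
    proof eventually_elim
      case (elim \<epsilon>)
      show ?case
      proof
        fix x :: "real^'n"
        let ?m = "cmod (mderiv \<alpha> (u \<epsilon>) x)" and ?p = "1 + norm x"
        have p: "?p > 0" by (intro add_pos_nonneg) auto
        have "?p ^ N * (?p ^ j * ?m)\<^sup>2 = ?m * (?p ^ J * ?m)"
          by (simp only: J_def power_add power2_eq_square mult_ac)
        also have "\<dots> \<le> (C * \<epsilon> powr (2 * real q - b) * ?p ^ N) * (D * \<epsilon> powr b)"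
          using elim \<alpha>J p C(1) by (intro mult_mono[of ?m _ "?p ^ J * ?m"]) auto
        also have "\<dots> = ?p ^ N * (C * D * \<epsilon> powr (2 * real q))"
          using elim by (simp add: powr_diff field_simps)
        also have "C * D * \<epsilon> powr (2 * real q) = (sqrt (C * D) * \<epsilon> powr real q)\<^sup>2"
        proof -
          have "(\<epsilon> powr real q)\<^sup>2 = \<epsilon> powr (2 * real q)" 
            by (simp only: power2_eq_square powr_add[symmetric] mult_2)
          then show ?thesis using C(1) D(1) by (simp add: power_mult_distrib)
        qed
        finally have "(?p ^ j * ?m)\<^sup>2 \<le> (sqrt (C * D) * \<epsilon> powr real q)\<^sup>2" using p by simp
        then show "?p ^ j * ?m \<le> sqrt (C * D) * \<epsilon> powr real q"
          by (rule power2_le_imp_le) (use C(1) D(1) in simp)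
      qed
    qed
    then show ?thesis by (subst wsup_bigo_iff) (use C(1) D(1) in \<open>auto intro!: exI[of _ "sqrt (C * D)"]\<close>)
  qed
  then have "eps_bigo (\<lambda>\<epsilon>. schwartz_seminorm j (u \<epsilon>)) (real q)" for j q
    unfolding schwartz_seminorm_def
    by (auto intro: wsup_bigo_finite_indices[OF finite_multi_indices_le])
  then show ?thesis using u unfolding negligible_S_def moderate_S_def by blast
qed

lemma inj_embed_S_tau: "inj (embed_S_tau :: 'n::finite G_S \<Rightarrow> 'n G_tau)"
proof (rule injI)
  fix v w :: "'n G_S" assume "embed_S_tau v = embed_S_tau w"
  then have "abs_G_tau (rep_G_S v) = abs_G_tau (rep_G_S w)"
    using embed_S_tau_abs[OF rep_G_S(1), of v] embed_S_tau_abs[OF rep_G_S(1), of w] by (simp add: rep_G_S(2))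
  then have "rep_G_S v - rep_G_S w \<in> negligible_tau"
    using abs_G_tau_eq_iff rep_G_S(1) moderate_S_tau by blast
  then have "rep_G_S v - rep_G_S w \<in> negligible_S"
    using moderate_S_negligible_tau moderate_S_diff rep_G_S(1) by blast
  then show "v = w" using abs_G_S_eq_iff[OF rep_G_S(1) rep_G_S(1), of v w] by (simp add: rep_G_S(2))
qed

section \<open>Taylor estimates along coordinate lines\<close>

lemma smooth_pder: "smooth f \<Longrightarrow> smooth (pder i f)"
proof -
  assume f: "smooth f"
  have "foldr pder is (pder i f) = foldr pder (is @ [i]) f" for "is" by simp
  then show ?thesis using smoothD[OF f] unfolding smooth_def by metis
qed

text \<open>\<open>smooth\<close> speaks of differentiability at parameter 0 only; moving the base
  point gives it along the entire line.\<close>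

lemma has_vector_derivative_pder:
  assumes "smooth f"
  shows "((\<lambda>t. f (x + t *\<^sub>R axis i 1)) has_vector_derivative pder i f (x + s *\<^sub>R axis i 1)) (at s)"
proof -
  have "((\<lambda>t. f (x + s *\<^sub>R axis i 1 + t *\<^sub>R axis i 1)) has_vector_derivative pder i f (x + s *\<^sub>R axis i 1)) (at 0)"
    using smoothD(1)[OF assms, of "[]" "x + s *\<^sub>R axis i 1" i]
    unfolding pder_def by (simp add: vector_derivative_works)
  then have "(((\<lambda>t. f (x + s *\<^sub>R axis i 1 + t *\<^sub>R axis i 1)) \<circ> (\<lambda>t. t - s)) has_vector_derivative
      1 *\<^sub>R pder i f (x + s *\<^sub>R axis i 1)) (at s)"
    by (intro vector_diff_chain_at) (auto intro!: derivative_eq_intros)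
  then show ?thesis by (simp add: o_def algebra_simps flip: scaleR_add_left)
qed

lemma pder_bound_increment:
  assumes f: "smooth f" and B: "\<And>s. \<bar>s\<bar> \<le> \<bar>t\<bar> \<Longrightarrow> cmod (pder i f (x + s *\<^sub>R axis i 1)) \<le> B"
  shows "cmod (f (x + t *\<^sub>R axis i 1) - f x) \<le> \<bar>t\<bar> * B"
proof -
  have "norm (f (x + t *\<^sub>R axis i 1) - f (x + 0 *\<^sub>R axis i 1)) \<le> B * norm (t - 0)"
  \<comment> \<open>The symmetric interval serves both signs of \<open>t\<close>.\<close>
  proof (rule differentiable_bound[where S = "{- \<bar>t\<bar>..\<bar>t\<bar>}" and f = "\<lambda>t. f (x + t *\<^sub>R axis i 1)"])
    fix s assume s: "s \<in> {- \<bar>t\<bar>..\<bar>t\<bar>}"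
    show "((\<lambda>t. f (x + t *\<^sub>R axis i 1)) has_derivative (\<lambda>h. h *\<^sub>R pder i f (x + s *\<^sub>R axis i 1)))
        (at s within {- \<bar>t\<bar>..\<bar>t\<bar>})"
      using has_vector_derivative_pder[OF f, of x i s]
      by (auto simp: has_vector_derivative_def intro: has_derivative_at_withinI)
    have "cmod (pder i f (x + s *\<^sub>R axis i 1)) \<le> B" using s by (intro B) auto
    then show "onorm (\<lambda>h. h *\<^sub>R pder i f (x + s *\<^sub>R axis i 1)) \<le> B"
      by (intro onorm_le) (simp add: mult.commute[of B] mult_left_mono)
  qed auto
  then show ?thesis by (simp add: mult.commute)
qed

text \<open>The usual factor 1/2 is missing because the increment of the derivative is bounded by
  |t| B uniformly on the whole interval.\<close>

lemma pder_taylor: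
  assumes f: "smooth f" and B: "\<And>s. \<bar>s\<bar> \<le> \<bar>t\<bar> \<Longrightarrow> cmod (pder i (pder i f) (x + s *\<^sub>R axis i 1)) \<le> B"
  shows "cmod (f (x + t *\<^sub>R axis i 1) - f x - t *\<^sub>R pder i f x) \<le> t\<^sup>2 * B"
proof -
  have B0: "B \<ge> 0" by (rule order_trans[OF norm_ge_zero B[of 0]]) simp
  have "norm (f (x + t *\<^sub>R axis i 1) - f (x + 0 *\<^sub>R axis i 1) - (t - 0) *\<^sub>R pder i f (x + 0 *\<^sub>R axis i 1))
      \<le> norm (t - 0) * (\<bar>t\<bar> * B)"
  proof (rule vector_differentiable_bound_linearization[where S = "{- \<bar>t\<bar>..\<bar>t\<bar>}"
        and f = "\<lambda>t. f (x + t *\<^sub>R axis i 1)" and f' = "\<lambda>s. pder i f (x + s *\<^sub>R axis i 1)" and ?x0.0 = 0])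
    fix s assume s: "s \<in> {- \<bar>t\<bar>..\<bar>t\<bar>}"
    show "((\<lambda>t. f (x + t *\<^sub>R axis i 1)) has_vector_derivative pder i f (x + s *\<^sub>R axis i 1))
        (at s within {- \<bar>t\<bar>..\<bar>t\<bar>})"
      using has_vector_derivative_pder[OF f] by (rule has_vector_derivative_at_within)
    have "cmod (pder i f (x + s *\<^sub>R axis i 1) - pder i f x) \<le> \<bar>s\<bar> * B"
      using s by (intro pder_bound_increment smooth_pder f B) auto
    also have "\<dots> \<le> \<bar>t\<bar> * B" using s B0 by (intro mult_right_mono) auto
    finally show "norm (pder i f (x + s *\<^sub>R axis i 1) - pder i f (x + 0 *\<^sub>R axis i 1)) \<le> \<bar>t\<bar> * B" by simp
  qed (auto simp: closed_segment_eq_real_ivl)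
  then show ?thesis by (simp add: power2_eq_square mult.assoc flip: abs_mult)
qed

text \<open>Only coordinate derivatives are at hand, so \<open>x\<close> is moved to
  \<open>z\<close> one coordinate at a time, which brings in the factor n. \<open>p S\<close> takes
  the coordinates in \<open>S\<close> from \<open>z\<close> and the others from \<open>x\<close>.
  Each point on the way is componentwise at most as far from \<open>x\<close> as \<open>z\<close>
  is, and hence stays in the ball where \<open>B\<close> applies.\<close>

lemma pder_bound_lipschitz:
  fixes f :: "real^'n::finite \<Rightarrow> complex"
  assumes f: "smooth f" and B: "\<And>i y. norm (y - x) \<le> norm (z - x) \<Longrightarrow> cmod (pder i f y) \<le> B"
  shows "cmod (f z - f x) \<le> CARD('n) * norm (z - x) * B"
proof -
  define p where "p S = (\<chi> i. if i \<in> S then z $ i else x $ i)" for S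
  have B0: "B \<ge> 0" by (rule order_trans[OF norm_ge_zero B[of x]]) simp
  have "cmod (f (p S) - f x) \<le> card S * norm (z - x) * B" if "finite S" for S
    using that
  proof (induction S)
    case empty
    have "p {} = x" by (simp add: p_def vec_eq_iff)
    then show ?case by simp
  next
    case (insert i S)
    let ?t = "z $ i - x $ i"
    have t: "\<bar>?t\<bar> \<le> norm (z - x)" using component_le_norm_cart[of "z - x" i] by simp
    have p: "p (insert i S) = p S + ?t *\<^sub>R axis i 1"
      using insert(2) by (auto simp: p_def vec_eq_iff axis_def)
    have "cmod (f (p (insert i S)) - f (p S)) \<le> \<bar>?t\<bar> * B"
      unfolding p
    proof (rule pder_bound_increment[OF f], rule B)
      fix s assume s: "\<bar>s\<bar> \<le> \<bar>?t\<bar>"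
      show "norm (p S + s *\<^sub>R axis i 1 - x) \<le> norm (z - x)"
        by (rule norm_le_componentwise_cart) (use s insert(2) in \<open>auto simp: p_def axis_def\<close>)
    qed
    also have "\<dots> \<le> norm (z - x) * B" by (intro mult_right_mono t B0)
    finally have "cmod (f (p (insert i S)) - f (p S)) \<le> norm (z - x) * B" .
    moreover have "cmod (f (p (insert i S)) - f x) \<le> cmod (f (p (insert i S)) - f (p S)) + cmod (f (p S) - f x)"
      using norm_triangle_ineq[of "f (p (insert i S)) - f (p S)" "f (p S) - f x"] by simp
    ultimately show ?case using insert by (simp add: algebra_simps)
  qed
  from this[of UNIV] show ?thesis by (simp add: p_def)
qed

section \<open>From zero order to all derivatives\<close>

abbreviation zero_order_negligible :: "(real \<Rightarrow> real^'n::finite \<Rightarrow> complex) \<Rightarrow> bool" where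
  "zero_order_negligible g \<equiv>
    \<exists>N::nat. \<forall>q::nat. eps_bigo (\<lambda>\<epsilon>. wsup (tempered_weight N) {\<lambda>_. 0} (g \<epsilon>)) (real q)"

lemma one_plus_norm_shift:
  fixes x y :: "'a::real_normed_vector"
  assumes "norm y \<le> 1"
  shows "1 + norm (x + y) \<le> 2 * (1 + norm x)"
proof -
  have "norm (x + y) \<le> norm x + 1" using norm_triangle_ineq[of x y] assms by simp
  also have "\<dots> \<le> 2 * norm x + 1" by simp
  finally show ?thesis by simp
qed

text \<open>A second-order Taylor expansion with step \<open>\<epsilon>\<^sup>r\<close>, where \<open>r\<close> may be taken arbitrarily large.\<close>

lemma zero_order_negligible_pder:
  fixes g :: "real \<Rightarrow> real^'n::finite \<Rightarrow> complex"
  assumes sm: "\<And>\<epsilon>. 0 < \<epsilon> \<Longrightarrow> \<epsilon> \<le> 1 \<Longrightarrow> smooth (g \<epsilon>)"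
    and neg: "zero_order_negligible g"
    and mod: "\<exists>L::nat. eps_bigo (\<lambda>\<epsilon>. wsup (tempered_weight L) {\<lambda>_. 0} (pder i (pder i (g \<epsilon>)))) (- real L)"
  shows "zero_order_negligible (\<lambda>\<epsilon>. pder i (g \<epsilon>))"
proof -
  obtain N where N: "\<And>q::nat. eps_bigo (\<lambda>\<epsilon>. wsup (tempered_weight N) {\<lambda>_. 0} (g \<epsilon>)) (real q)"
    using neg by blast
  obtain L :: nat and D where D: "D \<ge> 0" "\<forall>\<^sub>F \<epsilon> in at_right 0.
      \<forall>x. cmod (pder i (pder i (g \<epsilon>)) x) \<le> D * \<epsilon> powr (- real L) * (1 + norm x) ^ L"
    using mod unfolding tempered_bigo_iff by auto
  have "eps_bigo (\<lambda>\<epsilon>. wsup (tempered_weight (N + L)) {\<lambda>_. 0} (pder i (g \<epsilon>))) (real q)" for q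
  proof -
    \<comment> \<open>With step h = eps^(q + L) the Taylor remainder divided by h is of order h
      eps^(-L) = eps^q; the values of g are taken at order q + r so that order q survives the
      division by h.\<close>
    let ?r = "real q + real L"
    obtain C where C: "C \<ge> 0" "\<forall>\<^sub>F \<epsilon> in at_right 0.
        \<forall>x. cmod (g \<epsilon> x) \<le> C * \<epsilon> powr (real q + ?r) * (1 + norm x) ^ N"
      using bigo_nat_all[OF N, of "real q + ?r"] unfolding tempered_bigo_iff by auto
    \<comment> \<open>The powers of 2 come from shifting \<open>x\<close> by at most 1;
      \<open>2 ^ N + 1\<close> collects the two values of \<open>g\<close> in the difference
      quotient.\<close>
    let ?E = "C * (2 ^ N + 1) + D * 2 ^ L"
    have "\<forall>\<^sub>F \<epsilon> in at_right 0. \<forall>x. cmod (pder i (g \<epsilon>) x) \<le> ?E * \<epsilon> powr real q * (1 + norm x) ^ (N + L)"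
      using C(2) D(2) eventually_eps
    proof eventually_elim
      case (elim \<epsilon>)
      define h where "h = \<epsilon> powr ?r"
      have h: "h > 0" "h \<le> 1" using elim by (auto simp: h_def powr_le1)
      show ?case
      proof
        fix x :: "real^'n"
        let ?e = "axis i 1 :: real^'n" and ?p = "1 + norm x"
        have shift: "1 + norm (x + s *\<^sub>R ?e) \<le> 2 * ?p" if "\<bar>s\<bar> \<le> h" for s
          using that h by (intro one_plus_norm_shift) simp
        have p1: "?p ^ a \<le> ?p ^ (N + L)" if "a \<le> N + L" for a
          using that by (intro power_increasing) auto
        have "cmod (pder i (pder i (g \<epsilon>)) (x + s *\<^sub>R ?e)) \<le> D * \<epsilon> powr (- real L) * (2 * ?p) ^ L"
          if "\<bar>s\<bar> \<le> \<bar>h\<bar>" for s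
        proof -
          have "cmod (pder i (pder i (g \<epsilon>)) (x + s *\<^sub>R ?e))
              \<le> D * \<epsilon> powr (- real L) * (1 + norm (x + s *\<^sub>R ?e)) ^ L" using elim by blast
          also have "\<dots> \<le> D * \<epsilon> powr (- real L) * (2 * ?p) ^ L"
            using that h D(1) by (intro mult_left_mono power_mono shift) auto
          finally show ?thesis .
        qed
        then have T: "cmod (g \<epsilon> (x + h *\<^sub>R ?e) - g \<epsilon> x - h *\<^sub>R pder i (g \<epsilon>) x)
            \<le> h\<^sup>2 * (D * \<epsilon> powr (- real L) * (2 * ?p) ^ L)"
          using elim by (intro pder_taylor sm) auto
        have a: "cmod (g \<epsilon> x) \<le> C * \<epsilon> powr (real q + ?r) * ?p ^ N" using elim by blast
        have "cmod (g \<epsilon> (x + h *\<^sub>R ?e)) \<le> C * \<epsilon> powr (real q + ?r) * (1 + norm (x + h *\<^sub>R ?e)) ^ N"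
          using elim by blast
        also have "\<dots> \<le> C * \<epsilon> powr (real q + ?r) * (2 * ?p) ^ N"
          using h C(1) by (intro mult_left_mono power_mono shift) auto
        finally have b: "cmod (g \<epsilon> (x + h *\<^sub>R ?e)) \<le> C * \<epsilon> powr (real q + ?r) * (2 * ?p) ^ N" .
        have "h * cmod (pder i (g \<epsilon>) x) = cmod ((g \<epsilon> (x + h *\<^sub>R ?e) - g \<epsilon> x)
            - (g \<epsilon> (x + h *\<^sub>R ?e) - g \<epsilon> x - h *\<^sub>R pder i (g \<epsilon>) x))"
          using h by simp
        also have "\<dots> \<le> cmod (g \<epsilon> (x + h *\<^sub>R ?e) - g \<epsilon> x)
            + cmod (g \<epsilon> (x + h *\<^sub>R ?e) - g \<epsilon> x - h *\<^sub>R pder i (g \<epsilon>) x)"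
          by (rule norm_triangle_ineq4)
        also have "cmod (g \<epsilon> (x + h *\<^sub>R ?e) - g \<epsilon> x) \<le> cmod (g \<epsilon> (x + h *\<^sub>R ?e)) + cmod (g \<epsilon> x)"
          by (rule norm_triangle_ineq4)
        finally have "h * cmod (pder i (g \<epsilon>) x) \<le> C * \<epsilon> powr (real q + ?r) * (2 * ?p) ^ N
            + C * \<epsilon> powr (real q + ?r) * ?p ^ N + h\<^sup>2 * (D * \<epsilon> powr (- real L) * (2 * ?p) ^ L)"
          using a b T by linarith
        also have "\<dots> = h * (C * \<epsilon> powr real q * 2 ^ N * ?p ^ N + C * \<epsilon> powr real q * ?p ^ N
            + D * \<epsilon> powr real q * 2 ^ L * ?p ^ L)"
        proof -
          have 1: "\<epsilon> powr (real q + ?r) = h * \<epsilon> powr real q" by (simp add: h_def add.commute flip: powr_add)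
          have "h * \<epsilon> powr (- real L) = \<epsilon> powr real q"
            by (simp add: h_def flip: powr_add)
          then have 2: "h\<^sup>2 * (D * \<epsilon> powr (- real L) * X) = h * (D * \<epsilon> powr real q * X)" for X
            by (simp add: power2_eq_square mult_ac)
          show ?thesis unfolding 1 2 power_mult_distrib by (simp only: distrib_left mult_ac)
        qed
        finally have "cmod (pder i (g \<epsilon>) x) \<le> C * \<epsilon> powr real q * 2 ^ N * ?p ^ N
            + C * \<epsilon> powr real q * ?p ^ N + D * \<epsilon> powr real q * 2 ^ L * ?p ^ L"
          using h(1) by simp
        also have "\<dots> \<le> C * \<epsilon> powr real q * 2 ^ N * ?p ^ (N + L)
            + C * \<epsilon> powr real q * ?p ^ (N + L) + D * \<epsilon> powr real q * 2 ^ L * ?p ^ (N + L)"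
          using C(1) D(1) by (intro add_mono mult_left_mono p1) auto
        also have "\<dots> = ?E * \<epsilon> powr real q * ?p ^ (N + L)" by (simp add: algebra_simps)
        finally show "cmod (pder i (g \<epsilon>) x) \<le> ?E * \<epsilon> powr real q * ?p ^ (N + L)" .
      qed
    qed
    moreover have "?E \<ge> 0" using C(1) D(1) by simp
    ultimately show ?thesis unfolding tempered_bigo_iff by auto
  qed
  then show ?thesis by blast
qed

lemma coordinates: "distinct (coordinates :: 'n::finite list)" "set (coordinates :: 'n list) = UNIV"
proof -
  obtain xs :: "'n list" where "set xs = UNIV" "distinct xs"
    using finite_distinct_list[of "UNIV :: 'n set"] by auto
  then have "\<exists>xs :: 'n list. distinct xs \<and> set xs = UNIV" by blast
  from someI_ex[OF this] show "distinct (coordinates :: 'n list)" "set (coordinates :: 'n list) = UNIV"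
    unfolding coordinates_def by auto
qed

lemma smooth_funpow_pder: "smooth f \<Longrightarrow> smooth ((pder i ^^ k) f)"
  by (induction k) (auto intro: smooth_pder)

lemma smooth_foldr_pder: "smooth f \<Longrightarrow> smooth (foldr (\<lambda>i. pder i ^^ \<alpha> i) ys f)"
  by (induction ys) (auto intro: smooth_funpow_pder)

lemma foldr_funpow_cong:
  "(\<And>j. j \<in> set ys \<Longrightarrow> \<alpha> j = \<beta> j) \<Longrightarrow>
    foldr (\<lambda>i. pder i ^^ \<alpha> i) ys f = foldr (\<lambda>i. pder i ^^ \<beta> i) ys f"
  by (induction ys) auto

lemma foldr_funpow_zero: "(\<And>j. j \<in> set ys \<Longrightarrow> \<alpha> j = 0) \<Longrightarrow> foldr (\<lambda>i. pder i ^^ \<alpha> i) ys f = f"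
  by (induction ys) auto

text \<open>Differentiating along the fixed enumeration of the coordinates, every intermediate derivative and
  its second derivative in the current coordinate are of the form \<^term>\<open>mderiv \<beta> f\<close>, so that
  no interchange of partial derivatives is needed.\<close>

lemma negligible_tau_if_zero_order:
  fixes u :: "real \<Rightarrow> real^'n::finite \<Rightarrow> complex"
  assumes u: "u \<in> moderate_tau" and neg: "zero_order_negligible u"
  shows "u \<in> negligible_tau"
proof -
  have slow: "u \<in> nets_in slowly_increasing" using u unfolding moderate_tau_def by blast
  have sm: "smooth (u \<epsilon>)" if "0 < \<epsilon>" "\<epsilon> \<le> 1" for \<epsilon>
    using nets_in_eps[OF slow that] by (rule slowly_increasing_smooth)
  \<comment> \<open>\<open>foldr\<close> differentiates in the last coordinates first, so the
    intermediate derivatives belong to suffixes of \<open>coordinates\<close>.\<close>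
  have neg_suffix: "zero_order_negligible (\<lambda>\<epsilon>. foldr (\<lambda>i. pder i ^^ \<alpha> i) ys (u \<epsilon>))"
    if "coordinates = zs @ ys" for \<alpha> :: "'n \<Rightarrow> nat" and zs ys
    using that
  proof (induction ys arbitrary: zs)
    case Nil
    then show ?case using neg by simp
  next
    case (Cons i ys)
    let ?g = "\<lambda>\<epsilon>. foldr (\<lambda>i. pder i ^^ \<alpha> i) ys (u \<epsilon>)"
    have g: "zero_order_negligible ?g" using Cons.IH[of "zs @ [i]"] Cons.prems by simp
    have dist: "distinct (zs @ i # ys)" using coordinates(1) Cons.prems by metis
    have "zero_order_negligible (\<lambda>\<epsilon>. (pder i ^^ k) (?g \<epsilon>))" for k
    proof (induction k)
      case 0
      then show ?case using g by simp
    next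
      case (Suc k)
      \<comment> \<open>k + 2 derivatives in \<open>i\<close>, those of \<alpha> in the coordinates
        already treated, none in the others: the second derivative whose moderateness the Taylor
        step requires.\<close>
      define \<beta> where "\<beta> j = (if j = i then k + 2 else if j \<in> set ys then \<alpha> j else 0)" for j
      have \<beta>: "mderiv \<beta> f = pder i (pder i ((pder i ^^ k) (foldr (\<lambda>i. pder i ^^ \<alpha> i) ys f)))" for f
      proof -
        have "foldr (\<lambda>i. pder i ^^ \<beta> i) ys f = foldr (\<lambda>i. pder i ^^ \<alpha> i) ys f"
          using dist by (intro foldr_funpow_cong) (auto simp: \<beta>_def)
        moreover have "foldr (\<lambda>i. pder i ^^ \<beta> i) zs h = h" for h
          using dist by (intro foldr_funpow_zero) (auto simp: \<beta>_def)
        ultimately show ?thesis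
          unfolding mderiv_def Cons.prems by (simp add: \<beta>_def[of i])
      qed
      obtain L :: nat where "eps_bigo (\<lambda>\<epsilon>. wsup (tempered_weight L) {\<beta>} (u \<epsilon>)) (- real L)"
        using u unfolding moderate_tau_def by blast
      then have "eps_bigo (\<lambda>\<epsilon>. wsup (tempered_weight L) {\<lambda>_. 0}
          (pder i (pder i ((pder i ^^ k) (?g \<epsilon>))))) (- real L)"
        by (simp add: wsup_def \<beta>)
      then show ?case
        using zero_order_negligible_pder[of "\<lambda>\<epsilon>. (pder i ^^ k) (?g \<epsilon>)" i] Suc
          smooth_funpow_pder[OF smooth_foldr_pder[OF sm]] by auto
    qed
    from this[of "\<alpha> i"] show ?case by simp
  qed
  have "zero_order_negligible (\<lambda>\<epsilon>. mderiv \<alpha> (u \<epsilon>))" for \<alpha>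
    unfolding mderiv_def by (rule neg_suffix[of "[]"]) simp
  then have "\<exists>N. \<forall>q::nat. eps_bigo (\<lambda>\<epsilon>. wsup (tempered_weight N) {\<alpha>} (u \<epsilon>)) (real q)" for \<alpha>
    by (simp only: wsup_singleton[of _ \<alpha>])
  then show ?thesis using slow by (simp add: negligible_tau_def)
qed


section \<open>Gaussian test functions\<close>

text \<open>Up to the sign (-1)^k these are the physicists' Hermite polynomials, the polynomial
  factors in the derivatives of exp (- t^2).\<close>

primrec hermite :: "nat \<Rightarrow> real poly" where
  "hermite 0 = 1"
| "hermite (Suc k) = pderiv (hermite k) - [:0, 2:] * hermite k"

definition gauss_deriv :: "nat \<Rightarrow> real \<Rightarrow> real" where
  "gauss_deriv k t = poly (hermite k) t * exp (- t\<^sup>2)"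

lemma DERIV_gauss_deriv: "(gauss_deriv k has_real_derivative gauss_deriv (Suc k) t) (at t)"
  unfolding gauss_deriv_def[abs_def]
  by (auto intro!: derivative_eq_intros poly_DERIV simp: algebra_simps)

lemma poly_le_power:
  fixes p :: "real poly"
  shows "\<exists>A d. A \<ge> 0 \<and> (\<forall>t. \<bar>poly p t\<bar> \<le> A * (1 + \<bar>t\<bar>) ^ d)"
proof (induction p)
  case 0
  then show ?case by (intro exI[of _ 0]) simp
next
  case (pCons a p)
  then obtain A d where A: "A \<ge> 0" "\<And>t. \<bar>poly p t\<bar> \<le> A * (1 + \<bar>t\<bar>) ^ d" by blast
  have "\<bar>poly (pCons a p) t\<bar> \<le> (\<bar>a\<bar> + A) * (1 + \<bar>t\<bar>) ^ Suc d" for t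
  proof -
    have "\<bar>poly (pCons a p) t\<bar> \<le> \<bar>a\<bar> + \<bar>t\<bar> * \<bar>poly p t\<bar>"
      using abs_triangle_ineq[of a "t * poly p t"] by (simp add: abs_mult)
    also have "\<dots> \<le> \<bar>a\<bar> * (1 + \<bar>t\<bar>) ^ Suc d + (1 + \<bar>t\<bar>) * (A * (1 + \<bar>t\<bar>) ^ d)"
    proof (intro add_mono mult_mono A(2))
      have "1 \<le> (1 + \<bar>t\<bar>) ^ Suc d" by (intro one_le_power) simp
      from mult_left_mono[OF this, of "\<bar>a\<bar>"] show "\<bar>a\<bar> \<le> \<bar>a\<bar> * (1 + \<bar>t\<bar>) ^ Suc d" by simp
    qed auto
    finally show ?thesis by (simp add: algebra_simps)
  qed
  then show ?case using A(1) by (intro exI[of _ "\<bar>a\<bar> + A"] exI[of _ "Suc d"]) auto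
qed

text \<open>As 1 + |t| <= exp |t|, the exponent is at most m |t| - t^2, which completing the square
  bounds even by m^2 / 4.\<close>

lemma power_times_gaussian_le: "(1 + \<bar>t\<bar>) ^ m * exp (- t\<^sup>2) \<le> exp ((real m)\<^sup>2)"
proof -
  have "(1 + \<bar>t\<bar>) ^ m \<le> exp \<bar>t\<bar> ^ m" by (intro power_mono) auto
  then have "(1 + \<bar>t\<bar>) ^ m * exp (- t\<^sup>2) \<le> exp \<bar>t\<bar> ^ m * exp (- t\<^sup>2)" by (intro mult_right_mono) auto
  also have "\<dots> = exp (real m * \<bar>t\<bar> - t\<^sup>2)" by (simp flip: exp_of_nat_mult exp_add)
  also have "\<dots> \<le> exp ((real m)\<^sup>2)"
  proof (subst exp_le_cancel_iff)
    have "0 \<le> (\<bar>t\<bar> - real m / 2)\<^sup>2 + 3 / 4 * (real m)\<^sup>2" by simp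
    then show "real m * \<bar>t\<bar> - t\<^sup>2 \<le> (real m)\<^sup>2" by (simp add: power2_eq_square algebra_simps)
  qed
  finally show ?thesis .
qed

lemma gauss_deriv_bound: "\<exists>C\<ge>0. \<forall>k\<le>j. \<forall>t. (1 + \<bar>t\<bar>) ^ m * \<bar>gauss_deriv k t\<bar> \<le> C"
proof -
  have "\<exists>C\<ge>0. \<forall>t. (1 + \<bar>t\<bar>) ^ m * \<bar>gauss_deriv k t\<bar> \<le> C" for k
  proof -
    obtain A d where A: "A \<ge> 0" "\<And>t. \<bar>poly (hermite k) t\<bar> \<le> A * (1 + \<bar>t\<bar>) ^ d"
      using poly_le_power by blast
    have "(1 + \<bar>t\<bar>) ^ m * \<bar>gauss_deriv k t\<bar> \<le> A * exp ((real (m + d))\<^sup>2)" for t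
    proof -
      have "(1 + \<bar>t\<bar>) ^ m * \<bar>gauss_deriv k t\<bar> \<le> (1 + \<bar>t\<bar>) ^ m * (A * (1 + \<bar>t\<bar>) ^ d * exp (- t\<^sup>2))"
        unfolding gauss_deriv_def abs_mult by (intro mult_left_mono mult_mono A) (use A(1) in auto)
      also have "\<dots> = A * ((1 + \<bar>t\<bar>) ^ (m + d) * exp (- t\<^sup>2))" by (simp add: power_add mult_ac)
      also have "\<dots> \<le> A * exp ((real (m + d))\<^sup>2)" by (intro mult_left_mono power_times_gaussian_le A)
      finally show ?thesis .
    qed
    then show ?thesis using A(1) by (intro exI[of _ "A * exp ((real (m + d))\<^sup>2)"]) auto
  qed
  then obtain C where C: "\<And>k. C k \<ge> 0" "\<And>k t. (1 + \<bar>t\<bar>) ^ m * \<bar>gauss_deriv k t\<bar> \<le> C k" by metis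
  have "(1 + \<bar>t\<bar>) ^ m * \<bar>gauss_deriv k t\<bar> \<le> (\<Sum>k\<le>j. C k)" if "k \<le> j" for k t
    using C(2)[of t k] member_le_sum[of k "{..j}" C] C(1) that by fastforce
  then show ?thesis using C(1) by (intro exI[of _ "\<Sum>k\<le>j. C k"]) (auto intro: sum_nonneg)
qed

text \<open>The partial derivative with multi-index \<open>k\<close> of exp (- |y - x|^2 / h^2).
  Carrying the multi-index in the definition makes the family closed under \<open>pder\<close>,
  which gives smoothness and every \<open>mderiv\<close> at once.\<close>

definition gauss_test :: "('n::finite \<Rightarrow> nat) \<Rightarrow> real \<Rightarrow> real^'n \<Rightarrow> real^'n \<Rightarrow> complex" where
  "gauss_test k h x y = of_real (\<Prod>i\<in>UNIV. gauss_deriv (k i) ((y $ i - x $ i) / h) / h ^ k i)"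

lemma gauss_test_has_derivative:
  assumes h: "h > 0"
  shows "((\<lambda>t. gauss_test k h x (y + t *\<^sub>R axis i 1)) has_vector_derivative
    gauss_test (k(i := Suc (k i))) h x y) (at 0)"
proof -
  let ?R = "\<Prod>j\<in>UNIV - {i}. gauss_deriv (k j) ((y $ j - x $ j) / h) / h ^ k j"
  have "gauss_test k h x (y + t *\<^sub>R axis i 1)
      = of_real (gauss_deriv (k i) ((y $ i + t - x $ i) / h) / h ^ k i * ?R)" for t
    unfolding gauss_test_def
    by (subst prod.remove[of _ i]) (auto simp: axis_def intro!: arg_cong2[of _ _ _ _ "(*)"] prod.cong)
  moreover have "gauss_test (k(i := Suc (k i))) h x y
      = of_real (gauss_deriv (Suc (k i)) ((y $ i + 0 - x $ i) / h) / h ^ Suc (k i) * ?R)"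
    unfolding gauss_test_def
    by (subst prod.remove[of _ i]) (auto intro!: arg_cong2[of _ _ _ _ "(*)"] prod.cong)
  moreover have "((\<lambda>t. gauss_deriv (k i) ((y $ i + t - x $ i) / h) / h ^ k i * ?R) has_real_derivative
      gauss_deriv (Suc (k i)) ((y $ i + 0 - x $ i) / h) / h ^ Suc (k i) * ?R) (at 0)"
    using h by (auto intro!: derivative_eq_intros DERIV_chain2[OF DERIV_gauss_deriv])
  ultimately show ?thesis
    by (simp only: has_real_derivative_iff_has_vector_derivative has_vector_derivative_of_real)
qed

lemma pder_gauss_test: "h > 0 \<Longrightarrow> pder i (gauss_test k h x) = gauss_test (k(i := Suc (k i))) h x"
  unfolding pder_def by (intro ext vector_derivative_at gauss_test_has_derivative)

lemma continuous_gauss_deriv: "continuous_on A (gauss_deriv k)"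
  using DERIV_isCont[OF DERIV_gauss_deriv] by (simp add: continuous_at_imp_continuous_on)

lemma continuous_gauss_test:
  assumes "h > 0"
  shows "continuous_on UNIV (gauss_test k h x)"
  unfolding gauss_test_def[abs_def] using assms
  by (intro continuous_intros continuous_on_prod continuous_on_compose2[OF continuous_gauss_deriv[of UNIV]]) auto

lemma smooth_gauss_test:
  fixes x :: "real^'n::finite"
  assumes h: "h > 0"
  shows "smooth (gauss_test k h x)"
proof -
  have "\<exists>k'. foldr pder is (gauss_test k h x) = gauss_test k' h x" for "is"
    by (induction "is") (auto simp: pder_gauss_test[OF h])
  then show ?thesis unfolding smooth_def
    using continuous_gauss_test[OF h] gauss_test_has_derivative[OF h, THEN differentiableI_vector] by metis
qed

lemma funpow_pder_gauss_test:
  assumes "h > 0"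
  shows "(pder i ^^ m) (gauss_test k h x) = gauss_test (k(i := k i + m)) h x"
proof (induction m)
  case (Suc m)
  have "(k(i := k i + m))(i := Suc ((k(i := k i + m)) i)) = k(i := k i + Suc m)" by auto
  then show ?case by (simp only: funpow.simps o_apply Suc pder_gauss_test[OF assms])
qed simp

lemma mderiv_gauss_test:
  fixes x :: "real^'n::finite"
  assumes h: "h > 0"
  shows "mderiv \<alpha> (gauss_test (\<lambda>_. 0) h x) = gauss_test \<alpha> h x"
proof -
  have "foldr (\<lambda>i. pder i ^^ \<alpha> i) ys (gauss_test (\<lambda>_. 0) h x)
      = gauss_test (\<lambda>j. if j \<in> set ys then \<alpha> j else 0) h x" if "distinct ys" for ys
    using that
  proof (induction ys)
    case (Cons i ys)
    have "(\<lambda>j. if j \<in> set ys then \<alpha> j else 0)(i := \<alpha> i) = (\<lambda>j. if j \<in> set (i # ys) then \<alpha> j else 0)"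
      by auto
    then show ?case using Cons by (simp add: funpow_pder_gauss_test[OF h])
  qed simp
  from this[OF coordinates(1)] show ?thesis by (simp add: mderiv_def coordinates(2))
qed

lemma one_plus_sum_le_prod:
  fixes a :: "'i \<Rightarrow> real"
  assumes "finite I" "\<And>i. i \<in> I \<Longrightarrow> a i \<ge> 0"
  shows "1 + (\<Sum>i\<in>I. a i) \<le> (\<Prod>i\<in>I. 1 + a i)"
  using assms
proof (induction I)
  case (insert i I)
  have "1 + (\<Sum>j\<in>insert i I. a j) \<le> (1 + a i) * (1 + (\<Sum>j\<in>I. a j))"
    using insert mult_nonneg_nonneg[of "a i" "\<Sum>j\<in>I. a j"] by (simp add: algebra_simps sum_nonneg)
  also have "\<dots> \<le> (1 + a i) * (\<Prod>j\<in>I. 1 + a j)" using insert by (intro mult_left_mono) auto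
  finally show ?case using insert by simp
qed simp

text \<open>The Gaussian is a product over the coordinates, and so is a bound of the weight: 1 + |y|
  <= (1 + |x|) (1 + |y - x|), and the last factor is at most the product of the 1 + |z_i| with z =
  (y - x) / h, because h <= 1. This leaves one-dimensional bounds, uniform in x and h.\<close>

lemma gauss_test_bound:
  "\<exists>C\<ge>0. \<forall>h x y. \<forall>\<alpha>\<in>multi_indices_le j. 0 < h \<longrightarrow> h \<le> 1 \<longrightarrow>
    (1 + norm y) ^ j * cmod (gauss_test \<alpha> h x (y :: real^'n::finite)) \<le> C * (1 + norm x) ^ j / h ^ j"
proof -
  obtain C where C: "C \<ge> 0" "\<And>k t. k \<le> j \<Longrightarrow> (1 + \<bar>t\<bar>) ^ j * \<bar>gauss_deriv k t\<bar> \<le> C"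
    using gauss_deriv_bound[of j j] by blast
  have "(1 + norm y) ^ j * cmod (gauss_test \<alpha> h x y) \<le> C ^ CARD('n) * (1 + norm x) ^ j / h ^ j"
    if \<alpha>: "\<alpha> \<in> multi_indices_le j" and h: "0 < h" "h \<le> 1" for h and \<alpha> :: "'n \<Rightarrow> nat" and x y :: "real^'n"
  proof -
    define z where "z i = (y $ i - x $ i) / h" for i
    have \<alpha>j: "\<alpha> i \<le> j" for i
      using member_le_sum[of i UNIV \<alpha>] \<alpha> unfolding multi_indices_le_def by simp
    have "\<bar>(y - x) $ i\<bar> \<le> \<bar>z i\<bar>" for i
    proof -
      have "\<bar>(y - x) $ i\<bar> = h * \<bar>z i\<bar>" using h by (simp add: z_def abs_mult)
      also have "\<dots> \<le> 1 * \<bar>z i\<bar>" using h by (intro mult_right_mono) auto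
      finally show ?thesis by simp
    qed
    then have "norm (y - x) \<le> (\<Sum>i\<in>UNIV. \<bar>z i\<bar>)"
      using norm_le_l1_cart[of "y - x"] by (meson order_trans sum_mono)
    then have "1 + norm (y - x) \<le> (\<Prod>i\<in>UNIV. 1 + \<bar>z i\<bar>)"
      using one_plus_sum_le_prod[of UNIV "\<lambda>i. \<bar>z i\<bar>"] by simp
    moreover have "1 + norm y \<le> (1 + norm x) * (1 + norm (y - x))"
    proof -
      have "1 + norm y \<le> 1 + (norm x + norm (y - x))" using norm_triangle_ineq[of x "y - x"] by simp
      also have "\<dots> \<le> (1 + norm x) * (1 + norm (y - x))" by (simp add: algebra_simps)
      finally show ?thesis .
    qed
    ultimately have "1 + norm y \<le> (1 + norm x) * (\<Prod>i\<in>UNIV. 1 + \<bar>z i\<bar>)"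
      using mult_left_mono[of "1 + norm (y - x)" _ "1 + norm x"] by fastforce
    then have "(1 + norm y) ^ j \<le> (1 + norm x) ^ j * (\<Prod>i\<in>UNIV. (1 + \<bar>z i\<bar>) ^ j)"
      using power_mono[of "1 + norm y" "(1 + norm x) * (\<Prod>i\<in>UNIV. 1 + \<bar>z i\<bar>)" j]
      by (simp add: power_mult_distrib prod_power_distrib)
    moreover have "cmod (gauss_test \<alpha> h x y) = (\<Prod>i\<in>UNIV. \<bar>gauss_deriv (\<alpha> i) (z i)\<bar>) / h ^ sum \<alpha> UNIV"
      using h unfolding gauss_test_def norm_of_real z_def by (simp add: abs_prod prod_dividef power_sum)
    ultimately have "(1 + norm y) ^ j * cmod (gauss_test \<alpha> h x y)
        \<le> (1 + norm x) ^ j * (\<Prod>i\<in>UNIV. (1 + \<bar>z i\<bar>) ^ j) * ((\<Prod>i\<in>UNIV. \<bar>gauss_deriv (\<alpha> i) (z i)\<bar>) / h ^ sum \<alpha> UNIV)"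
      by (metis mult_right_mono norm_ge_zero)
    also have "\<dots> = (1 + norm x) ^ j * (\<Prod>i\<in>UNIV. (1 + \<bar>z i\<bar>) ^ j * \<bar>gauss_deriv (\<alpha> i) (z i)\<bar>) / h ^ sum \<alpha> UNIV"
      by (simp add: prod.distrib)
    also have "\<dots> \<le> (1 + norm x) ^ j * C ^ CARD('n) / h ^ j"
    proof (intro frac_le mult_left_mono mult_nonneg_nonneg)
      have "(\<Prod>i\<in>UNIV. (1 + \<bar>z i\<bar>) ^ j * \<bar>gauss_deriv (\<alpha> i) (z i)\<bar>) \<le> (\<Prod>i\<in>(UNIV :: 'n set). C)"
        using C(2) \<alpha>j by (intro prod_mono) auto
      then show "(\<Prod>i\<in>UNIV. (1 + \<bar>z i\<bar>) ^ j * \<bar>gauss_deriv (\<alpha> i) (z i)\<bar>) \<le> C ^ CARD('n)" by simp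
      show "h ^ j \<le> h ^ sum \<alpha> UNIV"
        using \<alpha> h unfolding multi_indices_le_def by (intro power_decreasing) auto
    qed (use C(1) h in auto)
    finally show ?thesis by (simp add: mult.commute)
  qed
  then show ?thesis using C(1) by (intro exI[of _ "C ^ CARD('n)"]) auto
qed

text \<open>The growth is by fixed powers of 1/h and 1 + |x|, so Gaussians with h a power of eps and
  with moderate centres form a net in \<open>moderate_S\<close>.\<close>

lemma schwartz_seminorm_gauss_test:
  "\<exists>C\<ge>0. \<forall>h x. 0 < h \<longrightarrow> h \<le> 1 \<longrightarrow>
    schwartz_seminorm j (gauss_test (\<lambda>_. 0) h (x :: real^'n::finite)) \<le> ennreal (C * (1 + norm x) ^ j / h ^ j)"
proof -
  obtain C where C: "C \<ge> 0" "\<And>h x y \<alpha>. \<alpha> \<in> multi_indices_le j \<Longrightarrow> 0 < h \<Longrightarrow> h \<le> 1 \<Longrightarrow>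
      (1 + norm y) ^ j * cmod (gauss_test \<alpha> h x (y :: real^'n)) \<le> C * (1 + norm x) ^ j / h ^ j"
    using gauss_test_bound by blast
  then show ?thesis unfolding schwartz_seminorm_def
    by (intro exI[of _ C]) (auto simp: wsup_le_iff mderiv_gauss_test)
qed

lemma gauss_test_schwartz:
  assumes "0 < h" "h \<le> 1"
  shows "gauss_test (\<lambda>_. 0) h x \<in> schwartz"
proof -
  have "schwartz_seminorm j (gauss_test (\<lambda>_. 0) h x) < \<infinity>" for j
    using schwartz_seminorm_gauss_test[of j, where 'n = 'a] assms le_less_trans[OF _ ennreal_less_top] by fastforce
  then show ?thesis using smooth_gauss_test assms unfolding schwartz_def by blast
qed

section \<open>Integrals against concentrated Gaussians\<close>

lemma weighted_bound_integral:
  fixes F :: "real^'n::finite \<Rightarrow> complex"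
  assumes F: "continuous_on UNIV F" and C: "\<And>z. (1 + norm z) ^ (CARD('n) + 2) * cmod (F z) \<le> C"
  shows "integrable lborel F"
    "cmod (LINT z|lborel. F z) \<le> C * (LINT z|lborel. 1 / (1 + norm (z :: real^'n)) ^ (CARD('n) + 2))"
proof -
  let ?w = "\<lambda>z :: real^'n. 1 / (1 + norm z) ^ (CARD('n) + 2)"
  have le: "cmod (F z) \<le> C * ?w z" for z
  proof -
    have "(1 + norm z) ^ (CARD('n) + 2) > 0" by (intro zero_less_power add_pos_nonneg) auto
    then show ?thesis using C[of z] by (simp add: field_simps)
  qed
  have w: "integrable lborel (\<lambda>z. C * ?w z)" using integrable_inverse_power_norm by (intro integrable_mult_right)
  show i: "integrable lborel F"
  proof (rule Bochner_Integration.integrable_bound[OF w])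
    show "AE z in lborel. cmod (F z) \<le> norm (C * ?w z)"
      unfolding real_norm_def by (intro always_eventually allI order_trans[OF le] abs_ge_self)
  qed (use F in \<open>auto intro: borel_measurable_continuous_onI\<close>)
  have "cmod (LINT z|lborel. F z) \<le> (LINT z|lborel. cmod (F z))" by (rule integral_norm_bound)
  also have "\<dots> \<le> (LINT z|lborel. C * ?w z)" using i w le by (intro integral_mono) auto
  also have "\<dots> = C * (LINT z|lborel. ?w z)" by (rule integral_mult_right_zero)
  finally show "cmod (LINT z|lborel. F z) \<le> C * (LINT z|lborel. ?w z)" .
qed

lemma integral_affine:
  fixes f :: "real^'n::finite \<Rightarrow> complex"
  assumes "continuous_on UNIV f" "h > 0"
  shows "(LINT y|lborel. f y) = of_real (h ^ CARD('n)) * (LINT z|lborel. f (x + h *\<^sub>R z))"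
proof -
  have f: "f \<in> borel_measurable borel" using assms(1) by (rule borel_measurable_continuous_onI)
  have "(LINT y|lborel. f y)
      = (LINT y|density (distr lborel borel (\<lambda>z. x + h *\<^sub>R z)) (\<lambda>_. ennreal (h ^ CARD('n))). f y)"
    using lborel_affine[of h x] assms(2) by simp
  also have "\<dots> = (LINT y|distr lborel borel (\<lambda>z. x + h *\<^sub>R z). h ^ CARD('n) *\<^sub>R f y)"
    using f assms(2) by (intro integral_density) auto
  also have "\<dots> = (LINT z|lborel. h ^ CARD('n) *\<^sub>R f (x + h *\<^sub>R z))"
    using f by (intro integral_distr) auto
  finally show ?thesis by (simp add: scaleR_conv_of_real)
qed

lemma gauss_test_affine: "h > 0 \<Longrightarrow> gauss_test (\<lambda>_. 0) h x (x + h *\<^sub>R z) = gauss_test (\<lambda>_. 0) 1 0 z"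
  by (simp add: gauss_test_def)

text \<open>Positivity is all that the concentration argument uses, so the integral is not computed:
  the integrand is strictly positive, and integral 0 would make the whole space a null set.\<close>

lemma gauss_test_integral_pos:
  "\<exists>c>0. (LINT z|lborel. gauss_test (\<lambda>_. 0) 1 (0 :: real^'n::finite) z) = of_real c"
proof -
  define F :: "real^'n \<Rightarrow> real" where "F z = (\<Prod>i\<in>UNIV. gauss_deriv 0 (z $ i))" for z
  have G: "gauss_test (\<lambda>_. 0) 1 0 = (\<lambda>z. complex_of_real (F z))"
    by (simp add: gauss_test_def F_def fun_eq_iff)
  have pos: "F z > 0" for z unfolding F_def by (intro prod_pos) (simp add: gauss_deriv_def)
  obtain C where C: "\<And>h x y. 0 < h \<Longrightarrow> h \<le> 1 \<Longrightarrow> (1 + norm y) ^ (CARD('n) + 2) * cmod (gauss_test (\<lambda>_. 0) h x (y :: real^'n))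
      \<le> C * (1 + norm x) ^ (CARD('n) + 2) / h ^ (CARD('n) + 2)"
    using gauss_test_bound[of "CARD('n) + 2", where 'n = 'n] zero_index_le[of "CARD('n) + 2"] by blast
  have "integrable lborel (\<lambda>z. complex_of_real (F z))"
    unfolding G[symmetric] using C[of 1 _ 0]
    by (intro weighted_bound_integral(1)[where C = C] continuous_gauss_test) auto
  then have i: "integrable lborel F" by (simp add: complex_of_real_integrable_eq)
  have "integral\<^sup>L lborel F \<noteq> 0"
  proof
    assume "integral\<^sup>L lborel F = 0"
    then have "AE z in lborel. F z = 0"
      using integral_nonneg_eq_0_iff_AE[OF i] pos by (auto intro: less_imp_le)
    then have "AE z in (lborel :: (real^'n) measure). False"
      by (rule AE_mp) (use pos in \<open>auto intro!: AE_I2 simp: less_le\<close>)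
    then obtain N where "{z \<in> space lborel. \<not> False} \<subseteq> N" "emeasure (lborel :: (real^'n) measure) N = 0"
      by (rule AE_E)
    then show False by (simp add: top.extremum_unique)
  qed
  moreover have "integral\<^sup>L lborel F \<ge> 0" using pos by (intro integral_nonneg_AE) (auto intro: less_imp_le)
  ultimately show ?thesis unfolding G by (intro exI[of _ "integral\<^sup>L lborel F"]) simp
qed

text \<open>After the substitution y = x + h z the Gaussian depends neither on h nor on x. Replacing
  f (x + h z) by f x leaves c f x, with c the integral of the Gaussian, and an error that carries a
  factor h from the Lipschitz bound. \<open>c\<close> and \<open>J\<close> are fixed before
  \<open>f\<close>, \<open>D\<close>, \<open>h\<close> and \<open>x\<close>, which will all vary
  with eps.\<close>

lemma gauss_test_concentrates:
  fixes L :: nat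
  obtains c J where "c > 0" "J \<ge> 0"
    "\<And>(f :: real^'n::finite \<Rightarrow> complex) (D::real) (h::real) (x::real^'n). f \<in> slowly_increasing \<Longrightarrow> D \<ge> 0 \<Longrightarrow>
      (\<And>i y. cmod (pder i f y) \<le> D * (1 + norm y) ^ L) \<Longrightarrow> 0 < h \<Longrightarrow> h \<le> 1 \<Longrightarrow>
      cmod (LINT y|lborel. f y * gauss_test (\<lambda>_. 0) h x y)
        \<ge> h ^ CARD('n) * (c * cmod (f x) - h * D * (1 + norm x) ^ L * J)"
proof -
  let ?K = "CARD('n) + 2"
  let ?G = "gauss_test (\<lambda>_. 0) 1 (0 :: real^'n)"
  define I where "I = (LINT z|lborel. 1 / (1 + norm (z :: real^'n)) ^ ?K)"
  have I: "I \<ge> 0" unfolding I_def by (intro integral_nonneg_AE) auto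
  obtain c where c: "c > 0" "(LINT z|lborel. ?G z) = of_real c" using gauss_test_integral_pos by blast
  have "\<exists>B\<ge>0. \<forall>y. (1 + norm y) ^ j * cmod (?G y) \<le> B" for j
  proof -
    obtain B where "B \<ge> 0" "\<And>h x y. 0 < h \<Longrightarrow> h \<le> 1 \<Longrightarrow>
        (1 + norm y) ^ j * cmod (gauss_test (\<lambda>_. 0) h x (y :: real^'n)) \<le> B * (1 + norm x) ^ j / h ^ j"
      using gauss_test_bound[of j, where 'n = 'n] zero_index_le[of j] by blast
    from this(1) this(2)[of 1 _ 0] show ?thesis by (intro exI[of _ B]) auto
  qed
  \<comment> \<open>In the exponent of the second bound, \<open>L\<close> pays for the growth of the
    derivatives of f, 1 for the factor |z| of the Lipschitz bound, and n + 2 for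
    integrability.\<close>
  then obtain B0 B where B0: "B0 \<ge> 0" "\<And>y. (1 + norm y) ^ ?K * cmod (?G y) \<le> B0"
      and B: "B \<ge> 0" "\<And>y. (1 + norm y) ^ (L + 1 + ?K) * cmod (?G y) \<le> B" by metis
  have iG: "integrable lborel ?G" by (rule weighted_bound_integral(1)[OF continuous_gauss_test B0(2)]) simp
  show ?thesis
  proof (rule that[of c "CARD('n) * B * I"])
    fix f :: "real^'n \<Rightarrow> complex" and D h :: real and x :: "real^'n"
    assume f: "f \<in> slowly_increasing" and D: "D \<ge> 0"
      and bd: "\<And>i y. cmod (pder i f y) \<le> D * (1 + norm y) ^ L" and h: "0 < h" "h \<le> 1"
    have sm: "smooth f" using f by (rule slowly_increasing_smooth)
    note cont = smooth_continuous[OF sm]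
    have cf: "continuous_on UNIV (\<lambda>z. f (x + h *\<^sub>R z))"
      by (intro continuous_on_compose2[OF cont] continuous_intros) auto
    let ?E = "\<lambda>z. (f (x + h *\<^sub>R z) - f x) * ?G z"
    let ?M = "CARD('n) * h * D * (1 + norm x) ^ L * B"
    have cE: "continuous_on UNIV ?E" by (intro continuous_intros cf continuous_gauss_test) auto
    have bE: "(1 + norm z) ^ ?K * cmod (?E z) \<le> ?M" for z
    proof -
      have "cmod (f (x + h *\<^sub>R z) - f x) \<le> CARD('n) * norm (x + h *\<^sub>R z - x) * (D * ((1 + norm x) * (1 + norm z)) ^ L)"
      proof (rule pder_bound_lipschitz[OF sm])
        fix i y assume y: "norm (y - x) \<le> norm (x + h *\<^sub>R z - x)"
        also have "\<dots> \<le> 1 * norm z" using h mult_right_mono[OF h(2), of "norm z"] by simp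
        finally have "1 + norm y \<le> 1 + (norm x + norm z)" using norm_triangle_ineq[of x "y - x"] by simp
        also have "\<dots> \<le> (1 + norm x) * (1 + norm z)" by (simp add: algebra_simps)
        finally have "D * (1 + norm y) ^ L \<le> D * ((1 + norm x) * (1 + norm z)) ^ L"
          using D by (intro mult_left_mono power_mono) auto
        then show "cmod (pder i f y) \<le> D * ((1 + norm x) * (1 + norm z)) ^ L" using bd[of i y] by linarith
      qed
      also have "\<dots> = CARD('n) * h * D * (1 + norm x) ^ L * (norm z * (1 + norm z) ^ L)"
        using h by (simp add: power_mult_distrib mult_ac)
      also have "\<dots> \<le> CARD('n) * h * D * (1 + norm x) ^ L * ((1 + norm z) * (1 + norm z) ^ L)"
        using h D by (intro mult_left_mono mult_right_mono) auto
      finally have "(1 + norm z) ^ ?K * cmod (?E z)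
          \<le> (1 + norm z) ^ ?K * (CARD('n) * h * D * (1 + norm x) ^ L * ((1 + norm z) * (1 + norm z) ^ L) * cmod (?G z))"
        unfolding norm_mult by (intro mult_left_mono mult_right_mono) auto
      also have "\<dots> = CARD('n) * h * D * (1 + norm x) ^ L * ((1 + norm z) ^ (L + 1 + ?K) * cmod (?G z))"
        by (simp add: power_add mult_ac)
      also have "\<dots> \<le> ?M" using h D by (intro mult_left_mono B(2)) auto
      finally show ?thesis .
    qed
    have iE: "integrable lborel ?E" and lE: "cmod (LINT z|lborel. ?E z) \<le> ?M * I"
      unfolding I_def by (rule weighted_bound_integral[OF cE bE])+
    have "(LINT y|lborel. f y * gauss_test (\<lambda>_. 0) h x y)
        = of_real (h ^ CARD('n)) * (LINT z|lborel. f (x + h *\<^sub>R z) * gauss_test (\<lambda>_. 0) h x (x + h *\<^sub>R z))"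
      using cont continuous_gauss_test[OF h(1)] h(1) by (intro integral_affine continuous_intros)
    also have "(LINT z|lborel. f (x + h *\<^sub>R z) * gauss_test (\<lambda>_. 0) h x (x + h *\<^sub>R z))
        = (LINT z|lborel. ?E z + f x * ?G z)"
      by (simp add: gauss_test_affine[OF h(1)] algebra_simps)
    also have "\<dots> = (LINT z|lborel. ?E z) + f x * of_real c"
      using iE iG c(2) by simp
    finally have eq: "cmod (LINT y|lborel. f y * gauss_test (\<lambda>_. 0) h x y)
        = h ^ CARD('n) * cmod ((LINT z|lborel. ?E z) + f x * of_real c)"
      using h by (simp add: norm_mult norm_power)
    have "cmod (f x * of_real c) - cmod (LINT z|lborel. ?E z) \<le> cmod ((LINT z|lborel. ?E z) + f x * of_real c)"
      using norm_diff_ineq[of "f x * of_real c" "LINT z|lborel. ?E z"] by (simp add: add.commute)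
    then have "c * cmod (f x) - ?M * I \<le> cmod ((LINT z|lborel. ?E z) + f x * of_real c)"
      using lE c(1) by (simp add: norm_mult mult.commute)
    then have "h ^ CARD('n) * (c * cmod (f x) - ?M * I)
        \<le> h ^ CARD('n) * cmod ((LINT z|lborel. ?E z) + f x * of_real c)"
      using h by (intro mult_left_mono) auto
    then show "cmod (LINT y|lborel. f y * gauss_test (\<lambda>_. 0) h x y)
        \<ge> h ^ CARD('n) * (c * cmod (f x) - h * D * (1 + norm x) ^ L * (CARD('n) * B * I))"
      unfolding eq by (simp add: mult_ac)
  qed (use c B I in auto)
qed

section \<open>Nets annihilated by all Schwartz nets\<close>

lemma pder_eq_mderiv:
  fixes i :: "'n::finite"
  shows "pder i f = mderiv (\<lambda>j. if j = i then 1 else 0) f"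
proof -
  let ?\<beta> = "\<lambda>j. if j = i then 1 else 0 :: nat"
  obtain zs ys where split: "coordinates = zs @ i # ys"
    using split_list[of i coordinates] coordinates(2) by auto
  then have "distinct (zs @ i # ys)" using coordinates(1) by metis
  then have "i \<notin> set zs" "i \<notin> set ys" by auto
  then have "foldr (\<lambda>j. pder j ^^ ?\<beta> j) zs h = h" "foldr (\<lambda>j. pder j ^^ ?\<beta> j) ys h = h" for h
    by (auto intro!: foldr_funpow_zero)
  then show ?thesis unfolding mderiv_def split by simp
qed

text \<open>If the zero-order estimate fails for \<open>u\<close> at order \<open>q\<close>, the points \<open>x\<^sub>\<epsilon>\<close> of failure are moderate,
  and testing against Gaussians concentrated at \<open>x\<^sub>\<epsilon>\<close> at a scale \<open>\<epsilon>\<^sup>P\<close> with \<open>P\<close> large gives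
  integrals which are not negligible.\<close>

lemma zero_order_negligible_if_annihilating:
  fixes u :: "real \<Rightarrow> real^'n::finite \<Rightarrow> complex"
  assumes u: "u \<in> moderate_tau" and ann: "\<And>v. v \<in> moderate_S \<Longrightarrow> net_integral u v \<in> negligible_num"
  shows "zero_order_negligible u"
proof -
  \<comment> \<open>Order 1, because concentration needs the first derivatives of u besides its
    values.\<close>
  obtain N0 where uN: "u \<in> moderate_mN 1 N0" using u unfolding moderate_tau_eq by blast
  note slow = moderate_mN_slow[OF uN]
  obtain M :: nat and C where C: "C \<ge> 0" and C_bound: "\<forall>\<^sub>F \<epsilon> in at_right 0. \<forall>x. \<forall>\<alpha>\<in>multi_indices_le 1.
      cmod (mderiv \<alpha> (u \<epsilon>) x) \<le> C * \<epsilon> powr (- real M) * (1 + norm x) ^ N0"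
    using uN unfolding moderate_mN_def tempered_seminorm_def tempered_bigo_iff by blast
  have bound0: "\<forall>\<^sub>F \<epsilon> in at_right 0. \<forall>x. cmod (u \<epsilon> x) \<le> C * \<epsilon> powr (- real M) * (1 + norm x) ^ N0"
    using C_bound
  proof eventually_elim
    case (elim \<epsilon>)
    then show ?case using zero_index_le[of 1, where 'a = 'n] mderiv_zero_index by metis
  qed
  have "(\<lambda>j. if j = i then 1 else 0) \<in> multi_indices_le 1" for i :: 'n
    by (simp add: multi_indices_le_def)
  then have bound1: "\<forall>\<^sub>F \<epsilon> in at_right 0. \<forall>i x. cmod (pder i (u \<epsilon>) x) \<le> C * \<epsilon> powr (- real M) * (1 + norm x) ^ N0"
    using C_bound unfolding pder_eq_mderiv by (auto elim!: eventually_mono)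
  have "eps_bigo (\<lambda>\<epsilon>. wsup (tempered_weight (N0 + 1)) {\<lambda>_. 0} (u \<epsilon>)) (real q)" for q
  proof (rule ccontr)
    assume not: "\<not> eps_bigo (\<lambda>\<epsilon>. wsup (tempered_weight (N0 + 1)) {\<lambda>_. 0} (u \<epsilon>)) (real q)"
    \<comment> \<open>The estimate fails for every constant; the constant 1 is enough to obtain bad
      points at parameters arbitrarily close to 0.\<close>
    define bad where "bad \<epsilon> x \<longleftrightarrow> \<epsilon> powr real q * (1 + norm x) ^ (N0 + 1) < cmod (u \<epsilon> x)" for \<epsilon> x
    have bad_ex: "\<exists>\<^sub>F \<epsilon> in at_right 0. \<exists>x. bad \<epsilon> x"
    proof (rule ccontr)
      assume "\<not> ?thesis"
      then have "\<forall>\<^sub>F \<epsilon> in at_right 0. \<forall>x. cmod (u \<epsilon> x) \<le> 1 * \<epsilon> powr real q * (1 + norm x) ^ (N0 + 1)"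
        unfolding not_frequently by eventually_elim (auto simp: bad_def not_less)
      then have "eps_bigo (\<lambda>\<epsilon>. wsup (tempered_weight (N0 + 1)) {\<lambda>_. 0} (u \<epsilon>)) (real q)"
        unfolding tempered_bigo_iff by (intro exI[of _ 1]) simp
      then show False using not by simp
    qed
    \<comment> \<open>Where no bad point exists the centre is 0, so that the test net is defined and
      moderate at all parameters.\<close>
    define p where "p \<epsilon> = (if \<exists>x. bad \<epsilon> x then SOME x. bad \<epsilon> x else 0)" for \<epsilon>
    have p_bad: "bad \<epsilon> (p \<epsilon>)" if "\<exists>x. bad \<epsilon> x" for \<epsilon>
      using someI_ex[OF that] that by (simp add: p_def)
    \<comment> \<open>The maximum with 1 covers the centre 0.\<close>
    define C1 where "C1 = max C 1"
    let ?r = "real M + real q"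
    have power_decay: "(\<epsilon> powr (- real M - real q)) ^ k = \<epsilon> powr (- (?r * real k))" if "\<epsilon> > 0" for \<epsilon> k
    proof -
      have "(- real M - real q) * real k = - (?r * real k)" by (simp add: algebra_simps)
      then show ?thesis using that by (simp only: powr_powr powr_realpow[symmetric] powr_gt_zero)
    qed
    have p_moderate: "\<forall>\<^sub>F \<epsilon> in at_right 0. 1 + norm (p \<epsilon>) \<le> C1 * \<epsilon> powr (- ?r)"
      using bound0 eventually_eps
    proof eventually_elim
      case (elim \<epsilon>)
      show ?case
      proof (cases "\<exists>x. bad \<epsilon> x")
        case True
        have pos: "(1 + norm (p \<epsilon>)) ^ N0 > 0" by (intro zero_less_power add_pos_nonneg) auto
        \<comment> \<open>The extra power of 1 + |p eps| survives the comparison with the a priori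
          bound and is thereby bounded itself.\<close>
        have "\<epsilon> powr real q * (1 + norm (p \<epsilon>)) ^ (N0 + 1) \<le> C * \<epsilon> powr (- real M) * (1 + norm (p \<epsilon>)) ^ N0"
          using p_bad[OF True] elim unfolding bad_def by (meson less_imp_le order_trans)
        then have "\<epsilon> powr real q * (1 + norm (p \<epsilon>)) \<le> C * \<epsilon> powr (- real M)"
          using pos by (simp add: mult.assoc[symmetric])
        then have "\<epsilon> powr (- real q) * (\<epsilon> powr real q * (1 + norm (p \<epsilon>))) \<le> \<epsilon> powr (- real q) * (C * \<epsilon> powr (- real M))"
          by (intro mult_left_mono) auto
        then have "1 + norm (p \<epsilon>) \<le> C * \<epsilon> powr (- ?r)"
        proof -
          have "\<epsilon> powr (- real q) * (\<epsilon> powr real q * (1 + norm (p \<epsilon>))) = 1 + norm (p \<epsilon>)"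
            using elim by (simp add: mult.assoc[symmetric] powr_add[symmetric])
          moreover have "\<epsilon> powr (- real q) * (C * \<epsilon> powr (- real M)) = C * \<epsilon> powr (- ?r)"
          proof -
            have "- ?r = - real M + - real q" by simp
            then show ?thesis by (simp only: powr_add mult_ac)
          qed
          ultimately show ?thesis using \<open>\<epsilon> powr (- real q) * _ \<le> _\<close> by metis
        qed
        also have "\<dots> \<le> C1 * \<epsilon> powr (- ?r)" by (intro mult_right_mono) (auto simp: C1_def)
        finally show ?thesis .
      next
        case False
        have "1 \<le> \<epsilon> powr (- ?r)" using elim powr_mono'[of "- ?r" 0 \<epsilon>] by simp
        then have "1 * 1 \<le> C1 * \<epsilon> powr (- ?r)" by (intro mult_mono) (auto simp: C1_def)
        then show ?thesis using False by (simp add: p_def)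
      qed
    qed
    \<comment> \<open>The concentration error is of order eps^P eps^(-M) eps^(-(M + q) N0): scale,
      derivative bound, weight at the centre. This \<open>P\<close> makes it eps^(q + 1), one order
      below the main term of size at least c eps^q.\<close>
    define P where "P = M + (M + q) * N0 + q + 1"
    define v where "v \<epsilon> = gauss_test (\<lambda>_. 0) (\<epsilon> ^ P) (p \<epsilon>)" for \<epsilon>
    have v: "v \<in> moderate_S"
    proof -
      have "v \<in> nets_in schwartz"
        unfolding nets_in_def v_def by (auto intro!: gauss_test_schwartz power_le_one)
      moreover have "\<exists>K::nat. eps_bigo (\<lambda>\<epsilon>. schwartz_seminorm j (v \<epsilon>)) (- real K)" for j
      proof (rule bigo_nat_ex)
        obtain B where B: "B \<ge> 0" "\<And>h x. 0 < h \<Longrightarrow> h \<le> 1 \<Longrightarrow>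
            schwartz_seminorm j (gauss_test (\<lambda>_. 0) h (x :: real^'n)) \<le> ennreal (B * (1 + norm x) ^ j / h ^ j)"
          using schwartz_seminorm_gauss_test by blast
        show "eps_bigo (\<lambda>\<epsilon>. schwartz_seminorm j (v \<epsilon>)) (- (?r * real j) - real (P * j))"
          unfolding eps_bigo_def
        proof (rule exI[of _ "B * C1 ^ j"], use p_moderate eventually_eps in eventually_elim)
          case (elim \<epsilon>)
          have "(1 + norm (p \<epsilon>)) ^ j \<le> (C1 * \<epsilon> powr (- ?r)) ^ j" using elim by (intro power_mono) auto
          also have "\<dots> = C1 ^ j * \<epsilon> powr (- (?r * real j))"
            using elim by (simp add: power_mult_distrib power_decay)
          finally have "B * (1 + norm (p \<epsilon>)) ^ j / (\<epsilon> ^ P) ^ j \<le> B * (C1 ^ j * \<epsilon> powr (- (?r * real j))) / (\<epsilon> ^ P) ^ j"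
            using B(1) elim by (intro divide_right_mono mult_left_mono) auto
          also have "\<dots> = B * C1 ^ j * \<epsilon> powr (- (?r * real j) - real (P * j))"
          proof -
            have "(\<epsilon> ^ P) ^ j = \<epsilon> powr real (P * j)" using elim by (simp only: powr_realpow power_mult)
            then show ?thesis by (simp only: powr_diff) simp
          qed
          finally have le: "B * (1 + norm (p \<epsilon>)) ^ j / (\<epsilon> ^ P) ^ j
              \<le> B * C1 ^ j * \<epsilon> powr (- (?r * real j) - real (P * j))" .
          have "schwartz_seminorm j (v \<epsilon>) \<le> ennreal (B * (1 + norm (p \<epsilon>)) ^ j / (\<epsilon> ^ P) ^ j)"
            unfolding v_def using elim by (intro B(2)) (auto intro: power_le_one)
          also have "\<dots> \<le> ennreal (B * C1 ^ j * \<epsilon> powr (- (?r * real j) - real (P * j)))"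
            by (rule ennreal_leI[OF le])
          finally show ?case .
        qed
      qed
      ultimately show ?thesis unfolding moderate_S_def by blast
    qed
    obtain c J where cJ: "c > 0" "J \<ge> 0" and conc: "\<And>(f :: real^'n \<Rightarrow> complex) (D::real) (h::real) (x::real^'n). f \<in> slowly_increasing \<Longrightarrow> D \<ge> 0 \<Longrightarrow>
        (\<And>i y. cmod (pder i f y) \<le> D * (1 + norm y) ^ N0) \<Longrightarrow> 0 < h \<Longrightarrow> h \<le> 1 \<Longrightarrow>
        cmod (LINT y|lborel. f y * gauss_test (\<lambda>_. 0) h x y)
          \<ge> h ^ CARD('n) * (c * cmod (f x) - h * D * (1 + norm x) ^ N0 * J)"
      using gauss_test_concentrates[of N0, where 'n = 'n] by blast
    define K where "K = C * C1 ^ N0 * J"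
    have K: "K \<ge> 0" using C cJ by (simp add: K_def C1_def)
    let ?n = "CARD('n)"
    \<comment> \<open>One order better than the lower bound h^n eps^q with h = eps^P, so that the
      two must collide.\<close>
    have "eps_bigo (\<lambda>\<epsilon>. ennreal (cmod (net_integral u v \<epsilon>))) (real (P * ?n) + real q + 1)"
      using ann[OF v] by (simp add: negligible_num_all)
    then obtain E where E: "E \<ge> 0" "\<forall>\<^sub>F \<epsilon> in at_right 0.
        ennreal (cmod (net_integral u v \<epsilon>)) \<le> ennreal (E * \<epsilon> powr (real (P * ?n) + real q + 1))"
      by (rule eps_bigo_obtain)
    \<comment> \<open>Below this threshold (K + E + 1) eps < c, whereas comparing the two bounds of
      the integral gives c <= (K + E) eps.\<close>
    have small: "\<forall>\<^sub>F \<epsilon> in at_right 0. \<epsilon> < c / (K + E + 1)"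
      unfolding eventually_at_right_field using cJ K E(1) by (intro exI[of _ "c / (K + E + 1)"]) auto
    \<comment> \<open>Bad parameters occur only frequently; intersecting them with estimates that
      hold eventually keeps this.\<close>
    have "\<exists>\<^sub>F \<epsilon> in at_right (0::real). False"
      using frequently_eventually_frequently[OF bad_ex
          eventually_conj[OF bound1 eventually_conj[OF p_moderate eventually_conj[OF E(2) eventually_conj[OF small eventually_eps]]]]]
    proof (rule frequently_elim1)
      fix \<epsilon> :: real
      assume "(\<exists>x. bad \<epsilon> x) \<and> (\<forall>i x. cmod (pder i (u \<epsilon>) x) \<le> C * \<epsilon> powr (- real M) * (1 + norm x) ^ N0)
        \<and> 1 + norm (p \<epsilon>) \<le> C1 * \<epsilon> powr (- ?r)
        \<and> ennreal (cmod (net_integral u v \<epsilon>)) \<le> ennreal (E * \<epsilon> powr (real (P * ?n) + real q + 1))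
        \<and> \<epsilon> < c / (K + E + 1) \<and> 0 < \<epsilon> \<and> \<epsilon> \<le> 1"
      then have bad: "\<exists>x. bad \<epsilon> x" and b1: "\<And>i x. cmod (pder i (u \<epsilon>) x) \<le> C * \<epsilon> powr (- real M) * (1 + norm x) ^ N0"
        and pm: "1 + norm (p \<epsilon>) \<le> C1 * \<epsilon> powr (- ?r)"
        and int: "ennreal (cmod (net_integral u v \<epsilon>)) \<le> ennreal (E * \<epsilon> powr (real (P * ?n) + real q + 1))"
        and sm: "\<epsilon> < c / (K + E + 1)" and \<epsilon>: "0 < \<epsilon>" "\<epsilon> \<le> 1" by auto
      let ?x = "p \<epsilon>" and ?h = "\<epsilon> ^ P"
      have h: "0 < ?h" "?h \<le> 1" using \<epsilon> by (auto intro: power_le_one)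
      have "(1 + norm ?x) ^ N0 \<le> (C1 * \<epsilon> powr (- ?r)) ^ N0" using pm by (intro power_mono) auto
      also have "\<dots> = C1 ^ N0 * \<epsilon> powr (- (?r * real N0))"
        using \<epsilon> by (simp add: power_mult_distrib power_decay)
      finally have pN: "(1 + norm ?x) ^ N0 \<le> C1 ^ N0 * \<epsilon> powr (- (?r * real N0))" .
      have hP: "?h = \<epsilon> powr real P" using \<epsilon> by (simp add: powr_realpow)
      have "?h * (C * \<epsilon> powr (- real M)) * (1 + norm ?x) ^ N0 * J
          \<le> ?h * (C * \<epsilon> powr (- real M)) * (C1 ^ N0 * \<epsilon> powr (- (?r * real N0))) * J"
        using C cJ \<epsilon> by (intro mult_right_mono mult_left_mono pN) auto
      also have "\<dots> = K * (\<epsilon> powr real P * \<epsilon> powr (- real M) * \<epsilon> powr (- (?r * real N0)))"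
        by (simp add: K_def hP mult_ac)
      also have "\<epsilon> powr real P * \<epsilon> powr (- real M) * \<epsilon> powr (- (?r * real N0)) = \<epsilon> powr (real q + 1)"
        unfolding powr_add[symmetric] by (rule arg_cong[of _ _ "(powr) \<epsilon>"]) (simp add: P_def algebra_simps)
      finally have err: "?h * (C * \<epsilon> powr (- real M)) * (1 + norm ?x) ^ N0 * J \<le> K * \<epsilon> powr (real q + 1)" .
      have "\<epsilon> powr real q * 1 \<le> \<epsilon> powr real q * (1 + norm ?x) ^ (N0 + 1)"
        by (intro mult_left_mono one_le_power) auto
      then have lower: "c * \<epsilon> powr real q \<le> c * cmod (u \<epsilon> ?x)"
        using p_bad[OF bad] cJ unfolding bad_def by (intro mult_left_mono) auto
      have "?h ^ ?n * (c * \<epsilon> powr real q - K * \<epsilon> powr (real q + 1))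
          \<le> ?h ^ ?n * (c * cmod (u \<epsilon> ?x) - ?h * (C * \<epsilon> powr (- real M)) * (1 + norm ?x) ^ N0 * J)"
        using h by (intro mult_left_mono[OF diff_mono[OF lower err]]) auto
      also have "\<dots> \<le> cmod (net_integral u v \<epsilon>)"
        unfolding net_integral_def v_def
        using nets_in_eps[OF slow \<epsilon>] C b1 h by (intro conc) auto
      also have "\<dots> \<le> E * \<epsilon> powr (real (P * ?n) + real q + 1)"
        using int E(1) by (simp add: ennreal_le_iff)
      finally have main: "?h ^ ?n * (c * \<epsilon> powr real q - K * \<epsilon> powr (real q + 1))
          \<le> E * \<epsilon> powr (real (P * ?n) + real q + 1)" .
      have e1: "?h ^ ?n = \<epsilon> powr real (P * ?n)" using \<epsilon> by (simp only: powr_realpow power_mult)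
      have e2: "\<epsilon> powr (a + 1) = \<epsilon> powr a * \<epsilon>" for a using \<epsilon> by (simp add: powr_add)
      have "(\<epsilon> powr real (P * ?n) * \<epsilon> powr real q) * (c - K * \<epsilon>)
          = \<epsilon> powr real (P * ?n) * (c * \<epsilon> powr real q - K * (\<epsilon> powr real q * \<epsilon>))"
        by (simp only: right_diff_distrib left_diff_distrib mult_ac)
      also have "\<dots> \<le> E * (\<epsilon> powr (real (P * ?n) + real q) * \<epsilon>)" using main unfolding e1 e2 .
      also have "\<dots> = (\<epsilon> powr real (P * ?n) * \<epsilon> powr real q) * (E * \<epsilon>)"
        by (simp only: powr_add mult_ac)
      finally have "(\<epsilon> powr real (P * ?n) * \<epsilon> powr real q) * (c - K * \<epsilon>)
          \<le> (\<epsilon> powr real (P * ?n) * \<epsilon> powr real q) * (E * \<epsilon>)" .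
      moreover have "\<epsilon> powr real (P * ?n) * \<epsilon> powr real q > 0" using \<epsilon> by simp
      ultimately have "c - K * \<epsilon> \<le> E * \<epsilon>" by (rule mult_left_le_imp_le)
      moreover have "(K + E + 1) * \<epsilon> < c" using sm K E(1) by (simp add: field_simps)
      ultimately show False using \<epsilon> by (simp add: algebra_simps)
    qed
    then show False by simp
  qed
  then show ?thesis by blast
qed

text \<open>By linearity a representative of u - w annihilates every net in
  \<open>moderate_S\<close>; it is then negligible at order zero, and hence at all orders.\<close>

lemma inj_pairing: "inj (pairing :: 'n::finite G_tau \<Rightarrow> 'n G_S \<Rightarrow> gcomplex)"
proof (rule injI)
  fix u w :: "'n G_tau" assume eq: "pairing u = pairing w"
  let ?a = "rep_G_tau (u - w)"
  obtain N where N: "?a \<in> moderate_mN 0 N" using moderate_tau_mN[OF rep_G_tau(1)] .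
  have "net_integral ?a v \<in> negligible_num" if v: "v \<in> moderate_S" for v
  proof -
    have "abs_gcomplex (net_integral ?a v) = pairing (u - w) (abs_G_S v)"
      using pairing_abs[OF rep_G_tau(1) v, of "u - w"] by (simp add: rep_G_tau(2))
    also have "\<dots> = abs_gcomplex 0" by (simp add: pairing_diff_left eq zero_gcomplex.abs_eq)
    finally show ?thesis
      using abs_gcomplex_eqD[OF net_integral_moderate[OF N v] moderate_num_0] by simp
  qed
  then have "?a \<in> negligible_tau"
    using zero_order_negligible_if_annihilating[OF rep_G_tau(1)] negligible_tau_if_zero_order[OF rep_G_tau(1)]
    by blast
  then have "abs_G_tau ?a = abs_G_tau 0"
    by (subst abs_G_tau_eq_iff[OF rep_G_tau(1) moderate_tau_0]) simp
  then show "u = w" by (simp add: rep_G_tau(2) zero_G_tau.abs_eq[symmetric])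
qed

lemma moderate_pairing_representatives:
  assumes u: "u \<in> moderate_tau" and v: "v \<in> moderate_S"
  shows "\<epsilon> \<in> {0<..1} \<Longrightarrow> integrable lborel (\<lambda>y. u \<epsilon> y * v \<epsilon> y)" "net_integral u v \<in> moderate_num"
proof -
  obtain N where N: "u \<in> moderate_mN 0 N" using moderate_tau_mN[OF u] .
  then show "net_integral u v \<in> moderate_num" using v by (rule net_integral_moderate)
  show "integrable lborel (\<lambda>y. u \<epsilon> y * v \<epsilon> y)" if "\<epsilon> \<in> {0<..1}"
    using that moderate_mN_slow[OF N] moderate_S_schwartz[OF v] by (simp add: nets_in_def integrable_product)
qed

text \<open>The clauses on representatives tie the two maps to nets: \<open>pairing\<close> is
  defined through chosen representatives, and any others have to give the same class.\<close>

theorem theorem3p8: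
  shows
    "(\<forall>u\<in>(moderate_S :: (real \<Rightarrow> real^'n::finite \<Rightarrow> complex) set).
        u \<in> moderate_tau \<and> embed_S_tau (abs_G_S u) = abs_G_tau u) \<and>
     module_hom scale_S scale_tau (embed_S_tau :: 'n G_S \<Rightarrow> 'n G_tau) \<and>
     continuous_map top_S top_tau (embed_S_tau :: 'n G_S \<Rightarrow> 'n G_tau) \<and>
     inj (embed_S_tau :: 'n G_S \<Rightarrow> 'n G_tau)
     \<and>
     (\<forall>u\<in>(moderate_tau :: (real \<Rightarrow> real^'n \<Rightarrow> complex) set). \<forall>v\<in>moderate_S.
        (\<forall>\<epsilon>\<in>{0<..1}. integrable lborel (\<lambda>y. u \<epsilon> y * v \<epsilon> y)) \<and>
        net_integral u v \<in> moderate_num \<and>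
        pairing (abs_G_tau u) (abs_G_S v) = abs_gcomplex (net_integral u v)) \<and>
     range (pairing :: 'n G_tau \<Rightarrow> 'n G_S \<Rightarrow> gcomplex) \<subseteq> dual_S \<and>
     module_hom scale_tau (\<lambda>l T v. l * T v) (pairing :: 'n G_tau \<Rightarrow> 'n G_S \<Rightarrow> gcomplex) \<and>
     continuous_map top_tau top_dual_S (pairing :: 'n G_tau \<Rightarrow> 'n G_S \<Rightarrow> gcomplex) \<and>
     inj (pairing :: 'n G_tau \<Rightarrow> 'n G_S \<Rightarrow> gcomplex)"
proof (intro conjI ballI)
  show "range (pairing :: 'n G_tau \<Rightarrow> 'n G_S \<Rightarrow> gcomplex) \<subseteq> dual_S"
    using pairing_dual_S by blast
qed (use moderate_S_tau moderate_pairing_representatives in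
    \<open>auto simp: embed_S_tau_abs pairing_abs module_hom_embed_S_tau continuous_map_embed_S_tau
      inj_embed_S_tau module_hom_pairing continuous_map_pairing inj_pairing\<close>)

end
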